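(* There is a quantum algorithm which, given $\varepsilon>0$ and oracle access to an unknown quantum $k$-junta $U\in\mathcal{U}_N$ on $n$ qubits, outputs, with probability at least $9/10$, a classical description of a unitary $\widehat{U}$ with $\mathrm{dist}(U,\widehat{U})\le\varepsilon$, and makes $O\!\left(\frac{k}{\varepsilon}+\frac{4^k}{\varepsilon^2}\right)$ queries to $U$.
   Context: $N=2^n$, $\mathcal{U}_N$ is the set of $N\times N$ unitaries. A unitary $U\in\mathcal{U}_N$ is a quantum $k$-junta if $U=V_S\otimes I_{\overline{S}}$ for some $S\subseteq[n]$ with $|S|=k$ and some $V_S\in\mathcal{U}_{2^k}$ acting on the qubits in $S$ (identity on the remaining qubits). For $A,B\in\mathbb{C}^{N\times N}$, $\mathrm{dist}(A,B):=\min_{\theta\in[0,2\pi)}\frac{1}{\sqrt{2N}}\|e^{i\theta}A-B\|$ with $\|\cdot\|$ the Frobenius norm. An oracle for $U$ maps $|\psi\rangle\mapsto U|\psi\rangle$. *)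

theory Defs
  imports Complex_Main "Jordan_Normal_Form.Matrix"
begin

definition cadjoint :: "complex mat \<Rightarrow> complex mat" where
  "cadjoint A = mat (dim_col A) (dim_row A) (\<lambda>(i,j). cnj (A $$ (j,i)))"

definition is_unitary :: "nat \<Rightarrow> complex mat \<Rightarrow> bool" where
  "is_unitary d U \<longleftrightarrow> U \<in> carrier_mat d d \<and> cadjoint U * U = 1\<^sub>m d"

definition frob_norm :: "complex mat \<Rightarrow> real" where
  "frob_norm A = sqrt (\<Sum>i<dim_row A. \<Sum>j<dim_col A. (cmod (A $$ (i,j)))\<^sup>2)"

definition qdist :: "complex mat \<Rightarrow> complex mat \<Rightarrow> real" where
  "qdist A B = (INF \<theta>\<in>{0..<2*pi}.
      frob_norm (exp (\<i> * complex_of_real \<theta>) \<cdot>\<^sub>m A - B) / sqrt (2 * real (dim_row A)))"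

text \<open>Computational basis states of n qubits are indexed by x < 2^n; qubit i carries bit i of x.\<close>
definition qbit :: "nat \<Rightarrow> nat \<Rightarrow> nat" where
  "qbit x i = x div 2 ^ i mod 2"

definition restrict_idx :: "nat set \<Rightarrow> nat \<Rightarrow> nat" where
  "restrict_idx S x = (let s = sorted_list_of_set S in
      \<Sum>j<length s. qbit x (s ! j) * 2 ^ j)"

text \<open>V_S tensor I_{complement of S}, as a 2^n x 2^n matrix.\<close>
definition embed_on :: "nat \<Rightarrow> nat set \<Rightarrow> complex mat \<Rightarrow> complex mat" where
  "embed_on n S V = mat (2^n) (2^n) (\<lambda>(x,y).
      if (\<forall>i<n. i \<notin> S \<longrightarrow> qbit x i = qbit y i)
      then V $$ (restrict_idx S x, restrict_idx S y) else 0)"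

definition quantum_junta :: "nat \<Rightarrow> nat \<Rightarrow> complex mat \<Rightarrow> bool" where
  "quantum_junta n k U \<longleftrightarrow>
     (\<exists>S V. S \<subseteq> {..<n} \<and> card S = k \<and> is_unitary (2^k) V \<and> U = embed_on n S V)"

text \<open>The oracle applied to the n-qubit query register, tensored with identity on an
  M-dimensional workspace: basis index i of the joint space corresponds to (i div M, i mod M).\<close>
definition query_op :: "complex mat \<Rightarrow> nat \<Rightarrow> complex mat" where
  "query_op U M = mat (dim_row U * M) (dim_row U * M) (\<lambda>(i,j).
      if i mod M = j mod M then U $$ (i div M, j div M) else 0)"

fun run_rest :: "complex mat \<Rightarrow> complex mat list \<Rightarrow> complex vec \<Rightarrow> complex vec" where
  "run_rest Q [] \<psi> = \<psi>"
| "run_rest Q (W # Ws) \<psi> = run_rest Q Ws (W *\<^sub>v (Q *\<^sub>v \<psi>))"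

text \<open>A T-query algorithm: W_0, O, W_1, O, ..., O, W_T applied to |0>, with O = U tensor I_M,
  followed by a computational-basis measurement; outcome i yields output out i.\<close>
definition final_state :: "complex mat \<Rightarrow> nat \<Rightarrow> complex mat list \<Rightarrow> complex vec" where
  "final_state U M Ws =
     run_rest (query_op U M) (tl Ws) (hd Ws *\<^sub>v unit_vec (dim_row U * M) 0)"

definition num_queries :: "complex mat list \<Rightarrow> nat" where
  "num_queries Ws = length Ws - 1"

definition valid_algorithm ::
  "nat \<Rightarrow> nat \<Rightarrow> complex mat list \<Rightarrow> (nat \<Rightarrow> complex mat) \<Rightarrow> bool" where
  "valid_algorithm n M Ws out \<longleftrightarrow>
     M \<ge> 1 \<and> Ws \<noteq> [] \<and> (\<forall>W\<in>set Ws. is_unitary (2^n * M) W)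
     \<and> (\<forall>i. is_unitary (2^n) (out i))"

definition success_prob ::
  "complex mat \<Rightarrow> nat \<Rightarrow> complex mat list \<Rightarrow> (nat \<Rightarrow> complex mat) \<Rightarrow> real \<Rightarrow> real" where
  "success_prob U M Ws out \<epsilon> =
     (let \<psi> = final_state U M Ws in
      \<Sum>i<dim_row U * M. if qdist U (out i) \<le> \<epsilon> then (cmod (\<psi> $ i))\<^sup>2 else 0)"

end

theory Submission
  imports Defs "HOL-Library.Nat_Bijection"
begin

text \<open>
  Since \<open>k / \<epsilon> \<le> 4 ^ k / \<epsilon>\<^sup>2\<close> for \<open>\<epsilon> \<le> 1\<close>, and every two unitaries are at distance at most \<open>1\<close>, it suffices
  to learn with \<open>O(4 ^ k / \<epsilon>\<^sup>2)\<close> queries when \<open>\<epsilon> \<le> 1\<close>. All queries are separate experiments: prepare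
  an input that depends on the earlier outcomes, query once, measure.

  First \<open>O(k / \<epsilon>\<^sup>2)\<close> Bell measurements of the Choi state sample Paulis \<open>P\<close> with probability the squared
  modulus of the Pauli coefficient of \<open>U\<close>. The union \<open>T\<close> of their supports lies in the junta set, and
  the expected Pauli mass outside \<open>T\<close> is small because each uncovered sample enlarges \<open>T\<close>.

  The remaining \<open>4 ^ |T|\<close> coefficients are estimated linearly. If a state \<open>\<psi>\<close> has amplitude \<open>\<rho>\<close> on a
  reference vector, spreading that vector uniformly over \<open>d\<close> coordinates and interfering it with \<open>\<psi>\<close>
  gives an unbiased estimator of the vector \<open>cnj \<rho> * \<psi> i\<close> with second moment \<open>4 * d\<close>, so that \<open>m\<close> samples
  have squared error \<open>O(d / m)\<close>. A reference for the Choi state is a column \<open>U|x\<rangle>\<close> at a random \<open>x\<close>, put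
  in superposition with it. This needs a known vector with constant overlap with \<open>U|x\<rangle>\<close>; as the
  column has dimension only \<open>2 ^ k\<close>, it can be found by the same estimator with a measured entry of the
  column, of squared modulus \<open>\<Omega>(1 / 2 ^ k)\<close>, as the reference, at the cost of \<open>O(4 ^ k)\<close> samples.

  The output is any unitary whose Pauli coefficients fit the estimate up to a scalar, so no
  rounding of the estimate to a unitary is needed.
\<close>

section \<open>Extending orthonormal families\<close>

definition ip :: "'a set \<Rightarrow> ('a \<Rightarrow> complex) \<Rightarrow> ('a \<Rightarrow> complex) \<Rightarrow> complex" where
  "ip I f g = (\<Sum>i\<in>I. cnj (f i) * g i)"

lemma ip_diff_left: "ip I (\<lambda>i. f i - g i) h = ip I f h - ip I g h"
  and ip_diff_right: "ip I h (\<lambda>i. f i - g i) = ip I h f - ip I h g"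
  by (simp_all add: ip_def algebra_simps sum_subtractf)

lemma ip_scale_left: "ip I (\<lambda>i. c * f i) g = cnj c * ip I f g"
  and ip_scale_right: "ip I g (\<lambda>i. c * f i) = c * ip I g f"
  by (simp_all add: ip_def sum_distrib_left mult_ac)

lemma cnj_ip: "cnj (ip I f g) = ip I g f"
  by (simp add: ip_def mult.commute)

lemma cnj_mult_self: "cnj z * z = of_real ((cmod z)\<^sup>2)"
  by (metis complex_norm_square mult.commute)

lemma ip_self: "ip I f f = of_real (\<Sum>i\<in>I. (cmod (f i))\<^sup>2)"
  by (simp only: ip_def cnj_mult_self of_real_sum)

lemma ip_basis_left:
  assumes "finite I" "a \<in> I"
  shows "ip I (\<lambda>i. of_bool (i = a)) g = g a"
proof -
  have "ip I (\<lambda>i. of_bool (i = a)) g = (\<Sum>i\<in>I. if i = a then g i else 0)"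
    unfolding ip_def by (rule sum.cong) auto
  then show ?thesis using assms by simp
qed

lemma ip_cong: "(\<And>i. i \<in> I \<Longrightarrow> f i = f' i) \<Longrightarrow> (\<And>i. i \<in> I \<Longrightarrow> g i = g' i) \<Longrightarrow> ip I f g = ip I f' g'"
  by (simp add: ip_def)

text \<open>Householder reflection along \<open>u\<close>. Where \<open>ip I u u = 0\<close>,
  division by zero yields 0 and the map is the identity.\<close>

definition reflect :: "'a set \<Rightarrow> ('a \<Rightarrow> complex) \<Rightarrow> ('a \<Rightarrow> complex) \<Rightarrow> 'a \<Rightarrow> complex" where
  "reflect I u v = (\<lambda>i. v i - (2 * ip I u v / ip I u u) * u i)"

lemma ip_reflect: "ip I (reflect I u v) (reflect I u w) = ip I v w"
proof (cases "ip I u u = 0")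
  case True
  then show ?thesis by (simp add: reflect_def)
next
  case False
  have c: "cnj (ip I u u) = ip I u u" and c': "cnj (ip I u v) = ip I v u" by (simp_all add: cnj_ip)
  show ?thesis
    unfolding reflect_def ip_diff_left ip_diff_right ip_scale_left ip_scale_right
    using False by (simp add: c c' field_simps)
qed

text \<open>For \<open>u\<close> the difference of \<open>x\<close> and \<open>y\<close>, equal
  norms together with a real inner product (\<open>ip I x y = ip I y x\<close>) give
  \<open>ip I u u = 2 * ip I u x\<close>, so the reflection subtracts exactly \<open>u\<close> from
  \<open>x\<close>.\<close>

lemma reflect_diff:
  assumes "finite I" "ip I x x = ip I y y" "ip I x y = ip I y x" "i \<in> I"
  shows "reflect I (\<lambda>i. x i - y i) x i = y i"
proof (cases "ip I x x = ip I x y")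
  case True
  have "ip I (\<lambda>i. x i - y i) (\<lambda>i. x i - y i) = 0"
    using True assms by (simp add: ip_diff_left ip_diff_right)
  then have "(\<Sum>i\<in>I. (cmod (x i - y i))\<^sup>2) = 0"
    by (simp only: ip_self of_real_eq_0_iff)
  then have "x i = y i" using assms by (simp add: sum_nonneg_eq_0_iff)
  then show ?thesis by (simp add: reflect_def)
next
  case False
  let ?u = "\<lambda>i. x i - y i"
  have "ip I ?u ?u = 2 * ip I ?u x"
    using assms by (simp add: ip_diff_left ip_diff_right)
  moreover have "ip I ?u x \<noteq> 0" using False assms by (simp add: ip_diff_left)
  ultimately have "2 * ip I ?u x / ip I ?u ?u = 1" by simp
  then show ?thesis unfolding reflect_def by simp
qed

lemma reflect_orthogonal: "ip I u v = 0 \<Longrightarrow> reflect I u v i = v i"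
  by (simp add: reflect_def)

text \<open>Induction on \<open>A\<close>: if the orthonormal family \<open>K\<close> extends
  \<open>f\<close> on \<open>A\<close>, a reflection carries \<open>K a\<close> to a phase multiple
  of \<open>f a\<close>. It preserves all inner products and fixes \<open>K b\<close> for
  \<open>b \<in> A\<close>, which is orthogonal to both \<open>K a\<close> and \<open>f a\<close>.
  The phase is then undone at index \<open>a\<close> alone.\<close>

lemma orthonormal_extension:
  assumes "finite I" "finite A" "A \<subseteq> I"
    and "\<And>a b. a \<in> A \<Longrightarrow> b \<in> A \<Longrightarrow> ip I (f a) (f b) = of_bool (a = b)"
  shows "\<exists>K. (\<forall>a\<in>I. \<forall>b\<in>I. ip I (K a) (K b) = of_bool (a = b)) \<and> (\<forall>a\<in>A. \<forall>i\<in>I. K a i = f a i)"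
  using assms(2-)
proof (induction A rule: finite_induct)
  case empty
  show ?case
    by (rule exI[of _ "\<lambda>a i. of_bool (i = a)"]) (use \<open>finite I\<close> in \<open>auto simp: ip_basis_left\<close>)
next
  case (insert a A)
  obtain K where K: "\<And>b c. b \<in> I \<Longrightarrow> c \<in> I \<Longrightarrow> ip I (K b) (K c) = of_bool (b = c)"
    and Kf: "\<And>b i. b \<in> A \<Longrightarrow> i \<in> I \<Longrightarrow> K b i = f b i"
    using insert.IH insert.prems by (metis insertI2 insert_subset)
  have aI: "a \<in> I" and AI: "A \<subseteq> I" using insert.prems by auto
  define z where "z = ip I (K a) (f a)"
  \<comment> \<open>This phase turns \<open>ip I (K a) (f a)\<close> into its modulus, because
    \<open>reflect_diff\<close> needs a real inner product.\<close>
  define w where "w = (if z = 0 then 1 else cnj (sgn z))"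
  have ww: "cnj w * w = 1"
    unfolding cnj_mult_self by (simp add: w_def norm_sgn)
  have "w * z = of_real (cmod z)"
    using cnj_mult_self[of z] by (simp add: w_def sgn_eq power2_eq_square)
  then have wz: "w * z = cnj (w * z)" by simp
  define g where "g = (\<lambda>i. w * f a i)"
  define u where "u = (\<lambda>i. K a i - g i)"
  have faa: "ip I (f a) (f a) = 1" using insert.prems by simp
  have gg: "ip I (K a) (K a) = ip I g g"
    using K[OF aI aI] faa ww by (simp add: g_def ip_scale_left ip_scale_right mult.assoc[symmetric])
  have kg: "ip I (K a) g = w * z" by (simp add: g_def ip_scale_right z_def)
  have sym: "ip I (K a) g = ip I g (K a)"
    using wz kg by (metis cnj_ip)
  have Ra: "reflect I u (K a) i = g i" if "i \<in> I" for i
    unfolding u_def using reflect_diff[OF \<open>finite I\<close> gg sym that] .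
  have Rb: "reflect I u (K b) i = f b i" if "b \<in> A" "i \<in> I" for b i
  proof -
    have "ip I (f a) (K b) = ip I (f a) (f b)"
      by (rule ip_cong) (use Kf that in auto)
    also have "\<dots> = 0" using insert.prems that insert.hyps by auto
    finally have "ip I u (K b) = 0"
      using K[OF aI, of b] AI that insert.hyps by (auto simp: u_def ip_diff_left g_def ip_scale_left)
    then show ?thesis using Kf that by (simp add: reflect_orthogonal)
  qed
  define K' where "K' = (\<lambda>b i. (if b = a then cnj w else 1) * reflect I u (K b) i)"
  have wc: "w * cnj w = 1" using ww by (simp add: mult.commute)
  have "ip I (K' b) (K' c) = of_bool (b = c)" if "b \<in> I" "c \<in> I" for b c
    unfolding K'_def ip_scale_left ip_scale_right ip_reflect K[OF that] using wc by auto
  moreover have "K' b i = f b i" if "b \<in> insert a A" "i \<in> I" for b i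
    using that Ra Rb insert.hyps ww by (auto simp: K'_def g_def mult.assoc[symmetric])
  ultimately show ?case by blast
qed

text \<open>Gates of the circuit below are specified only on the columns that matter; this completes
  them.\<close>

lemma unitary_extension:
  assumes "A \<subseteq> {..<N}"
    and "\<And>a b. a \<in> A \<Longrightarrow> b \<in> A \<Longrightarrow> ip {..<N} (f a) (f b) = of_bool (a = b)"
  shows "\<exists>W. is_unitary N W \<and> (\<forall>a\<in>A. \<forall>i<N. W $$ (i, a) = f a i)"
proof -
  obtain K where K: "\<And>b c. b < N \<Longrightarrow> c < N \<Longrightarrow> ip {..<N} (K b) (K c) = of_bool (b = c)"
    and Kf: "\<And>b i. b \<in> A \<Longrightarrow> i < N \<Longrightarrow> K b i = f b i"
    using orthonormal_extension[OF finite_lessThan finite_subset[OF assms(1) finite_lessThan] assms] by (metis lessThan_iff)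
  let ?W = "mat N N (\<lambda>(i, a). K a i)"
  have "cadjoint ?W * ?W = 1\<^sub>m N"
    by (rule eq_matI) (use K in \<open>auto simp: cadjoint_def scalar_prod_def ip_def lessThan_atLeast0\<close>)
  then have "is_unitary N ?W" by (simp add: is_unitary_def)
  moreover have "\<forall>a\<in>A. \<forall>i<N. ?W $$ (i, a) = f a i" using Kf assms(1) by auto
  ultimately show ?thesis by blast
qed

section \<open>Simulating adaptive single-query experiments\<close>

lemma pair_index_bounds:
  assumes "bij_betw e A {..<N::nat}" "bij_betw c Y {..<M::nat}" "a \<in> A" "y \<in> Y"
  shows "(e a * M + c y) div M = e a" "(e a * M + c y) mod M = c y" "e a * M + c y < N * M"
proof -
  have ea: "e a < N" and cy: "c y < M" using assms bij_betwE by blast+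
  then show "(e a * M + c y) div M = e a" "(e a * M + c y) mod M = c y" by auto
  have "e a * M + c y < Suc (e a) * M" using cy by simp
  also have "\<dots> \<le> N * M" using ea by (intro mult_right_mono) auto
  finally show "e a * M + c y < N * M" .
qed

lemma bij_betw_pair_index:
  assumes e: "bij_betw e A {..<N::nat}" and c: "bij_betw c Y {..<M::nat}"
  shows "bij_betw (\<lambda>(a, y). e a * M + c y) (A \<times> Y) {..<N * M}"
proof -
  let ?f = "\<lambda>(a, y). e a * M + c y"
  note b = pair_index_bounds[OF e c]
  have inj: "inj_on ?f (A \<times> Y)"
  proof (rule inj_onI, clarsimp)
    fix a y a' y' assume *: "a \<in> A" "y \<in> Y" "a' \<in> A" "y' \<in> Y" "e a * M + c y = e a' * M + c y'"
    then have "e a = e a'" "c y = c y'" using b by metis+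
    then show "a = a' \<and> y = y'" using * e c by (meson bij_betw_imp_inj_on inj_onD)
  qed
  moreover have "?f ` (A \<times> Y) = {..<N * M}"
  proof (rule card_subset_eq)
    show "?f ` (A \<times> Y) \<subseteq> {..<N * M}" using b(3) by auto
    show "card (?f ` (A \<times> Y)) = card {..<N * M}"
      using card_image[OF inj] bij_betw_same_card[OF e] bij_betw_same_card[OF c] by (simp add: card_cartesian_product)
  qed auto
  ultimately show ?thesis by (simp add: bij_betw_def)
qed

section \<open>Adaptive experiments and the circuit that records their history\<close>

fun adaptive_expect :: "('o list \<Rightarrow> 'o \<Rightarrow> real) \<Rightarrow> 'o set \<Rightarrow> nat \<Rightarrow> 'o list \<Rightarrow> ('o list \<Rightarrow> real) \<Rightarrow> real" where
  "adaptive_expect P X 0 h f = f h"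
| "adaptive_expect P X (Suc q) h f = (\<Sum>x\<in>X. P h x * adaptive_expect P X q (h @ [x]) f)"

lemma adaptive_expect_add:
  "adaptive_expect P X (a + b) h f = adaptive_expect P X a h (\<lambda>h'. adaptive_expect P X b h' f)"
  by (induction a arbitrary: h) auto

lemma run_rest_snoc: "run_rest A (Ws @ [W]) \<psi> = W *\<^sub>v (A *\<^sub>v run_rest A Ws \<psi>)"
  by (induction Ws arbitrary: \<psi>) auto

text \<open>\<open>frame\<close> says that the rank-one operators of the vectors
  \<open>m h o'\<close> sum to the identity, so a measurement may have more outcomes than the
  dimension. \<open>unit\<close> and \<open>frame\<close> are required for every list
  \<open>h\<close>, even one that cannot occur as a history.\<close>

locale adaptive_queries =
  fixes n :: nat and Q :: "'q set" and enc :: "'q \<Rightarrow> nat" and W :: "'w set" and X :: "'o set"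
    and s :: "'o list \<Rightarrow> 'q \<times> 'w \<Rightarrow> complex" and m :: "'o list \<Rightarrow> 'o \<Rightarrow> 'q \<times> 'w \<Rightarrow> complex"
  assumes enc: "bij_betw enc Q {..<2 ^ n}" and finW: "finite W" and finX: "finite X"
    and unit: "\<And>h. ip (Q \<times> W) (s h) (s h) = 1"
    and frame: "\<And>h x y. x \<in> Q \<times> W \<Longrightarrow> y \<in> Q \<times> W \<Longrightarrow>
      (\<Sum>o'\<in>X. m h o' x * cnj (m h o' y)) = of_bool (x = y)"
begin

definition queried :: "complex mat \<Rightarrow> 'o list \<Rightarrow> 'q \<times> 'w \<Rightarrow> complex" where
  "queried U h = (\<lambda>(a, w). \<Sum>b\<in>Q. U $$ (enc a, enc b) * s h (b, w))"

definition amp :: "complex mat \<Rightarrow> 'o list \<Rightarrow> 'o \<Rightarrow> complex" where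
  "amp U h x = ip (Q \<times> W) (m h x) (queried U h)"

definition out_prob :: "complex mat \<Rightarrow> 'o list \<Rightarrow> 'o \<Rightarrow> real" where
  "out_prob U h x = (cmod (amp U h x))\<^sup>2"

definition hist_amp :: "complex mat \<Rightarrow> 'o list \<Rightarrow> complex" where
  "hist_amp U h = (\<Prod>i<length h. amp U (take i h) (h ! i))"

lemma hist_amp_Nil [simp]: "hist_amp U [] = 1"
  by (simp add: hist_amp_def)

lemma hist_amp_snoc [simp]: "hist_amp U (h @ [x]) = hist_amp U h * amp U h x"
  by (simp add: hist_amp_def nth_append)

lemma lists_Suc:
  "{h. set h \<subseteq> X \<and> length h = Suc q} = (\<lambda>(h, x). h @ [x]) ` ({h. set h \<subseteq> X \<and> length h = q} \<times> X)"
proof (intro equalityI subsetI)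
  fix h assume h: "h \<in> {h. set h \<subseteq> X \<and> length h = Suc q}"
  then obtain h' x where hx: "h = h' @ [x]" by (cases h rule: rev_cases) auto
  show "h \<in> (\<lambda>(h, x). h @ [x]) ` ({h. set h \<subseteq> X \<and> length h = q} \<times> X)"
    using h hx by (auto intro!: image_eqI[of _ _ "(h', x)"])
qed auto

lemma sum_lists_Suc:
  fixes F :: "'o list \<Rightarrow> 'b :: comm_monoid_add"
  shows "(\<Sum>h | set h \<subseteq> X \<and> length h = Suc q. F h) = (\<Sum>h | set h \<subseteq> X \<and> length h = q. \<Sum>x\<in>X. F (h @ [x]))"
  unfolding lists_Suc
  by (subst sum.reindex) (auto simp: inj_on_def sum.cartesian_product intro!: sum.cong)

lemma sum_hist_amp:
  "(\<Sum>h | set h \<subseteq> X \<and> length h = q. (cmod (hist_amp U h))\<^sup>2 * f h) = adaptive_expect (out_prob U) X q [] f"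
proof (induction q arbitrary: f)
  case 0
  have "{h. set h \<subseteq> X \<and> length h = 0} = {[]}" by auto
  then show ?case by simp
next
  case (Suc q)
  have "adaptive_expect (out_prob U) X (q + 1) [] f
      = adaptive_expect (out_prob U) X q [] (\<lambda>h. \<Sum>x\<in>X. out_prob U h x * f (h @ [x]))"
    unfolding adaptive_expect_add by simp
  also have "\<dots> = (\<Sum>h | set h \<subseteq> X \<and> length h = Suc q. (cmod (hist_amp U h))\<^sup>2 * f h)"
    unfolding sum_lists_Suc Suc[symmetric]
    by (simp add: sum_distrib_left out_prob_def norm_mult power_mult_distrib mult_ac)
  finally show ?case by simp
qed

text \<open>The workspace holds the whole history: the query register and \<open>W\<close> in state \<open>s h\<close> next to
  the history \<open>h\<close> are, after a query, mapped isometrically to the superposition of the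
  states \<open>s (h @ [x])\<close> next to \<open>h @ [x]\<close> with the outcome amplitudes as coefficients.\<close>

theorem simulation:
  assumes outU: "\<And>h. is_unitary (2 ^ n) (outf h)"
  shows "\<exists>M Ws out. valid_algorithm n M Ws out \<and> num_queries Ws = q \<and>
    (\<forall>U\<in>carrier_mat (2 ^ n) (2 ^ n). success_prob U M Ws out \<epsilon> =
      adaptive_expect (out_prob U) X q [] (\<lambda>h. if qdist U (outf h) \<le> \<epsilon> then 1 else 0))"
proof -
  define H where "H = {h. set h \<subseteq> X \<and> length h \<le> q}"
  have finH: "finite H" unfolding H_def using finite_lists_length_le[OF finX] .
  define M where "M = card (W \<times> H)"
  define N where "N = (2::nat) ^ n"
  obtain c where c: "bij_betw c (W \<times> H) {..<M}"
    using ex_bij_betw_finite_nat[of "W \<times> H"] finW finH unfolding M_def lessThan_atLeast0 by auto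
  define Z where "Z = (Q \<times> W) \<times> H"
  \<comment> \<open>The query register becomes the quotient by \<open>M\<close>, ancilla and history
    the remainder, as in the index convention of \<open>query_op\<close>.\<close>
  define idx where "idx = (\<lambda>((a, w), h). enc a * M + c (w, h))"
  have encN: "bij_betw enc Q {..<N}" using enc by (simp add: N_def)
  have idx: "bij_betw idx Z {..<N * M}"
  proof -
    have "bij_betw (\<lambda>((a, w), h). (a, (w, h))) Z (Q \<times> (W \<times> H))"
      unfolding Z_def by (rule bij_betwI[where g = "\<lambda>(a, (w, h)). ((a, w), h)"]) auto
    from bij_betw_trans[OF this bij_betw_pair_index[OF encN c]]
    show ?thesis by (rule bij_betw_cong[THEN iffD1, rotated]) (auto simp: idx_def)
  qed
  have finZ: "finite Z" using idx bij_betw_finite by blast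
  have idx_lt: "idx z < N * M" if "z \<in> Z" for z using idx that bij_betwE by blast
  have idx_eq: "idx z = idx z' \<longleftrightarrow> z = z'" if "z \<in> Z" "z' \<in> Z" for z z'
    using idx that by (meson bij_betw_imp_inj_on inj_on_eq_iff)
  define dec where "dec = the_inv_into Z idx"
  have dec: "dec (idx z) = z" if "z \<in> Z" for z
    unfolding dec_def using idx that by (simp add: bij_betw_def the_inv_into_f_f)
  have dec_in: "dec i \<in> Z" "idx (dec i) = i" if "i < N * M" for i
    unfolding dec_def using idx that
    by (auto simp: bij_betw_def f_the_inv_into_f intro!: the_inv_into_into)
  have sum_idx: "(\<Sum>i<N * M. F i) = (\<Sum>z\<in>Z. F (idx z))" for F :: "nat \<Rightarrow> 'z::comm_monoid_add"
    using sum.reindex_bij_betw[OF idx, of F] by simp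
  have nonempty: "Q \<times> W \<noteq> {}" using unit[of "[]"] by (auto simp: ip_def)
  have HN: "[] \<in> H" by (simp add: H_def)
  have M1: "M \<ge> 1" unfolding M_def using nonempty HN finW finH by (auto simp: card_gt_0_iff Suc_le_eq)
  have NM: "0 < N * M" using M1 by (simp add: N_def)

  define V where "V F = vec (N * M) (\<lambda>i. F (dec i))" for F :: "('q \<times> 'w) \<times> 'o list \<Rightarrow> complex"
  have mult_V: "A *\<^sub>v V F = V F'"
    if "A \<in> carrier_mat (N * M) (N * M)" "\<And>z'. z' \<in> Z \<Longrightarrow> F' z' = (\<Sum>z\<in>Z. A $$ (idx z', idx z) * F z)"
    for A F F'
  proof (rule eq_vecI)
    fix i assume "i < dim_vec (V F')"
    then have i: "i < N * M" by (simp add: V_def)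
    have "(A *\<^sub>v V F) $ i = (\<Sum>j<N * M. A $$ (i, j) * F (dec j))"
      using i that(1) by (simp add: V_def scalar_prod_def lessThan_atLeast0)
    also have "\<dots> = (\<Sum>z\<in>Z. A $$ (idx (dec i), idx z) * F z)"
      unfolding sum_idx using dec dec_in[OF i] by simp
    also have "\<dots> = V F' $ i" using that(2) dec_in[OF i] i by (simp add: V_def)
    finally show "(A *\<^sub>v V F) $ i = V F' $ i" .
  qed (use that in \<open>simp add: V_def\<close>)

  \<comment> \<open>\<open>G (x, h)\<close> is the image of basis state \<open>x\<close> beside
    history \<open>h\<close>: for each outcome \<open>o'\<close> the amplitude
    \<open>cnj (m h o' x)\<close> times the next input \<open>s (h @ [o'])\<close>, beside the
    extended history.\<close>
  define G where "G = (\<lambda>(x, h) (x', h'). if h' \<noteq> [] \<and> butlast h' = h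
      then cnj (m h (last h') x) * s h' x' else 0)"
  have sum_Z: "(\<Sum>z\<in>Z. F z) = (\<Sum>h\<in>H. \<Sum>x\<in>Q\<times>W. F (x, h))"
    for F :: "('q \<times> 'w) \<times> 'o list \<Rightarrow> complex"
    unfolding Z_def using sum.swap[of "\<lambda>x h. F (x, h)" H "Q \<times> W"] by (simp add: sum.cartesian_product)
  have sum_ext: "(\<Sum>h'\<in>H. if h' \<noteq> [] \<and> butlast h' = h then F h' else 0) = (\<Sum>x\<in>X. F (h @ [x]))"
    if "set h \<subseteq> X" "length h < q" for h and F :: "'o list \<Rightarrow> complex"
  proof -
    have "(\<Sum>h'\<in>H. if h' \<noteq> [] \<and> butlast h' = h then F h' else 0)
        = (\<Sum>h' | h' \<in> H \<and> h' \<noteq> [] \<and> butlast h' = h. F h')"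
      using finH by (simp add: sum.inter_filter)
    also have "{h'. h' \<in> H \<and> h' \<noteq> [] \<and> butlast h' = h} = (\<lambda>x. h @ [x]) ` X"
    proof (intro equalityI subsetI)
      fix h' assume *: "h' \<in> {h'. h' \<in> H \<and> h' \<noteq> [] \<and> butlast h' = h}"
      then have "h' = h @ [last h']" using append_butlast_last_id by fastforce
      moreover have "last h' \<in> X" using * last_in_set[of h'] by (auto simp: H_def)
      ultimately show "h' \<in> (\<lambda>x. h @ [x]) ` X" by (rule image_eqI)
    qed (use that in \<open>auto simp: H_def\<close>)
    also have "(\<Sum>h'\<in>\<dots>. F h') = (\<Sum>x\<in>X. F (h @ [x]))"
      by (subst sum.reindex) (auto simp: inj_on_def)
    finally show ?thesis .
  qed
  \<comment> \<open>Images for different histories have disjoint supports, since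
    \<open>butlast\<close> recovers \<open>h\<close>. For equal histories the normalised inputs
    \<open>s k\<close> drop out and \<open>frame\<close> remains. The bound
    \<open>length h < q\<close> keeps the extended histories inside \<open>H\<close>.\<close>
  have G_ortho: "ip Z (G (x, h)) (G (x', h')) = of_bool ((x, h) = (x', h'))"
    if "x \<in> Q \<times> W" "x' \<in> Q \<times> W" "h \<in> H" "h' \<in> H" "length h < q" "length h' < q" for x x' h h'
  proof (cases "h = h'")
    case False
    then show ?thesis by (auto simp: ip_def G_def split: prod.splits intro!: sum.neutral)
  next
    case True
    have "ip Z (G (x, h)) (G (x', h')) = (\<Sum>k\<in>H. if k \<noteq> [] \<and> butlast k = h
        then m h (last k) x * cnj (m h (last k) x') * ip (Q \<times> W) (s k) (s k) else 0)"
      unfolding ip_def sum_Z using True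
      by (intro sum.cong refl) (auto simp: G_def sum_distrib_left mult_ac)
    also have "\<dots> = (\<Sum>o'\<in>X. m h o' x * cnj (m h o' x'))"
      using that by (subst sum_ext) (auto simp: H_def unit)
    also have "\<dots> = of_bool (x = x')" using frame that by simp
    finally show ?thesis using True by simp
  qed

  \<comment> \<open>When gate \<open>t\<close> acts, only histories of length \<open>t\<close> carry
    amplitude, so only their columns are prescribed.\<close>
  have "\<exists>A. is_unitary (N * M) A \<and> (\<forall>z\<in>Z. \<forall>z'\<in>Z. length (snd z) = t \<longrightarrow> A $$ (idx z', idx z) = G z z')"
    if "t < q" for t
  proof -
    have "\<exists>A. is_unitary (N * M) A \<and> (\<forall>a\<in>idx ` {z\<in>Z. length (snd z) = t}. \<forall>i<N*M.
        A $$ (i, a) = G (dec a) (dec i))"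
    proof (rule unitary_extension)
      fix a b assume *: "a \<in> idx ` {z\<in>Z. length (snd z) = t}" "b \<in> idx ` {z\<in>Z. length (snd z) = t}"
      obtain x h x' h' where xh: "(x, h) \<in> Z" "(x', h') \<in> Z" "length h = t" "length h' = t"
        "a = idx (x, h)" "b = idx (x', h')" using * by auto
      have "ip {..<N*M} (\<lambda>i. G (dec a) (dec i)) (\<lambda>i. G (dec b) (dec i)) = ip Z (G (dec a)) (G (dec b))"
        unfolding ip_def sum_idx using dec by simp
      also have "\<dots> = ip Z (G (x, h)) (G (x', h'))" using xh by (simp add: dec)
      also have "\<dots> = of_bool ((x, h) = (x', h'))"
        by (rule G_ortho) (use xh that in \<open>auto simp: Z_def\<close>)
      finally show "ip {..<N*M} (\<lambda>i. G (dec a) (dec i)) (\<lambda>i. G (dec b) (dec i)) = of_bool (a = b)"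
        using xh by (simp add: idx_eq)
    qed (use idx_lt in auto)
    then obtain A where "is_unitary (N * M) A" and
      A: "\<And>a i. a \<in> idx ` {z\<in>Z. length (snd z) = t} \<Longrightarrow> i < N*M \<Longrightarrow> A $$ (i, a) = G (dec a) (dec i)"
      by blast
    moreover have "A $$ (idx z', idx z) = G z z'" if "z \<in> Z" "z' \<in> Z" "length (snd z) = t" for z z'
      using A[of "idx z" "idx z'"] that by (simp add: dec idx_lt)
    ultimately show ?thesis by blast
  qed
  then obtain A where A: "\<And>t. t < q \<Longrightarrow> is_unitary (N * M) (A t)"
    and AG: "\<And>t z z'. t < q \<Longrightarrow> z \<in> Z \<Longrightarrow> z' \<in> Z \<Longrightarrow> length (snd z) = t \<Longrightarrow> A t $$ (idx z', idx z) = G z z'"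
    by metis
  define S0 where "S0 = (\<lambda>(x, h::'o list). if h = [] then s [] x else 0)"
  obtain A0 where A0: "is_unitary (N * M) A0" and A0s: "\<And>i. i < N * M \<Longrightarrow> A0 $$ (i, 0) = S0 (dec i)"
  proof -
    have "ip {..<N*M} (\<lambda>i. S0 (dec i)) (\<lambda>i. S0 (dec i)) = ip Z S0 S0"
      unfolding ip_def sum_idx using dec by simp
    also have "\<dots> = (\<Sum>h\<in>H. if h = [] then ip (Q \<times> W) (s []) (s []) else 0)"
      unfolding ip_def sum_Z by (intro sum.cong refl) (auto simp: S0_def)
    also have "\<dots> = 1" using HN finH by (simp add: unit)
    finally show ?thesis
      using that unitary_extension[of "{0}" "N * M" "\<lambda>_ i. S0 (dec i)"] NM by auto
  qed
  define Ws where "Ws = A0 # map A [0..<q]"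
  define out where "out i = outf (snd (dec i))" for i
  have "valid_algorithm n M Ws out"
    using M1 A A0 outU by (auto simp: valid_algorithm_def Ws_def out_def N_def)
  moreover have "num_queries Ws = q" by (simp add: num_queries_def Ws_def)
  moreover have "success_prob U M Ws out \<epsilon> =
      adaptive_expect (out_prob U) X q [] (\<lambda>h. if qdist U (outf h) \<le> \<epsilon> then 1 else 0)"
    if U: "U \<in> carrier_mat (2 ^ n) (2 ^ n)" for U
  proof -
    have dU: "dim_row U = N" using U by (simp add: N_def)
    \<comment> \<open>\<open>F t\<close> is the state after \<open>t\<close> queries and the gate
      following them, with the next input prepared; \<open>F' t\<close> is the state after one
      further query.\<close>
    define F where "F t = (\<lambda>(x, h). if length h = t then hist_amp U h * s h x else 0)" for t
    define F' where "F' t = (\<lambda>(x, h). if length h = t then hist_amp U h * queried U h x else 0)" for t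
    let ?O = "query_op U M"
    have O: "?O \<in> carrier_mat (N * M) (N * M)" by (simp add: query_op_def dU)
    have O_entry: "?O $$ (idx ((a, w), h), idx ((b, w'), h')) = (if (w, h) = (w', h') then U $$ (enc a, enc b) else 0)"
      if "((a, w), h) \<in> Z" "((b, w'), h') \<in> Z" for a w h b w' h'
    proof -
      have wh: "a \<in> Q" "b \<in> Q" "(w, h) \<in> W \<times> H" "(w', h') \<in> W \<times> H" using that by (auto simp: Z_def)
      have cc: "c (w, h) = c (w', h') \<longleftrightarrow> (w, h) = (w', h')"
        by (rule inj_on_eq_iff[OF bij_betw_imp_inj_on[OF c] wh(3,4)])
      show ?thesis
        using idx_lt[OF that(1)] idx_lt[OF that(2)] pair_index_bounds[OF encN c wh(1,3)]
          pair_index_bounds[OF encN c wh(2,4)] cc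
        by (auto simp: query_op_def dU idx_def)
    qed
    have OF: "?O *\<^sub>v V (F t) = V (F' t)" for t
    proof (rule mult_V[OF O])
      fix z' assume z': "z' \<in> Z"
      obtain a w h where z: "z' = ((a, w), h)" by (metis prod.exhaust)
      have wW: "w \<in> W" "h \<in> H" "a \<in> Q" using z' z by (auto simp: Z_def)
      have "(\<Sum>z\<in>Z. ?O $$ (idx z', idx z) * F t z)
          = (\<Sum>h'\<in>H. \<Sum>b\<in>Q. \<Sum>w'\<in>W. ?O $$ (idx z', idx ((b, w'), h')) * F t ((b, w'), h'))"
        unfolding sum_Z by (simp add: sum.cartesian_product)
      also have "\<dots> = (\<Sum>h'\<in>H. \<Sum>b\<in>Q. \<Sum>w'\<in>W. if w' = w then (if h' = h then U $$ (enc a, enc b) * F t ((b, w), h) else 0) else 0)"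
        unfolding z by (intro sum.cong refl, subst O_entry) (use wW in \<open>auto simp: Z_def\<close>)
      also have "\<dots> = (\<Sum>h'\<in>H. if h' = h then \<Sum>b\<in>Q. U $$ (enc a, enc b) * F t ((b, w), h) else 0)"
        using wW finW by (intro sum.cong refl) auto
      also have "\<dots> = (\<Sum>b\<in>Q. U $$ (enc a, enc b) * F t ((b, w), h))"
        using wW finH by simp
      also have "\<dots> = F' t z'"
        by (auto simp: z F_def F'_def queried_def sum_distrib_left mult_ac)
      finally show "F' t z' = (\<Sum>z\<in>Z. ?O $$ (idx z', idx z) * F t z)" by simp
    qed
    have AF: "A t *\<^sub>v V (F' t) = V (F (Suc t))" if t: "t < q" for t
    proof (rule mult_V)
      show "A t \<in> carrier_mat (N * M) (N * M)" using A[OF t] by (simp add: is_unitary_def)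
      fix z' assume z': "z' \<in> Z"
      obtain x' k where z: "z' = (x', k)" by (metis prod.exhaust)
      have kH: "k \<in> H" "x' \<in> Q \<times> W" using z' z by (auto simp: Z_def)
      have "(\<Sum>z\<in>Z. A t $$ (idx z', idx z) * F' t z)
          = (\<Sum>h\<in>H. \<Sum>x\<in>Q\<times>W. A t $$ (idx z', idx (x, h)) * F' t (x, h))"
        by (rule sum_Z)
      also have "\<dots> = (\<Sum>h\<in>H. if length h = t then \<Sum>x\<in>Q\<times>W. G (x, h) z' * (hist_amp U h * queried U h x) else 0)"
        using AG[OF t _ z'] by (intro sum.cong refl) (auto simp: F'_def Z_def intro!: sum.cong)
      also have "\<dots> = F (Suc t) z'"
      proof (cases "k \<noteq> [] \<and> length k = Suc t")
        case False
        have "(\<Sum>h\<in>H. if length h = t then \<Sum>x\<in>Q\<times>W. G (x, h) z' * (hist_amp U h * queried U h x) else 0) = 0"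
          using False by (intro sum.neutral ballI) (auto simp: G_def z intro!: sum.neutral)
        then show ?thesis using False by (auto simp: F_def z)
      next
        case True
        then obtain h0 o0 where k: "k = h0 @ [o0]" by (metis append_butlast_last_id)
        have h0: "h0 \<in> H" "length h0 = t" using kH True k by (auto simp: H_def)
        have "(\<Sum>h\<in>H. if length h = t then \<Sum>x\<in>Q\<times>W. G (x, h) z' * (hist_amp U h * queried U h x) else 0)
           = (\<Sum>h\<in>H. if h = h0 then \<Sum>x\<in>Q\<times>W. G (x, h0) z' * (hist_amp U h0 * queried U h0 x) else 0)"
          using h0 by (intro sum.cong refl) (auto simp: G_def z k)
        also have "\<dots> = (\<Sum>x\<in>Q\<times>W. G (x, h0) z' * (hist_amp U h0 * queried U h0 x))"
          using h0 finH by simp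
        also have "\<dots> = F (Suc t) z'"
          using h0 by (simp add: G_def z k F_def amp_def ip_def sum_distrib_left mult_ac)
        finally show ?thesis .
      qed
      finally show "F (Suc t) z' = (\<Sum>z\<in>Z. A t $$ (idx z', idx z) * F' t z)" by simp
    qed
    have init: "A0 *\<^sub>v unit_vec (N * M) 0 = V (F 0)"
    proof (rule eq_vecI)
      fix i assume "i < dim_vec (V (F 0))"
      then have i: "i < N * M" by (simp add: V_def)
      have d: "A0 \<in> carrier_mat (N * M) (N * M)" using A0 by (simp add: is_unitary_def)
      have "(A0 *\<^sub>v unit_vec (N * M) 0) $ i = A0 $$ (i, 0)"
        using i d NM by (simp add: scalar_prod_def unit_vec_def if_distrib cong: if_cong)
      then show "(A0 *\<^sub>v unit_vec (N * M) 0) $ i = V (F 0) $ i"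
        using i A0s[OF i] by (auto simp: V_def S0_def F_def split: prod.splits)
    qed (use A0 in \<open>auto simp: V_def is_unitary_def\<close>)
    have "run_rest ?O (map A [0..<t]) (V (F 0)) = V (F t)" if "t \<le> q" for t
      using that
    proof (induction t)
      case (Suc t)
      then show ?case using OF AF by (simp add: run_rest_snoc)
    qed simp
    then have fin: "final_state U M Ws = V (F q)"
      by (simp add: final_state_def Ws_def dU init)
    define g where "g h = (if qdist U (outf h) \<le> \<epsilon> then 1 else 0 :: real)" for h
    have "success_prob U M Ws out \<epsilon> = (\<Sum>i<N*M. (cmod (F q (dec i)))\<^sup>2 * g (snd (dec i)))"
      unfolding success_prob_def fin Let_def dU
      by (intro sum.cong refl) (auto simp: V_def out_def g_def)
    also have "\<dots> = (\<Sum>z\<in>Z. (cmod (F q z))\<^sup>2 * g (snd z))"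
      unfolding sum_idx using dec by simp
    also have "\<dots> = (\<Sum>h\<in>H. \<Sum>x\<in>Q\<times>W. (cmod (F q (x, h)))\<^sup>2 * g h)"
      unfolding Z_def using sum.swap[of "\<lambda>x h. (cmod (F q (x, h)))\<^sup>2 * g h" H "Q \<times> W"] by (simp add: sum.cartesian_product split_beta)
    \<comment> \<open>The last gate has prepared one more input \<open>s h\<close> that is never
      queried; its unit norm leaves the squared history amplitude as the probability of
      \<open>h\<close>.\<close>
    also have "\<dots> = (\<Sum>h\<in>H. if length h = q then (cmod (hist_amp U h))\<^sup>2 * g h else 0)"
    proof (intro sum.cong refl)
      fix h
      have "(\<Sum>x\<in>Q\<times>W. (cmod (s h x))\<^sup>2) = 1"
        using unit[of h] unfolding ip_self by (simp only: of_real_eq_1_iff)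
      then show "(\<Sum>x\<in>Q\<times>W. (cmod (F q (x, h)))\<^sup>2 * g h) = (if length h = q then (cmod (hist_amp U h))\<^sup>2 * g h else 0)"
        by (auto simp: F_def norm_mult power_mult_distrib simp flip: sum_distrib_left sum_distrib_right)
    qed
    also have "\<dots> = (\<Sum>h | set h \<subseteq> X \<and> length h = q. (cmod (hist_amp U h))\<^sup>2 * g h)"
      using finH by (simp add: sum.inter_filter[symmetric]) (auto simp: H_def intro!: sum.cong)
    also have "\<dots> = adaptive_expect (out_prob U) X q [] g" by (rule sum_hist_amp)
    finally show ?thesis unfolding g_def .
  qed
  ultimately show ?thesis by blast
qed

end

section \<open>Expectations over independent samples\<close>

fun iid_expect :: "('o \<Rightarrow> real) \<Rightarrow> 'o set \<Rightarrow> nat \<Rightarrow> ('o list \<Rightarrow> real) \<Rightarrow> real" where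
  "iid_expect p X 0 f = f []"
| "iid_expect p X (Suc q) f = (\<Sum>x\<in>X. p x * iid_expect p X q (\<lambda>l. f (x # l)))"

text \<open>Turns a stage whose experiment does not depend on the outcomes within that stage into
  independent sampling.\<close>

lemma adaptive_expect_iid:
  assumes "\<And>l. length l < q \<Longrightarrow> P (h @ l) = p"
  shows "adaptive_expect P X q h f = iid_expect p X q (\<lambda>l. f (h @ l))"
  using assms
proof (induction q arbitrary: h)
  case (Suc q)
  have "adaptive_expect P X q (h @ [x]) f = iid_expect p X q (\<lambda>l. f ((h @ [x]) @ l))" for x
    using Suc.prems[of "x # _"] by (intro Suc.IH) simp
  then show ?case using Suc.prems[of "[]"] by simp
qed simp

lemma iid_expect_add: "iid_expect p X q (\<lambda>l. f l + g l) = iid_expect p X q f + iid_expect p X q g"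
  by (induction q arbitrary: f g) (simp_all add: distrib_left sum.distrib)

lemma iid_expect_scale: "iid_expect p X q (\<lambda>l. c * f l) = c * iid_expect p X q f"
  by (induction q arbitrary: f) (simp_all add: sum_distrib_left mult_ac)

lemma cmod_add_sq: "(cmod (u + c))\<^sup>2 = (cmod u)\<^sup>2 + (cmod c)\<^sup>2 + 2 * Re (cnj u * c)"
  unfolding cmod_power2 by (simp add: power2_eq_square algebra_simps)

locale finite_dist =
  fixes p :: "'o \<Rightarrow> real" and X :: "'o set"
  assumes fin: "finite X" and nonneg: "\<And>x. x \<in> X \<Longrightarrow> 0 \<le> p x" and total: "(\<Sum>x\<in>X. p x) = 1"
begin

lemma iid_expect_const: "iid_expect p X q (\<lambda>_. c) = c"
  by (induction q) (simp_all add: total flip: sum_distrib_right)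

text \<open>Restricting the comparison to lists of outcomes with nonzero weight is what later gives
  access to facts that hold only for outcomes that can occur, such as sampled Paulis having support
  in the junta set.\<close>

lemma iid_expect_mono:
  assumes "\<And>l. length l = q \<Longrightarrow> (\<And>x. x \<in> set l \<Longrightarrow> x \<in> X \<and> p x \<noteq> 0) \<Longrightarrow> f l \<le> g l"
  shows "iid_expect p X q f \<le> iid_expect p X q g"
  using assms
proof (induction q arbitrary: f g)
  case (Suc q)
  have "p x * iid_expect p X q (\<lambda>l. f (x # l)) \<le> p x * iid_expect p X q (\<lambda>l. g (x # l))" if "x \<in> X" for x
  proof (cases "p x = 0")
    case False
    have "iid_expect p X q (\<lambda>l. f (x # l)) \<le> iid_expect p X q (\<lambda>l. g (x # l))"
      using that False by (intro Suc.IH Suc.prems) auto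
    then show ?thesis using nonneg[OF that] by (rule mult_left_mono)
  qed simp
  then show ?case by (auto intro: sum_mono)
qed simp

text \<open>Markov's inequality, through the pointwise bound of the indicator of
  \<open>f l \<le> a\<close> from below by \<open>1 - f l / a\<close>.\<close>

lemma iid_expect_Markov:
  assumes "0 < a" "\<And>l. length l = q \<Longrightarrow> (\<And>x. x \<in> set l \<Longrightarrow> x \<in> X \<and> p x \<noteq> 0) \<Longrightarrow> 0 \<le> f l"
    and "iid_expect p X q f \<le> \<delta> * a"
  shows "1 - \<delta> \<le> iid_expect p X q (\<lambda>l. of_bool (f l \<le> a))"
proof -
  have "1 - \<delta> \<le> 1 + (- 1 / a) * iid_expect p X q f" using assms by (simp add: field_simps)
  also have "\<dots> = iid_expect p X q (\<lambda>l. 1 + (- 1 / a) * f l)"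
    by (simp only: iid_expect_add iid_expect_scale iid_expect_const)
  also have "\<dots> \<le> iid_expect p X q (\<lambda>l. of_bool (f l \<le> a))"
    by (rule iid_expect_mono) (use assms(1,2) in \<open>auto simp: field_simps of_bool_def\<close>)
  finally show ?thesis .
qed

text \<open>Chains stages: success \<open>b\<close> on a good event of probability at least
  \<open>1 - \<delta>\<close> gives \<open>b * (1 - \<delta>)\<close>, which is at least
  \<open>b - \<delta>\<close>, so failure probabilities add up.\<close>

lemma iid_expect_good:
  assumes "1 - \<delta> \<le> iid_expect p X q (\<lambda>l. of_bool (G l))" "0 \<le> b" "b \<le> 1" "0 \<le> \<delta>"
    and "\<And>l. length l = q \<Longrightarrow> (\<And>x. x \<in> set l \<Longrightarrow> x \<in> X \<and> p x \<noteq> 0) \<Longrightarrow> G l \<Longrightarrow> b \<le> g l"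
    and "\<And>l. 0 \<le> g l"
  shows "b - \<delta> \<le> iid_expect p X q g"
proof -
  have "\<delta> * b \<le> \<delta> * 1" using assms by (intro mult_left_mono) auto
  then have "b - \<delta> \<le> b * (1 - \<delta>)" by (simp add: algebra_simps)
  also have "\<dots> \<le> b * iid_expect p X q (\<lambda>l. of_bool (G l))" using assms by (intro mult_left_mono) auto
  also have "\<dots> = iid_expect p X q (\<lambda>l. b * of_bool (G l))" by (simp only: iid_expect_scale)
  also have "\<dots> \<le> iid_expect p X q g"
    by (rule iid_expect_mono) (use assms in \<open>auto simp: of_bool_def\<close>)
  finally show ?thesis .
qed

section \<open>Squared error of an empirical mean\<close>

lemma sum_centered_sq:
  fixes c :: "'o \<Rightarrow> complex"
  assumes "(\<Sum>x\<in>X. of_real (p x) * c x) = 0"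
  shows "(\<Sum>x\<in>X. p x * (cmod (u + c x))\<^sup>2) = (cmod u)\<^sup>2 + (\<Sum>x\<in>X. p x * (cmod (c x))\<^sup>2)"
proof -
  have "(\<Sum>x\<in>X. p x * (2 * Re (cnj u * c x))) = 2 * Re (cnj u * (\<Sum>x\<in>X. of_real (p x) * c x))"
    by (simp add: sum_distrib_left mult_ac Re_sum distrib_left right_diff_distrib)
  also have "\<dots> = 0" using assms by simp
  finally show ?thesis
    by (simp only: cmod_add_sq distrib_left sum.distrib sum_distrib_right[symmetric] total)
qed

text \<open>The offset \<open>u\<close> is the part of the sum drawn so far and varies in the
  induction; each new centred sample adds its second moment, as the cross terms average to
  zero.\<close>

lemma iid_expect_sum_sq:
  fixes c :: "'o \<Rightarrow> 'j \<Rightarrow> complex"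
  assumes "\<And>j. j \<in> J \<Longrightarrow> (\<Sum>x\<in>X. of_real (p x) * c x j) = 0"
  shows "iid_expect p X q (\<lambda>l. \<Sum>j\<in>J. (cmod (u j + (\<Sum>x\<leftarrow>l. c x j)))\<^sup>2)
    = (\<Sum>j\<in>J. (cmod (u j))\<^sup>2) + real q * (\<Sum>x\<in>X. p x * (\<Sum>j\<in>J. (cmod (c x j))\<^sup>2))"
proof (induction q arbitrary: u)
  case (Suc q)
  let ?V = "\<Sum>x\<in>X. p x * (\<Sum>j\<in>J. (cmod (c x j))\<^sup>2)"
  have "iid_expect p X (Suc q) (\<lambda>l. \<Sum>j\<in>J. (cmod (u j + (\<Sum>x\<leftarrow>l. c x j)))\<^sup>2)
     = (\<Sum>x\<in>X. p x * ((\<Sum>j\<in>J. (cmod (u j + c x j))\<^sup>2) + real q * ?V))"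
    using Suc[of "\<lambda>j. u j + c _ j"] by (simp add: add.assoc)
  also have "\<dots> = (\<Sum>x\<in>X. \<Sum>j\<in>J. p x * (cmod (u j + c x j))\<^sup>2) + real q * ?V"
    by (simp add: distrib_left sum.distrib total flip: sum_distrib_right) (simp add: sum_distrib_left)
  also have "(\<Sum>x\<in>X. \<Sum>j\<in>J. p x * (cmod (u j + c x j))\<^sup>2)
      = (\<Sum>j\<in>J. (cmod (u j))\<^sup>2 + (\<Sum>x\<in>X. p x * (cmod (c x j))\<^sup>2))"
    by (subst sum.swap) (intro sum.cong refl sum_centered_sq assms)
  also have "\<dots> = (\<Sum>j\<in>J. (cmod (u j))\<^sup>2) + ?V"
    by (simp add: sum.distrib sum_distrib_left) (rule sum.swap)
  finally show ?case by (simp add: algebra_simps)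
qed simp

lemma iid_mean_sq_error:
  fixes v :: "'o \<Rightarrow> 'j \<Rightarrow> complex"
  assumes mu: "\<And>j. j \<in> J \<Longrightarrow> \<mu> j = (\<Sum>x\<in>X. of_real (p x) * v x j)"
    and V: "(\<Sum>x\<in>X. p x * (\<Sum>j\<in>J. (cmod (v x j))\<^sup>2)) \<le> V" and q: "0 < q"
  shows "iid_expect p X q (\<lambda>l. \<Sum>j\<in>J. (cmod ((\<Sum>x\<leftarrow>l. v x j) / of_nat q - \<mu> j))\<^sup>2) \<le> V / real q"
proof -
  define c where "c x j = v x j - \<mu> j" for x j
  have tc: "(\<Sum>x\<in>X. complex_of_real (p x)) = 1" by (metis of_real_1 of_real_sum total)
  have c0: "(\<Sum>x\<in>X. of_real (p x) * c x j) = 0" if "j \<in> J" for j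
    using mu[OF that] tc by (simp add: c_def right_diff_distrib sum_subtractf flip: sum_distrib_right)
  let ?Vc = "\<Sum>x\<in>X. p x * (\<Sum>j\<in>J. (cmod (c x j))\<^sup>2)"
  \<comment> \<open>Centring can only lower the second moment: \<open>sum_centered_sq\<close> with
    offset \<open>\<mu> j\<close>.\<close>
  have Vc: "?Vc \<le> V"
  proof -
    have "?Vc = (\<Sum>j\<in>J. \<Sum>x\<in>X. p x * (cmod (c x j))\<^sup>2)"
      by (simp add: sum_distrib_left) (rule sum.swap)
    also have "\<dots> \<le> (\<Sum>j\<in>J. \<Sum>x\<in>X. p x * (cmod (\<mu> j + c x j))\<^sup>2)"
      by (rule sum_mono) (simp add: sum_centered_sq[OF c0])
    also have "\<dots> = (\<Sum>x\<in>X. p x * (\<Sum>j\<in>J. (cmod (v x j))\<^sup>2))"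
      by (simp add: c_def sum_distrib_left) (rule sum.swap)
    finally show ?thesis using V by simp
  qed
  have "iid_expect p X q (\<lambda>l. \<Sum>j\<in>J. (cmod ((\<Sum>x\<leftarrow>l. v x j) / of_nat q - \<mu> j))\<^sup>2)
      \<le> iid_expect p X q (\<lambda>l. (1 / (real q)\<^sup>2) * (\<Sum>j\<in>J. (cmod (0 + (\<Sum>x\<leftarrow>l. c x j)))\<^sup>2))"
  proof (rule iid_expect_mono)
    fix l :: "'o list" assume l: "length l = q"
    have "(cmod ((\<Sum>x\<leftarrow>l. v x j) / of_nat q - \<mu> j))\<^sup>2 = (1 / (real q)\<^sup>2) * (cmod (0 + (\<Sum>x\<leftarrow>l. c x j)))\<^sup>2" for j
    proof -
      have "(\<Sum>x\<leftarrow>l. c x j) = (\<Sum>x\<leftarrow>l. v x j) - of_nat (length l) * \<mu> j"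
        by (induction l) (auto simp: c_def algebra_simps)
      then have "(\<Sum>x\<leftarrow>l. v x j) / of_nat q - \<mu> j = (\<Sum>x\<leftarrow>l. c x j) / of_nat q"
        using q l by (simp add: field_simps)
      then show ?thesis by (simp add: norm_divide power_divide)
    qed
    then show "(\<Sum>j\<in>J. (cmod ((\<Sum>x\<leftarrow>l. v x j) / of_nat q - \<mu> j))\<^sup>2)
        \<le> (1 / (real q)\<^sup>2) * (\<Sum>j\<in>J. (cmod (0 + (\<Sum>x\<leftarrow>l. c x j)))\<^sup>2)"
      by (simp add: sum_distrib_left)
  qed
  also have "\<dots> = (1 / (real q)\<^sup>2) * (real q * ?Vc)"
    unfolding iid_expect_scale using iid_expect_sum_sq[where J = J and c = c and u = "\<lambda>_. 0" and q = q] c0 by simp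
  also have "\<dots> \<le> V / real q" using Vc q by (simp add: power2_eq_square divide_right_mono)
  finally show ?thesis .
qed

end

section \<open>Tight frames and the interference measurement\<close>

lemma sum_Times: "(\<Sum>k\<in>X \<times> Y. F k) = (\<Sum>j\<in>X. \<Sum>z\<in>Y. F (j, z))"
  by (simp add: sum.cartesian_product)

definition tight_frame :: "'x set \<Rightarrow> 'o set \<Rightarrow> ('o \<Rightarrow> 'x \<Rightarrow> complex) \<Rightarrow> bool" where
  "tight_frame X Y m \<longleftrightarrow> (\<forall>x\<in>X. \<forall>y\<in>X. (\<Sum>k\<in>Y. m k x * cnj (m k y)) = of_bool (x = y))"

lemma tight_frame_Parseval:
  assumes "tight_frame X Y m" "finite X"
  shows "(\<Sum>k\<in>Y. cnj (ip X (m k) \<phi>) * ip X (m k) \<psi>) = ip X \<phi> \<psi>"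
proof -
  have "(\<Sum>k\<in>Y. cnj (ip X (m k) \<phi>) * ip X (m k) \<psi>)
      = (\<Sum>k\<in>Y. \<Sum>x\<in>X. \<Sum>y\<in>X. cnj (\<phi> x) * \<psi> y * (m k x * cnj (m k y)))"
    unfolding cnj_ip unfolding ip_def sum_product by (simp add: mult_ac)
  also have "\<dots> = (\<Sum>x\<in>X. \<Sum>y\<in>X. cnj (\<phi> x) * \<psi> y * (\<Sum>k\<in>Y. m k x * cnj (m k y)))"
    unfolding sum_distrib_left by (subst sum.swap, intro sum.cong refl, rule sum.swap)
  also have "\<dots> = (\<Sum>x\<in>X. \<Sum>y\<in>X. if y = x then cnj (\<phi> x) * \<psi> y else 0)"
    using assms(1) by (intro sum.cong refl) (auto simp: tight_frame_def)
  also have "\<dots> = ip X \<phi> \<psi>" using assms(2) by (simp add: ip_def)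
  finally show ?thesis .
qed

lemma tight_frame_norm:
  assumes "tight_frame X Y m" "finite X"
  shows "(\<Sum>k\<in>Y. (cmod (ip X (m k) \<psi>))\<^sup>2) = (\<Sum>x\<in>X. (cmod (\<psi> x))\<^sup>2)"
proof -
  have "of_real (\<Sum>k\<in>Y. (cmod (ip X (m k) \<psi>))\<^sup>2) = complex_of_real (\<Sum>x\<in>X. (cmod (\<psi> x))\<^sup>2)"
    using tight_frame_Parseval[OF assms, of \<psi> \<psi>]
    by (simp only: cnj_mult_self ip_self of_real_sum)
  then show ?thesis by (simp only: of_real_eq_iff)
qed

lemma tight_frame_dist:
  assumes "tight_frame X Y m" "finite X" "finite Y" "ip X \<psi> \<psi> = 1"
  shows "finite_dist (\<lambda>k. (cmod (ip X (m k) \<psi>))\<^sup>2) Y"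
proof
  have "(\<Sum>x\<in>X. (cmod (\<psi> x))\<^sup>2) = 1"
    using assms(4) unfolding ip_self by (simp only: of_real_eq_1_iff)
  then show "(\<Sum>k\<in>Y. (cmod (ip X (m k) \<psi>))\<^sup>2) = 1" using tight_frame_norm[OF assms(1,2)] by simp
qed (use assms in auto)

lemma tight_frame_standard: "finite X \<Longrightarrow> tight_frame X X (\<lambda>j x. of_bool (x = j))"
  by (auto simp: tight_frame_def simp flip: of_bool_conj intro!: sum.neutral)

text \<open>The zero vectors give all measurements the same outcome set.\<close>

definition basis_frame :: "('x \<Rightarrow> 'x \<Rightarrow> complex) \<Rightarrow> 'x \<times> nat \<Rightarrow> 'x \<Rightarrow> complex" where
  "basis_frame B = (\<lambda>(j, z) x. if z = 0 then B j x else 0)"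

lemma sum_lessThan_6: "(\<Sum>z<6. f (z::nat)) = f 0 + f 1 + f 2 + f 3 + f 4 + f 5"
  by (simp add: eval_nat_numeral)

lemma tight_basis_frame:
  assumes "tight_frame X X B"
  shows "tight_frame X (X \<times> {..<6}) (basis_frame B)"
  using assms by (simp add: tight_frame_def sum_Times sum_lessThan_6 basis_frame_def)

text \<open>Interference of the coordinates \<open>B j\<close>, \<open>j \<in> I\<close>, with a uniformly spread copy of the
  reference vector \<open>r\<close> at the four relative phases \<open>\<i> ^ z\<close>, \<open>z < 4\<close>; the outcomes with
  \<open>z \<ge> 4\<close> only complete the measurement.\<close>

definition interference_frame :: "('x \<Rightarrow> 'x \<Rightarrow> complex) \<Rightarrow> 'x set \<Rightarrow> ('x \<Rightarrow> complex) \<Rightarrow> 'x \<times> nat \<Rightarrow> 'x \<Rightarrow> complex" where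
  "interference_frame B I r = (\<lambda>(j, z) x.
     if z < 4 then (if j \<in> I then (B j x + \<i> ^ z * (r x / of_real (sqrt (card I)))) / of_real (sqrt 8) else 0)
     else if z = 4 then (if j \<in> I then 0 else B j x / of_real (sqrt 2))
     else (of_bool (x = j) - cnj (r j) * r x) / of_real (sqrt 2))"

text \<open>The factor and the phase are chosen so that the mean is exactly
  \<open>ip X (B i) \<psi> * cnj (ip X r \<psi>)\<close>: the phase isolates one cross term, and
  \<open>2 * sqrt (card I)\<close> undoes the spreading of \<open>r\<close> and the normalisation by
  \<open>sqrt 8\<close>.\<close>

definition interference_estimate :: "'x set \<Rightarrow> 'x \<times> nat \<Rightarrow> 'x \<Rightarrow> complex" where
  "interference_estimate I = (\<lambda>(j, z) i. if z < 4 \<and> j \<in> I \<and> i = j then 2 * of_real (sqrt (card I)) * (- \<i>) ^ z else 0)"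

section \<open>Completeness, mean and second moment of the interference measurement\<close>

lemma div_sqrt_mult_cnj:
  assumes "0 \<le> c"
  shows "a / of_real (sqrt c) * cnj (b / of_real (sqrt c)) = a * cnj b / of_real c"
  using assms by (simp flip: of_real_mult)

lemma sum_four_phases: "(\<Sum>z<4::nat. (b + \<i> ^ z * u) * cnj (b' + \<i> ^ z * u')) = 4 * (b * cnj b' + u * cnj u')"
  by (simp add: eval_nat_numeral algebra_simps)

text \<open>Let P be the sum of the rank-one operators of \<open>B j\<close> for
  \<open>j \<in> I\<close>, and R that of \<open>r\<close>. The four phases contribute (P + R) / 2,
  \<open>z = 4\<close> contributes (1 - P) / 2, and \<open>z = 5\<close> contributes (1 - R) / 2,
  its vectors being multiples of the images of the standard basis under the projection 1 -
  R.\<close>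

lemma tight_interference_frame:
  assumes X: "finite X" and B: "tight_frame X X B" and I: "I \<subseteq> X" "I \<noteq> {}" and r: "ip X r r = 1"
  shows "tight_frame X (X \<times> {..<6}) (interference_frame B I r)"
  unfolding tight_frame_def
proof (intro ballI)
  fix x y assume xy: "x \<in> X" "y \<in> X"
  let ?m = "interference_frame B I r"
  let ?d = "of_nat (card I) :: complex"
  have finI: "finite I" using X I finite_subset by blast
  have d: "?d \<noteq> 0" using I finI by simp
  have low: "(\<Sum>z<4. ?m (j, z) x * cnj (?m (j, z) y))
      = (if j \<in> I then (B j x * cnj (B j y) + r x * cnj (r y) / ?d) / 2 else 0)" for j
  proof (cases "j \<in> I")
    case True
    have "(\<Sum>z<4. ?m (j, z) x * cnj (?m (j, z) y)) = (\<Sum>z<4::nat.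
        (B j x + \<i> ^ z * (r x / of_real (sqrt (card I)))) * cnj (B j y + \<i> ^ z * (r y / of_real (sqrt (card I)))) / of_real 8)"
      using True by (intro sum.cong refl) (simp only: interference_frame_def prod.case lessThan_iff if_True, rule div_sqrt_mult_cnj, simp)
    also have "\<dots> = (4 * (B j x * cnj (B j y) + r x / of_real (sqrt (card I)) * cnj (r y / of_real (sqrt (card I))))) / of_real 8"
      by (simp only: sum_divide_distrib[symmetric] sum_four_phases)
    also have "\<dots> = (B j x * cnj (B j y) + r x * cnj (r y) / ?d) / 2"
      by (subst div_sqrt_mult_cnj) simp_all
    finally show ?thesis using True by simp
  qed (simp add: interference_frame_def)
  have m4: "?m (j, 4) x * cnj (?m (j, 4) y) = (if j \<in> I then 0 else B j x * cnj (B j y) / 2)" for j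
    using div_sqrt_mult_cnj[of 2 "B j x" "B j y"] by (simp add: interference_frame_def)
  have m5: "?m (j, 5) x * cnj (?m (j, 5) y) = (of_bool (x = j) - cnj (r j) * r x) * cnj (of_bool (y = j) - cnj (r j) * r y) / 2" for j
    using div_sqrt_mult_cnj[of 2 "of_bool (x = j) - cnj (r j) * r x" "of_bool (y = j) - cnj (r j) * r y"]
    by (simp add: interference_frame_def)
  have "(\<Sum>j\<in>X. (of_bool (x = j) - cnj (r j) * r x) * cnj (of_bool (y = j) - cnj (r j) * r y))
     = (\<Sum>j\<in>X. of_bool (x = y \<and> j = x) - (if j = y then cnj (r j) * r x else 0) - (if j = x then r j * cnj (r y) else 0)
         + r x * cnj (r y) * (cnj (r j) * r j))"
    by (intro sum.cong refl) (auto simp: algebra_simps)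
  also have "\<dots> = of_bool (x = y) - cnj (r y) * r x - r x * cnj (r y) + r x * cnj (r y) * ip X r r"
    using X xy by (auto simp: sum.distrib sum_subtractf ip_def simp flip: sum_distrib_left)
  finally have s5: "(\<Sum>j\<in>X. (of_bool (x = j) - cnj (r j) * r x) * cnj (of_bool (y = j) - cnj (r j) * r y))
     = of_bool (x = y) - r x * cnj (r y)"
    using r by simp
  have sI: "(\<Sum>j\<in>X. (if j \<in> I then (B j x * cnj (B j y) + r x * cnj (r y) / ?d) / 2 else 0) + (if j \<in> I then 0 else B j x * cnj (B j y) / 2))
     = (of_bool (x = y) + r x * cnj (r y)) / 2"
  proof -
    have "(\<Sum>j\<in>X. (if j \<in> I then (B j x * cnj (B j y) + r x * cnj (r y) / ?d) / 2 else 0) + (if j \<in> I then 0 else B j x * cnj (B j y) / 2))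
       = (\<Sum>j\<in>X. B j x * cnj (B j y) / 2 + (if j \<in> I then r x * cnj (r y) / ?d / 2 else 0))"
      by (intro sum.cong refl) (auto simp: field_simps)
    also have "\<dots> = (\<Sum>j\<in>X. B j x * cnj (B j y)) / 2 + (\<Sum>j\<in>X \<inter> I. r x * cnj (r y) / ?d / 2)"
      by (simp only: sum.distrib sum_divide_distrib sum.inter_restrict[OF X])
    also have "X \<inter> I = I" using I by auto
    also have "(\<Sum>j\<in>I. r x * cnj (r y) / ?d / 2) = r x * cnj (r y) / 2" using d by simp
    finally show ?thesis using B xy by (simp add: tight_frame_def field_simps)
  qed
  have "(\<Sum>k\<in>X \<times> {..<6}. ?m k x * cnj (?m k y)) = (\<Sum>j\<in>X. \<Sum>z<6. ?m (j, z) x * cnj (?m (j, z) y))"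
    by (rule sum_Times)
  also have "\<dots> = (\<Sum>j\<in>X. (\<Sum>z<4. ?m (j, z) x * cnj (?m (j, z) y)) + ?m (j, 4) x * cnj (?m (j, 4) y) + ?m (j, 5) x * cnj (?m (j, 5) y))"
    by (simp add: eval_nat_numeral)
  also have "\<dots> = (of_bool (x = y) + r x * cnj (r y)) / 2 + (of_bool (x = y) - r x * cnj (r y)) / 2"
    unfolding low m4 m5 sI[symmetric] s5[symmetric] by (simp only: sum.distrib sum_divide_distrib)
  also have "\<dots> = of_bool (x = y)" by (simp add: field_simps)
  finally show "(\<Sum>k\<in>X \<times> {..<6}. ?m k x * cnj (?m k y)) = of_bool (x = y)" .
qed

lemma interference_prob:
  assumes "j \<in> I" "z < 4"
  shows "complex_of_real ((cmod (ip X (interference_frame B I r (j, z)) \<psi>))\<^sup>2)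
    = (ip X (B j) \<psi> + (- \<i>) ^ z * (ip X r \<psi> / of_real (sqrt (card I))))
      * cnj (ip X (B j) \<psi> + (- \<i>) ^ z * (ip X r \<psi> / of_real (sqrt (card I)))) / 8"
proof -
  have "ip X (interference_frame B I r (j, z)) \<psi>
     = (ip X (B j) \<psi> + (- \<i>) ^ z * (ip X r \<psi> / of_real (sqrt (card I)))) / of_real (sqrt 8)"
    using assms
    by (simp add: ip_def interference_frame_def sum_divide_distrib sum.distrib[symmetric] sum_distrib_left algebra_simps add_divide_distrib
        cong: sum.cong)
  then show ?thesis
    using div_sqrt_mult_cnj[of 8 "ip X (B j) \<psi> + (- \<i>) ^ z * (ip X r \<psi> / of_real (sqrt (card I)))"
        "ip X (B j) \<psi> + (- \<i>) ^ z * (ip X r \<psi> / of_real (sqrt (card I)))"]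
    by (simp only: complex_norm_square) simp
qed

text \<open>Against the weight \<open>(- \<i>) ^ z\<close> the squares and one of the cross terms
  sum to zero over the four phases.\<close>

lemma sum_four_phases_weighted:
  "(\<Sum>z<4::nat. (- \<i>) ^ z * ((b + (- \<i>) ^ z * u) * cnj (b + (- \<i>) ^ z * u))) = 4 * (b * cnj u)"
  by (simp add: eval_nat_numeral algebra_simps)

lemma interference_estimate_mean:
  assumes X: "finite X" and I: "I \<subseteq> X" "i \<in> I"
  shows "(\<Sum>k\<in>X \<times> {..<6}. of_real ((cmod (ip X (interference_frame B I r k) \<psi>))\<^sup>2) * interference_estimate I k i)
    = ip X (B i) \<psi> * cnj (ip X r \<psi>)"
proof -
  let ?p = "\<lambda>k. complex_of_real ((cmod (ip X (interference_frame B I r k) \<psi>))\<^sup>2)"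
  let ?sd = "complex_of_real (sqrt (card I))"
  let ?u = "ip X r \<psi> / ?sd"
  have finI: "finite I" using X I finite_subset by blast
  have "card I > 0" using I finI by (auto simp: card_gt_0_iff)
  then have sd: "?sd \<noteq> 0" by simp
  have "(\<Sum>k\<in>X \<times> {..<6}. ?p k * interference_estimate I k i)
     = (\<Sum>j\<in>X. \<Sum>z<6. ?p (j, z) * interference_estimate I (j, z) i)"
    by (rule sum_Times)
  also have "\<dots> = (\<Sum>j\<in>X. if j = i then \<Sum>z<6. ?p (j, z) * interference_estimate I (j, z) i else 0)"
    by (intro sum.cong refl) (auto simp: interference_estimate_def)
  also have "\<dots> = (\<Sum>z<6. ?p (i, z) * interference_estimate I (i, z) i)" using X I by auto
  also have "\<dots> = (\<Sum>z<4. ?p (i, z) * interference_estimate I (i, z) i)"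
    by (rule sum.mono_neutral_right) (auto simp: interference_estimate_def)
  also have "\<dots> = (\<Sum>z<4. (?sd / 4) * ((- \<i>) ^ z * ((ip X (B i) \<psi> + (- \<i>) ^ z * ?u) * cnj (ip X (B i) \<psi> + (- \<i>) ^ z * ?u))))"
    using I by (intro sum.cong refl) (simp add: interference_prob interference_estimate_def del: of_real_power)
  also have "\<dots> = (?sd / 4) * (4 * (ip X (B i) \<psi> * cnj ?u))"
    by (simp only: sum_distrib_left[symmetric] sum_four_phases_weighted)
  also have "\<dots> = ip X (B i) \<psi> * cnj (ip X r \<psi>)" using sd by simp
  finally show ?thesis .
qed

text \<open>An outcome \<open>(j, z)\<close> contributes to coordinate \<open>j\<close> only, so the
  squared norm of the whole estimated vector is a single term.\<close>

lemma interference_estimate_norm: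
  assumes "finite I"
  shows "(\<Sum>i\<in>I. (cmod (interference_estimate I k i))\<^sup>2) \<le> 4 * real (card I)"
proof -
  obtain j z where k: "k = (j, z)" by (cases k)
  have "(\<Sum>i\<in>I. (cmod (interference_estimate I k i))\<^sup>2) \<le> (\<Sum>i\<in>I. if i = j then 4 * real (card I) else 0)"
    by (intro sum_mono) (auto simp: k interference_estimate_def norm_mult norm_power power_mult_distrib)
  also have "\<dots> \<le> 4 * real (card I)" using assms by simp
  finally show ?thesis .
qed

text \<open>The mean squared error is at most \<open>4 * card I / q\<close>; Markov's inequality at
  failure probability 1/50 turns 4 into 200.\<close>

lemma interference_concentration:
  assumes X: "finite X" and B: "tight_frame X X B" and I: "I \<subseteq> X" "I \<noteq> {}"
    and r: "ip X r r = 1" and \<psi>: "ip X \<psi> \<psi> = 1" and q: "0 < q"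
  defines "p \<equiv> \<lambda>k. (cmod (ip X (interference_frame B I r k) \<psi>))\<^sup>2"
  shows "1 - 1 / 50 \<le> iid_expect p (X \<times> {..<6}) q (\<lambda>l. of_bool
    ((\<Sum>i\<in>I. (cmod ((\<Sum>k\<leftarrow>l. interference_estimate I k i) / of_nat q - ip X (B i) \<psi> * cnj (ip X r \<psi>)))\<^sup>2)
      \<le> 200 * real (card I) / real q))"
proof -
  have finI: "finite I" using X I finite_subset by blast
  interpret finite_dist p "X \<times> {..<6}"
    unfolding p_def by (rule tight_frame_dist[OF tight_interference_frame]) (use X B I r \<psi> in auto)
  have "(\<Sum>k\<in>X \<times> {..<6}. p k * (\<Sum>i\<in>I. (cmod (interference_estimate I k i))\<^sup>2))
      \<le> (\<Sum>k\<in>X \<times> {..<6}. p k * (4 * real (card I)))"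
    by (intro sum_mono mult_left_mono interference_estimate_norm finI nonneg)
  also have "\<dots> = 4 * real (card I)" using total by (simp flip: sum_distrib_right)
  finally have V: "(\<Sum>k\<in>X \<times> {..<6}. p k * (\<Sum>i\<in>I. (cmod (interference_estimate I k i))\<^sup>2)) \<le> 4 * real (card I)" .
  have "card I > 0" using I finI by (auto simp: card_gt_0_iff)
  then show ?thesis
    using iid_mean_sq_error[OF _ V q, where \<mu> = "\<lambda>i. ip X (B i) \<psi> * cnj (ip X r \<psi>)"]
      interference_estimate_mean[OF X I(1), of _ B r \<psi>] q
    by (intro iid_expect_Markov) (auto simp: p_def sum_nonneg)
qed

section \<open>Pauli expansions and juntas\<close>

definition sdiff :: "'a set \<Rightarrow> 'a set \<Rightarrow> 'a set" where
  "sdiff a b = (a - b) \<union> (b - a)"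

text \<open>A computational basis state is represented by the set of its qubits with bit 1. Then
  \<open>sdiff\<close> is bitwise addition modulo 2 and \<open>chi c\<close> is the Walsh character
  of \<open>c\<close>.\<close>

definition chi :: "nat set \<Rightarrow> nat set \<Rightarrow> complex" where
  "chi c x = (- 1) ^ card (c \<inter> x)"

lemma chi_toggle:
  assumes "finite c"
  shows "chi (sdiff c {i}) x = (if i \<in> x then - chi c x else chi c x)"
proof (cases "i \<in> x")
  case False
  then have "sdiff c {i} \<inter> x = c \<inter> x" by (auto simp: sdiff_def)
  then show ?thesis using False by (simp add: chi_def)
next
  case True
  show ?thesis
  proof (cases "i \<in> c")
    case ic: True
    have "c \<inter> x = insert i (sdiff c {i} \<inter> x)" "i \<notin> sdiff c {i} \<inter> x" using True ic by (auto simp: sdiff_def)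
    moreover have "finite (sdiff c {i} \<inter> x)" using assms by (auto simp: sdiff_def)
    ultimately show ?thesis using True by (simp add: chi_def)
  next
    case False
    have "sdiff c {i} \<inter> x = insert i (c \<inter> x)" using True False by (auto simp: sdiff_def)
    then show ?thesis using True False assms by (simp add: chi_def)
  qed
qed

lemma chi_commute: "chi c x = chi x c"
  by (simp add: chi_def Int_commute)

lemma cnj_chi [simp]: "cnj (chi c x) = chi c x"
  by (simp add: chi_def)

lemma chi_square: "chi c x * chi c x = 1"
  by (simp add: chi_def flip: power_mult_distrib)

text \<open>Toggling \<open>i\<close> is an involution of \<open>Pow {..<n}\<close> that reverses
  the sign of every term.\<close>

lemma sum_toggle_zero:
  fixes F :: "nat set \<Rightarrow> complex"
  assumes "i < n" "\<And>c. c \<subseteq> {..<n} \<Longrightarrow> F (sdiff c {i}) = - F c"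
  shows "(\<Sum>c\<in>Pow {..<n}. F c) = 0"
proof -
  have "(\<Sum>c\<in>Pow {..<n}. F c) = (\<Sum>c\<in>Pow {..<n}. F (sdiff c {i}))"
    by (rule sum.reindex_bij_witness[where i = "\<lambda>c. sdiff c {i}" and j = "\<lambda>c. sdiff c {i}"])
       (use assms(1) in \<open>auto simp: sdiff_def\<close>, (rule arg_cong[of _ _ F], auto)?)
  also have "\<dots> = - (\<Sum>c\<in>Pow {..<n}. F c)" using assms(2) by (simp add: sum_negf)
  finally show ?thesis by simp
qed

lemma sum_chi_chi:
  assumes "x \<subseteq> {..<n}" "x' \<subseteq> {..<n}"
  shows "(\<Sum>c\<in>Pow {..<n}. chi c x * chi c x') = of_bool (x = x') * 2 ^ n"
proof (cases "x = x'")
  case True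
  then show ?thesis by (simp add: chi_square card_Pow)
next
  case False
  then obtain i where i: "i \<in> x \<longleftrightarrow> i \<notin> x'" by auto
  then have "i < n" using assms by auto
  moreover have "chi (sdiff c {i}) x * chi (sdiff c {i}) x' = - (chi c x * chi c x')" if "c \<subseteq> {..<n}" for c
  proof -
    have "finite c" using that finite_subset by blast
    then show ?thesis using i by (auto simp: chi_toggle)
  qed
  ultimately have "(\<Sum>c\<in>Pow {..<n}. chi c x * chi c x') = 0" by (rule sum_toggle_zero)
  then show ?thesis using False by simp
qed

text \<open>\<open>bell n (a, c)\<close> is the normalised vectorisation of the Pauli operator X^a
  Z^c, row index \<open>y\<close> first and column index \<open>x\<close> second.\<close>

definition bell :: "nat \<Rightarrow> nat set \<times> nat set \<Rightarrow> nat set \<times> nat set \<Rightarrow> complex" where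
  "bell n = (\<lambda>(a, c) (y, x). of_bool (y = sdiff x a) * chi c x / of_real (sqrt (2 ^ n)))"

lemma tight_bell: "tight_frame (Pow {..<n} \<times> Pow {..<n}) (Pow {..<n} \<times> Pow {..<n}) (bell n)"
  unfolding tight_frame_def
proof (intro ballI, clarify)
  fix y x y' x' assume *: "y \<subseteq> {..<n}" "x \<subseteq> {..<n}" "y' \<subseteq> {..<n}" "x' \<subseteq> {..<n}"
  let ?Q = "Pow {..<n}"
  have "(\<Sum>k\<in>?Q \<times> ?Q. bell n k (y, x) * cnj (bell n k (y', x')))
      = (\<Sum>a\<in>?Q. \<Sum>c\<in>?Q. of_bool (y = sdiff x a) * of_bool (y' = sdiff x' a) * (chi c x * chi c x') / 2 ^ n)"
    unfolding sum_Times by (intro sum.cong refl) (simp add: bell_def flip: of_real_mult)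
  also have "\<dots> = (\<Sum>a\<in>?Q. of_bool (y = sdiff x a) * of_bool (y' = sdiff x' a) * of_bool (x = x'))"
    using * by (simp add: sum_chi_chi flip: sum_distrib_left sum_divide_distrib)
  also have "\<dots> = (\<Sum>a\<in>?Q. if a = sdiff x y then of_bool ((y, x) = (y', x')) else 0)"
    by (intro sum.cong refl) (auto simp: sdiff_def)
  also have "\<dots> = of_bool ((y, x) = (y', x'))" using * by (auto simp: sdiff_def)
  finally show "(\<Sum>k\<in>?Q \<times> ?Q. bell n k (y, x) * cnj (bell n k (y', x'))) = of_bool ((y, x) = (y', x'))" .
qed

section \<open>Matrix indices as sets of qubits\<close>

lemma bij_set_encode: "bij_betw set_encode (Pow {..<n}) {..<2 ^ n}"
proof -
  have inj: "inj_on set_encode (Pow {..<n})"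
    by (rule inj_on_subset[OF inj_on_set_encode]) (auto intro: finite_subset)
  have lt: "set_encode A < 2 ^ n" if "A \<subseteq> {..<n}" for A
  proof -
    have "set_encode A \<le> (\<Sum>i<n. 2 ^ i)"
      unfolding set_encode_def using that by (intro sum_mono2) auto
    also have "\<dots> < 2 ^ n" by (induction n) auto
    finally show ?thesis .
  qed
  have "set_encode ` Pow {..<n} = {..<2 ^ n}"
    by (rule card_subset_eq) (use lt in \<open>auto simp: card_image[OF inj] card_Pow\<close>)
  with inj show ?thesis by (simp add: bij_betw_def)
qed

lemma sum_set_encode: "(\<Sum>i<2 ^ n. F i) = (\<Sum>x\<in>Pow {..<n}. F (set_encode x))"
  using sum.reindex_bij_betw[OF bij_set_encode, of F n] by simp

lemma set_encode_lt: "x \<subseteq> {..<n} \<Longrightarrow> set_encode x < 2 ^ n"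
  using bij_betwE[OF bij_set_encode] by blast

abbreviation ent :: "complex mat \<Rightarrow> nat set \<Rightarrow> nat set \<Rightarrow> complex" where
  "ent U y x \<equiv> U $$ (set_encode y, set_encode x)"

lemma is_unitary_iff:
  assumes "U \<in> carrier_mat (2 ^ n) (2 ^ n)"
  shows "is_unitary (2 ^ n) U \<longleftrightarrow>
    (\<forall>x\<in>Pow {..<n}. \<forall>x'\<in>Pow {..<n}. ip (Pow {..<n}) (\<lambda>y. ent U y x) (\<lambda>y. ent U y x') = of_bool (x = x'))"
    (is "_ \<longleftrightarrow> ?R")
proof -
  have entry: "(cadjoint U * U) $$ (i, j) = (\<Sum>k<2 ^ n. cnj (U $$ (k, i)) * U $$ (k, j))"
    if "i < 2 ^ n" "j < 2 ^ n" for i j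
    using assms that by (simp add: cadjoint_def scalar_prod_def lessThan_atLeast0)
  have "is_unitary (2 ^ n) U \<longleftrightarrow> (\<forall>i\<in>{..<2 ^ n}. \<forall>j\<in>{..<2 ^ n}. (cadjoint U * U) $$ (i, j) = of_bool (i = j))"
  proof
    assume "is_unitary (2 ^ n) U"
    then show "\<forall>i\<in>{..<2 ^ n}. \<forall>j\<in>{..<2 ^ n}. (cadjoint U * U) $$ (i, j) = of_bool (i = j)"
      by (simp add: is_unitary_def)
  next
    assume *: "\<forall>i\<in>{..<2 ^ n}. \<forall>j\<in>{..<2 ^ n}. (cadjoint U * U) $$ (i, j) = of_bool (i = j)"
    have "cadjoint U * U = 1\<^sub>m (2 ^ n)"
      by (rule eq_matI) (use * assms in \<open>auto simp: cadjoint_def simp del: index_mult_mat(1)\<close>)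
    then show "is_unitary (2 ^ n) U" using assms by (simp add: is_unitary_def)
  qed
  also have "\<dots> \<longleftrightarrow> ?R"
    unfolding bij_betw_imp_surj_on[OF bij_set_encode, symmetric] ball_simps
    using inj_on_eq_iff[OF bij_betw_imp_inj_on[OF bij_set_encode[of n]]]
    by (simp add: entry set_encode_lt sum_set_encode ip_def)
  finally show ?thesis .
qed

section \<open>Choi vectors and Pauli coefficients\<close>

definition choi :: "nat \<Rightarrow> complex mat \<Rightarrow> nat set \<times> nat set \<Rightarrow> complex" where
  "choi n U = (\<lambda>(y, x). ent U y x / of_real (sqrt (2 ^ n)))"

lemma ip_choi: "ip (Pow {..<n} \<times> Pow {..<n}) (choi n U) (choi n V)
    = (\<Sum>y\<in>Pow {..<n}. \<Sum>x\<in>Pow {..<n}. cnj (ent U y x) * ent V y x) / 2 ^ n"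
  unfolding ip_def sum_Times sum_divide_distrib
  by (intro sum.cong refl) (simp add: choi_def flip: of_real_mult)

lemma ip_choi_unitary:
  assumes "is_unitary (2 ^ n) U"
  shows "ip (Pow {..<n} \<times> Pow {..<n}) (choi n U) (choi n U) = 1"
proof -
  have "(\<Sum>y\<in>Pow {..<n}. \<Sum>x\<in>Pow {..<n}. cnj (ent U y x) * ent U y x)
      = (\<Sum>x\<in>Pow {..<n}. ip (Pow {..<n}) (\<lambda>y. ent U y x) (\<lambda>y. ent U y x))"
    unfolding ip_def by (rule sum.swap)
  also have "\<dots> = (\<Sum>x\<in>Pow {..<n}. 1)"
    using assms is_unitary_iff[of U n] by (intro sum.cong refl) (auto simp: is_unitary_def)
  also have "\<dots> = 2 ^ n" by (simp add: card_Pow)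
  finally show ?thesis by (simp add: ip_choi)
qed

text \<open>The coefficient of X^a Z^c in the Pauli expansion of \<open>U\<close>, and at the same
  time the amplitude of outcome \<open>P\<close> when the Choi state is measured in the Bell
  basis.\<close>

definition pauli :: "nat \<Rightarrow> complex mat \<Rightarrow> nat set \<times> nat set \<Rightarrow> complex" where
  "pauli n U P = ip (Pow {..<n} \<times> Pow {..<n}) (bell n P) (choi n U)"

lemma pauli_Parseval:
  "ip (Pow {..<n} \<times> Pow {..<n}) (pauli n U) (pauli n V) = ip (Pow {..<n} \<times> Pow {..<n}) (choi n U) (choi n V)"
  using tight_frame_Parseval[OF tight_bell, of n "choi n U" "choi n V"] by (simp add: ip_def pauli_def)

lemma pauli_eq:
  assumes "a \<subseteq> {..<n}"
  shows "pauli n U (a, c) = (\<Sum>x\<in>Pow {..<n}. chi c x * ent U (sdiff x a) x) / 2 ^ n"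
proof -
  have "pauli n U (a, c) = (\<Sum>y\<in>Pow {..<n}. \<Sum>x\<in>Pow {..<n}. if y = sdiff x a then chi c x * ent U (sdiff x a) x / 2 ^ n else 0)"
    unfolding pauli_def ip_def sum_Times
    by (intro sum.cong refl) (auto simp: bell_def choi_def simp flip: of_real_mult)
  also have "\<dots> = (\<Sum>x\<in>Pow {..<n}. \<Sum>y\<in>Pow {..<n}. if y = sdiff x a then chi c x * ent U (sdiff x a) x / 2 ^ n else 0)"
    by (rule sum.swap)
  also have "\<dots> = (\<Sum>x\<in>Pow {..<n}. chi c x * ent U (sdiff x a) x / 2 ^ n)"
  proof (intro sum.cong refl)
    fix x assume "x \<in> Pow {..<n}"
    then have "sdiff x a \<in> Pow {..<n}" using assms by (auto simp: sdiff_def)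
    then show "(\<Sum>y\<in>Pow {..<n}. if y = sdiff x a then chi c x * ent U (sdiff x a) x / 2 ^ n else 0)
        = chi c x * ent U (sdiff x a) x / 2 ^ n" by simp
  qed
  finally show ?thesis by (simp add: sum_divide_distrib)
qed

text \<open>X^a Z^c has nonzero entries only where \<open>sdiff y x = a\<close>. Masking the Choi
  vector to the entries with \<open>sdiff y x\<close> not inside \<open>T\<close> therefore masks
  its coefficients to those with \<open>a\<close> not inside \<open>T\<close>, and Parseval equates
  the two masses.\<close>

lemma column_mass_off:
  "(\<Sum>x\<in>Pow {..<n}. \<Sum>y | y \<in> Pow {..<n} \<and> \<not> sdiff y x \<subseteq> T. (cmod (ent U y x))\<^sup>2) / 2 ^ n
    = (\<Sum>P | P \<in> Pow {..<n} \<times> Pow {..<n} \<and> \<not> fst P \<subseteq> T. (cmod (pauli n U P))\<^sup>2)"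
proof -
  let ?Q = "Pow {..<n}"
  define \<psi> where "\<psi> = (\<lambda>(y, x). of_bool (\<not> sdiff y x \<subseteq> T) * choi n U (y, x))"
  have ip\<psi>: "ip (?Q \<times> ?Q) (bell n P) \<psi> = of_bool (\<not> fst P \<subseteq> T) * pauli n U P" for P
    unfolding pauli_def ip_def sum_distrib_left
  proof (rule sum.cong)
    fix z
    show "cnj (bell n P z) * \<psi> z = of_bool (\<not> fst P \<subseteq> T) * (cnj (bell n P z) * choi n U z)"
    proof (cases "fst z = sdiff (snd z) (fst P)")
      case True
      then have "sdiff (fst z) (snd z) = fst P" by (auto simp: sdiff_def)
      then show ?thesis by (auto simp: \<psi>_def split: prod.splits)
    qed (auto simp: bell_def split: prod.splits)
  qed simp
  have "(\<Sum>P | P \<in> ?Q \<times> ?Q \<and> \<not> fst P \<subseteq> T. (cmod (pauli n U P))\<^sup>2)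
      = (\<Sum>P\<in>?Q \<times> ?Q. (cmod (ip (?Q \<times> ?Q) (bell n P) \<psi>))\<^sup>2)"
    unfolding ip\<psi> by (subst sum.inter_filter) (auto intro!: sum.cong)
  also have "\<dots> = (\<Sum>z\<in>?Q \<times> ?Q. (cmod (\<psi> z))\<^sup>2)"
    by (rule tight_frame_norm[OF tight_bell]) simp
  also have "\<dots> = (\<Sum>x\<in>?Q. \<Sum>y\<in>?Q. (cmod (\<psi> (y, x)))\<^sup>2)"
    unfolding sum_Times by (rule sum.swap)
  also have "\<dots> = (\<Sum>x\<in>?Q. \<Sum>y | y \<in> ?Q \<and> \<not> sdiff y x \<subseteq> T. (cmod (ent U y x))\<^sup>2 / 2 ^ n)"
    by (subst sum.inter_filter)
       (auto simp: \<psi>_def choi_def norm_mult norm_divide power_divide intro!: sum.cong)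
  finally show ?thesis by (simp add: sum_divide_distrib)
qed

section \<open>Bits, restriction to a set of qubits, and juntas\<close>

lemma qbit_set_encode:
  assumes "finite x"
  shows "qbit (set_encode x) i = of_bool (i \<in> x)"
proof -
  have "i \<in> x \<longleftrightarrow> odd (set_encode x div 2 ^ i)"
    using set_encode_inverse[OF assms] by (auto simp: set_decode_def)
  then show ?thesis by (auto simp: qbit_def odd_iff_mod_2_eq_one)
qed

text \<open>\<open>restrict_idx S\<close> renumbers the qubits of \<open>S\<close> by their
  positions in the sorted list, so it is \<open>set_encode\<close> of the set of positions that
  carry bit 1.\<close>

lemma restrict_idx_bij:
  assumes "finite S"
  shows "bij_betw (\<lambda>x. restrict_idx S (set_encode x)) (Pow S) {..<2 ^ card S}"
    and "finite x \<Longrightarrow> restrict_idx S (set_encode x) = restrict_idx S (set_encode (x \<inter> S))"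
proof -
  define s where "s = sorted_list_of_set S"
  have s: "length s = card S" "set s = S" "distinct s" using assms by (simp_all add: s_def)
  have eq: "restrict_idx S (set_encode x) = set_encode {j. j < card S \<and> s ! j \<in> x}" if "finite x" for x
  proof -
    have "restrict_idx S (set_encode x) = (\<Sum>j<card S. of_bool (s ! j \<in> x) * 2 ^ j)"
      using s(1) by (simp add: restrict_idx_def Let_def qbit_set_encode[OF that] flip: s_def)
    also have "\<dots> = (\<Sum>j | j \<in> {..<card S} \<and> s ! j \<in> x. 2 ^ j)"
      by (subst sum.inter_filter) (simp, intro sum.cong refl, simp add: of_bool_def)
    finally show ?thesis by (simp add: set_encode_def)
  qed
  show "restrict_idx S (set_encode x) = restrict_idx S (set_encode (x \<inter> S))" if "finite x" for x
  proof -
    have "{j. j < card S \<and> s ! j \<in> x} = {j. j < card S \<and> s ! j \<in> x \<inter> S}" using s by (auto simp: nth_mem)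
    then show ?thesis using that by (simp add: eq)
  qed
  have "bij_betw (\<lambda>x. {j. j < card S \<and> s ! j \<in> x}) (Pow S) (Pow {..<card S})"
  proof (rule bij_betwI[where g = "\<lambda>J. (!) s ` J"])
    fix x assume "x \<in> Pow S"
    then show "(!) s ` {j. j < card S \<and> s ! j \<in> x} = x"
      using s by (auto simp: in_set_conv_nth image_iff) (metis in_set_conv_nth subsetD)
  next
    fix J assume "J \<in> Pow {..<card S}"
    then show "{j. j < card S \<and> s ! j \<in> (!) s ` J} = J"
      using s by (auto simp: nth_eq_iff_index_eq) 
  qed (use s in auto)
  from bij_betw_trans[OF this bij_set_encode]
  show "bij_betw (\<lambda>x. restrict_idx S (set_encode x)) (Pow S) {..<2 ^ card S}"
    by (rule bij_betw_cong[THEN iffD1, rotated]) (use assms in \<open>auto simp: eq finite_subset\<close>)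
qed

lemma embed_on_entry:
  assumes "S \<subseteq> {..<n}" "x \<subseteq> {..<n}" "y \<subseteq> {..<n}"
  shows "ent (embed_on n S V) y x = (if y - S = x - S
    then V $$ (restrict_idx S (set_encode (y \<inter> S)), restrict_idx S (set_encode (x \<inter> S))) else 0)"
proof -
  have fin: "finite S" "finite x" "finite y" using assms finite_subset by blast+
  have "(\<forall>i<n. i \<notin> S \<longrightarrow> qbit (set_encode y) i = qbit (set_encode x) i) \<longleftrightarrow> y - S = x - S"
    using assms fin by (auto simp: qbit_set_encode)
  then show ?thesis
    using assms restrict_idx_bij(2)[OF fin(1,2)] restrict_idx_bij(2)[OF fin(1,3)]
    by (simp add: embed_on_def set_encode_lt)
qed

text \<open>A nonzero entry has row and column equal off \<open>S\<close>. A Pauli whose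
  \<open>a\<close> leaves \<open>S\<close> thus meets only zero entries. If
  \<open>a \<subseteq> S\<close> but \<open>c\<close> contains some \<open>i\<close> outside
  \<open>S\<close>, toggling qubit \<open>i\<close> keeps the entry and flips the character, so the
  coefficient cancels.\<close>

lemma junta_properties:
  assumes "quantum_junta n k U"
  obtains S where "S \<subseteq> {..<n}" "card S = k" "is_unitary (2 ^ n) U"
    "\<And>y x. y \<subseteq> {..<n} \<Longrightarrow> x \<subseteq> {..<n} \<Longrightarrow> ent U y x \<noteq> 0 \<Longrightarrow> sdiff y x \<subseteq> S"
    "\<And>a c. a \<subseteq> {..<n} \<Longrightarrow> c \<subseteq> {..<n} \<Longrightarrow> pauli n U (a, c) \<noteq> 0 \<Longrightarrow> a \<union> c \<subseteq> S"
proof -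
  obtain S V where S: "S \<subseteq> {..<n}" "card S = k" and V: "is_unitary (2 ^ k) V" and U: "U = embed_on n S V"
    using assms by (auto simp: quantum_junta_def)
  let ?Q = "Pow {..<n}"
  let ?\<rho> = "\<lambda>x. restrict_idx S (set_encode x)"
  have finS: "finite S" using S finite_subset by blast
  note ent = embed_on_entry[OF S(1), of _ _ V, folded U]
  have \<rho>: "bij_betw ?\<rho> (Pow S) {..<2 ^ k}" using restrict_idx_bij(1)[OF finS] S by simp
  have Vc: "V \<in> carrier_mat (2 ^ k) (2 ^ k)" using V by (simp add: is_unitary_def)
  have VV: "(\<Sum>A\<in>Pow S. cnj (V $$ (?\<rho> A, i)) * V $$ (?\<rho> A, j)) = of_bool (i = j)" if "i < 2 ^ k" "j < 2 ^ k" for i j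
  proof -
    have "(\<Sum>A\<in>Pow S. cnj (V $$ (?\<rho> A, i)) * V $$ (?\<rho> A, j)) = (\<Sum>l<2 ^ k. cnj (V $$ (l, i)) * V $$ (l, j))"
      using sum.reindex_bij_betw[OF \<rho>, of "\<lambda>l. cnj (V $$ (l, i)) * V $$ (l, j)"] .
    also have "\<dots> = (cadjoint V * V) $$ (i, j)"
      using Vc that by (simp add: cadjoint_def scalar_prod_def lessThan_atLeast0)
    also have "\<dots> = of_bool (i = j)" using V that by (simp add: is_unitary_def)
    finally show ?thesis .
  qed
  have unit: "is_unitary (2 ^ n) U"
  proof (subst is_unitary_iff)
    show "U \<in> carrier_mat (2 ^ n) (2 ^ n)" by (simp add: U embed_on_def)
    show "\<forall>x\<in>?Q. \<forall>x'\<in>?Q. ip ?Q (\<lambda>y. ent U y x) (\<lambda>y. ent U y x') = of_bool (x = x')"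
    proof (intro ballI)
      fix x x' assume x: "x \<in> ?Q" "x' \<in> ?Q"
      have "ip ?Q (\<lambda>y. ent U y x) (\<lambda>y. ent U y x')
          = (\<Sum>y | y \<in> ?Q \<and> y - S = x - S. cnj (ent U y x) * ent U y x')"
        unfolding ip_def by (rule sum.mono_neutral_right) (use x ent in auto)
      \<comment> \<open>Rows agreeing with \<open>x\<close> off \<open>S\<close> are parametrised by
        their part \<open>A\<close> inside \<open>S\<close>.\<close>
      also have "\<dots> = (\<Sum>A\<in>Pow S. of_bool (x - S = x' - S) *
          (cnj (V $$ (?\<rho> A, ?\<rho> (x \<inter> S))) * V $$ (?\<rho> A, ?\<rho> (x' \<inter> S))))"
      proof (rule sum.reindex_bij_witness[where i = "\<lambda>A. A \<union> (x - S)" and j = "\<lambda>y. y \<inter> S"])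
        fix y assume y: "y \<in> {y. y \<in> ?Q \<and> y - S = x - S}"
        show "y \<inter> S \<union> (x - S) = y" using y by auto
        show "y \<inter> S \<in> Pow S" by auto
        show "of_bool (x - S = x' - S) * (cnj (V $$ (?\<rho> (y \<inter> S), ?\<rho> (x \<inter> S))) * V $$ (?\<rho> (y \<inter> S), ?\<rho> (x' \<inter> S)))
            = cnj (ent U y x) * ent U y x'"
          using y x by (auto simp: ent)
      next
        fix A assume A: "A \<in> Pow S"
        show "A \<union> (x - S) \<in> {y. y \<in> ?Q \<and> y - S = x - S}" using A x S by auto
        show "(A \<union> (x - S)) \<inter> S = A" using A by auto
      qed
      also have "\<dots> = of_bool (x - S = x' - S) * of_bool (?\<rho> (x \<inter> S) = ?\<rho> (x' \<inter> S))"
        using bij_betwE[OF \<rho>] by (simp only: sum_distrib_left[symmetric]) (subst VV, auto)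
      also have "\<dots> = of_bool (x - S = x' - S) * of_bool (x \<inter> S = x' \<inter> S)"
        using inj_on_eq_iff[OF bij_betw_imp_inj_on[OF \<rho>], of "x \<inter> S" "x' \<inter> S"] by simp
      also have "\<dots> = of_bool (x = x')" by (auto simp: of_bool_def)
      finally show "ip ?Q (\<lambda>y. ent U y x) (\<lambda>y. ent U y x') = of_bool (x = x')" .
    qed
  qed
  have supp: "sdiff y x \<subseteq> S" if "y \<subseteq> {..<n}" "x \<subseteq> {..<n}" "ent U y x \<noteq> 0" for y x
    using that ent[of x y] by (auto simp: sdiff_def split: if_splits)
  have "a \<union> c \<subseteq> S" if ac: "a \<subseteq> {..<n}" "c \<subseteq> {..<n}" "pauli n U (a, c) \<noteq> 0" for a c
  proof (rule ccontr)
    assume "\<not> a \<union> c \<subseteq> S"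
    then consider i where "i \<in> a" "i \<notin> S" | i where "a \<subseteq> S" "i \<in> c" "i \<notin> S" by auto
    then have "(\<Sum>x\<in>?Q. chi c x * ent U (sdiff x a) x) = 0"
    proof cases
      case 1
      have "ent U (sdiff x a) x = 0" if "x \<in> ?Q" for x
      proof (rule ccontr)
        assume "ent U (sdiff x a) x \<noteq> 0"
        moreover have "sdiff x a \<subseteq> {..<n}" using ac that by (auto simp: sdiff_def)
        ultimately have "sdiff (sdiff x a) x \<subseteq> S" using supp that by blast
        then show False using 1 by (auto simp: sdiff_def)
      qed
      then show ?thesis by simp
    next
      case 2
      have "i < n" using 2 ac by auto
      then show ?thesis
      proof (rule sum_toggle_zero)
        fix x assume x: "x \<subseteq> {..<n}"
        let ?x = "sdiff x {i}"
        have sub: "?x \<subseteq> {..<n}" "sdiff ?x a \<subseteq> {..<n}" "sdiff x a \<subseteq> {..<n}"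
          using x ac \<open>i < n\<close> by (auto simp: sdiff_def)
        have eqs: "?x \<inter> S = x \<inter> S" "sdiff ?x a \<inter> S = sdiff x a \<inter> S" "?x - S = sdiff (x - S) {i}"
          "sdiff ?x a - S = sdiff (x - S) {i}" "sdiff x a - S = x - S"
          using 2 by (auto simp: sdiff_def)
        have "ent U (sdiff ?x a) ?x = ent U (sdiff x a) x"
          using x sub by (simp add: ent eqs)
        moreover have "chi c ?x = - chi c x"
          using chi_toggle[of x i c] x 2 finite_subset by (auto simp: chi_commute[of c])
        ultimately show "chi c ?x * ent U (sdiff ?x a) ?x = - (chi c x * ent U (sdiff x a) x)" by simp
      qed
    qed
    then show False using ac by (simp add: pauli_eq)
  qed
  then show thesis using that S unit supp by blast
qed

section \<open>Distance estimates\<close>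

lemma exp_ii_surj:
  assumes "cmod w = 1"
  shows "\<exists>\<theta>\<in>{0..<2 * pi}. exp (\<i> * complex_of_real \<theta>) = w"
proof -
  have "w \<noteq> 0" using assms by auto
  then have c: "cis (Arg w) = w" using assms cis_Arg[of w] by (simp add: sgn_eq)
  show ?thesis
  proof (cases "0 \<le> Arg w")
    case True
    moreover have "Arg w < 2 * pi" using Arg_bounded[of w] pi_gt_zero by linarith
    ultimately show ?thesis using c
      by (intro bexI[of _ "Arg w"]) (auto simp: cis_conv_exp[symmetric])
  next
    case False
    have "cis (Arg w + 2 * pi) = w" using c by (simp flip: cis_mult)
    then have "exp (\<i> * complex_of_real (Arg w + 2 * pi)) = w" by (simp only: cis_conv_exp)
    moreover have "Arg w + 2 * pi \<in> {0..<2 * pi}" using False Arg_bounded[of w] by auto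
    ultimately show ?thesis by blast
  qed
qed

lemma norm_sq_diff_phase:
  assumes "ip X u u = 1" "ip X v v = 1"
  shows "(\<Sum>x\<in>X. (cmod (a * u x - b * v x))\<^sup>2) = (cmod a)\<^sup>2 + (cmod b)\<^sup>2 - 2 * Re (cnj a * b * ip X u v)"
proof -
  have "complex_of_real (\<Sum>x\<in>X. (cmod (a * u x - b * v x))\<^sup>2)
      = cnj a * a + cnj b * b - (cnj a * b * ip X u v + cnj (cnj a * b * ip X u v))"
    using assms cnj_ip[of X u v, symmetric]
    unfolding ip_self[of X "\<lambda>x. a * u x - b * v x", symmetric]
    by (simp add: ip_diff_left ip_diff_right ip_scale_left ip_scale_right algebra_simps)
  also have "\<dots> = of_real ((cmod a)\<^sup>2 + (cmod b)\<^sup>2 - 2 * Re (cnj a * b * ip X u v))"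
    unfolding cnj_mult_self complex_add_cnj by (simp only: of_real_add of_real_diff)
  finally show ?thesis by (simp only: of_real_eq_iff)
qed

text \<open>The infimum is at most its value at the phase that makes the overlap of the Choi vectors
  real and nonnegative.\<close>

lemma qdist_le:
  assumes U: "is_unitary (2 ^ n) U" and V: "is_unitary (2 ^ n) V"
  shows "qdist U V \<le> sqrt (1 - cmod (ip (Pow {..<n} \<times> Pow {..<n}) (choi n U) (choi n V)))"
proof -
  let ?Q = "Pow {..<n}"
  define t where "t = ip (?Q \<times> ?Q) (choi n U) (choi n V)"
  define w where "w = (if t = 0 then 1 else sgn t)"
  have w1: "cmod w = 1" by (simp add: w_def norm_sgn)
  have wt: "cnj w * t = of_real (cmod t)"
    using cnj_mult_self[of t] by (simp add: w_def sgn_eq power2_eq_square)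
  obtain \<theta> where \<theta>: "\<theta> \<in> {0..<2 * pi}" "exp (\<i> * complex_of_real \<theta>) = w"
    using exp_ii_surj[OF w1] by blast
  have cU: "U \<in> carrier_mat (2 ^ n) (2 ^ n)" and cV: "V \<in> carrier_mat (2 ^ n) (2 ^ n)"
    using U V by (auto simp: is_unitary_def)
  have "(\<Sum>i<2 ^ n. \<Sum>j<2 ^ n. (cmod (w * U $$ (i, j) - V $$ (i, j)))\<^sup>2)
      = (\<Sum>z\<in>?Q \<times> ?Q. 2 ^ n * (cmod (w * choi n U z - 1 * choi n V z))\<^sup>2)"
    unfolding sum_set_encode sum_Times
  proof (intro sum.cong refl)
    fix y x
    have "w * choi n U (y, x) - 1 * choi n V (y, x) = (w * ent U y x - ent V y x) / of_real (sqrt (2 ^ n))"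
      by (simp add: choi_def diff_divide_distrib)
    then show "(cmod (w * ent U y x - ent V y x))\<^sup>2 = 2 ^ n * (cmod (w * choi n U (y, x) - 1 * choi n V (y, x)))\<^sup>2"
      by (simp add: norm_divide power_divide)
  qed
  also have "\<dots> = 2 ^ n * (2 - 2 * cmod t)"
    unfolding sum_distrib_left[symmetric] norm_sq_diff_phase[OF ip_choi_unitary[OF U] ip_choi_unitary[OF V]]
    using w1 wt by (simp add: t_def[symmetric])
  finally have F: "frob_norm (w \<cdot>\<^sub>m U - V) = sqrt (2 ^ n * (2 - 2 * cmod t))"
    using cU cV by (simp add: frob_norm_def)
  have "qdist U V \<le> frob_norm (exp (\<i> * complex_of_real \<theta>) \<cdot>\<^sub>m U - V) / sqrt (2 * real (dim_row U))"
    unfolding qdist_def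
    by (rule cINF_lower[OF _ \<theta>(1)])
       (auto intro!: bdd_belowI2[of _ 0] divide_nonneg_nonneg simp: frob_norm_def sum_nonneg)
  also have "\<dots> = sqrt (1 - cmod t)"
    using cU by (simp add: \<theta>(2) F flip: real_sqrt_divide)
  finally show ?thesis by (simp add: t_def)
qed

lemma qdist_le_1:
  assumes "is_unitary (2 ^ n) U" "is_unitary (2 ^ n) V"
  shows "qdist U V \<le> 1"
  using order_trans[OF qdist_le[OF assms]] by simp

text \<open>Both scaled coefficient vectors are near \<open>w\<close>, hence their squared distance
  is at most \<open>4 * D\<close>. That distance is at least
  \<open>2 * cmod z * cmod z' * (1 - cmod t)\<close> for the overlap \<open>t\<close>, and the lower
  bounds 1/5 on the scalars give \<open>1 - cmod t \<le> 50 * D\<close>.\<close>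

lemma qdist_le_common_estimate:
  assumes U: "is_unitary (2 ^ n) U" and V: "is_unitary (2 ^ n) V"
    and z: "1 / 5 \<le> cmod z" "1 / 5 \<le> cmod z'"
    and w: "(\<Sum>P\<in>Pow {..<n} \<times> Pow {..<n}. (cmod (w P - z * pauli n U P))\<^sup>2) \<le> D"
           "(\<Sum>P\<in>Pow {..<n} \<times> Pow {..<n}. (cmod (w P - z' * pauli n V P))\<^sup>2) \<le> D"
  shows "qdist U V \<le> sqrt (50 * D)"
proof -
  let ?X = "Pow {..<n} \<times> Pow {..<n}"
  define t where "t = ip ?X (choi n U) (choi n V)"
  have tq: "t = ip ?X (pauli n U) (pauli n V)" by (simp add: t_def pauli_Parseval)
  have uu: "ip ?X (pauli n U) (pauli n U) = 1" "ip ?X (pauli n V) (pauli n V) = 1"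
    by (simp_all add: pauli_Parseval ip_choi_unitary U V)
  have q: "qdist U V \<le> sqrt (1 - cmod t)" using qdist_le[OF U V] by (simp add: t_def)
  have "(cmod (a - b))\<^sup>2 \<le> 2 * (cmod (c - a))\<^sup>2 + 2 * (cmod (c - b))\<^sup>2" for a b c :: complex
  proof -
    have "cmod (a - b) \<le> cmod (c - a) + cmod (c - b)"
      using norm_triangle_ineq4[of "c - b" "c - a"] by (simp add: norm_minus_commute)
    then have "(cmod (a - b))\<^sup>2 \<le> (cmod (c - a) + cmod (c - b))\<^sup>2" by (intro power_mono) auto
    also have "\<dots> \<le> 2 * (cmod (c - a))\<^sup>2 + 2 * (cmod (c - b))\<^sup>2"
      using sum_squares_bound[of "cmod (c - a)" "cmod (c - b)"] by (simp add: power2_sum)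
    finally show ?thesis .
  qed
  then have "(\<Sum>P\<in>?X. (cmod (z * pauli n U P - z' * pauli n V P))\<^sup>2)
      \<le> (\<Sum>P\<in>?X. 2 * (cmod (w P - z * pauli n U P))\<^sup>2 + 2 * (cmod (w P - z' * pauli n V P))\<^sup>2)"
    by (intro sum_mono)
  also have "\<dots> \<le> 4 * D" using w by (simp add: sum.distrib flip: sum_distrib_left)
  finally have "(cmod z)\<^sup>2 + (cmod z')\<^sup>2 - 2 * Re (cnj z * z' * t) \<le> 4 * D"
    unfolding norm_sq_diff_phase[OF uu] tq .
  moreover have "Re (cnj z * z' * t) \<le> cmod z * cmod z' * cmod t"
    using complex_Re_le_cmod[of "cnj z * z' * t"] by (simp add: norm_mult)
  ultimately have "cmod z * cmod z' * (1 - cmod t) \<le> 2 * D"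
    using sum_squares_bound[of "cmod z" "cmod z'"] by (simp add: algebra_simps)
  moreover have "1 / 25 * (1 - cmod t) \<le> cmod z * cmod z' * (1 - cmod t)" if "cmod t \<le> 1"
    using mult_mono[OF z] that by (intro mult_right_mono) auto
  moreover have "0 \<le> D" using order_trans[OF sum_nonneg w(1)] by simp
  ultimately have "1 - cmod t \<le> 50 * D" by (cases "cmod t \<le> 1") auto
  then show ?thesis using order_trans[OF q] real_sqrt_le_mono by blast
qed

text \<open>Expanding the squared error shows that \<open>w\<close>, being close to
  \<open>cnj \<kappa>\<close> times \<open>u\<close> on \<open>J\<close>, has an inner product with
  \<open>u\<close> proportional to its own norm. This makes the normalised estimate a usable
  reference vector.\<close>

lemma overlap_of_estimate:
  assumes "finite J" "\<kappa> \<noteq> 0" "3 / 4 \<le> (\<Sum>y\<in>J. (cmod (u y))\<^sup>2)"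
    and "(\<Sum>y\<in>J. (cmod (w y - u y * cnj \<kappa>))\<^sup>2) \<le> (cmod \<kappa>)\<^sup>2 / 16"
  shows "0 < (\<Sum>y\<in>J. (cmod (w y))\<^sup>2)" "2 / 5 * sqrt (\<Sum>y\<in>J. (cmod (w y))\<^sup>2) \<le> cmod (ip J w u)"
proof -
  define s where "s = sqrt (\<Sum>y\<in>J. (cmod (w y))\<^sup>2)"
  have s0: "0 \<le> s" by (simp add: s_def sum_nonneg)
  have s2: "(\<Sum>y\<in>J. (cmod (w y))\<^sup>2) = s\<^sup>2" by (simp add: s_def sum_nonneg)
  have \<kappa>: "0 < cmod \<kappa>" using assms by simp
  have "(cmod (w y - u y * cnj \<kappa>))\<^sup>2 = (cmod (w y))\<^sup>2 + (cmod \<kappa>)\<^sup>2 * (cmod (u y))\<^sup>2 - 2 * Re (cnj \<kappa> * (cnj (w y) * u y))" for y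
    using cmod_add_sq[of "w y" "- (u y * cnj \<kappa>)"] by (simp add: norm_mult power_mult_distrib mult_ac)
  then have "(\<Sum>y\<in>J. (cmod (w y - u y * cnj \<kappa>))\<^sup>2)
     = s\<^sup>2 + (cmod \<kappa>)\<^sup>2 * (\<Sum>y\<in>J. (cmod (u y))\<^sup>2) - 2 * Re (cnj \<kappa> * ip J w u)"
    by (simp only: sum.distrib sum_subtractf sum_distrib_left[symmetric] s2 ip_def Re_sum[symmetric])
  moreover have "(cmod \<kappa>)\<^sup>2 * (3 / 4) \<le> (cmod \<kappa>)\<^sup>2 * (\<Sum>y\<in>J. (cmod (u y))\<^sup>2)"
    using assms by (intro mult_left_mono) auto
  moreover have "Re (cnj \<kappa> * ip J w u) \<le> cmod \<kappa> * cmod (ip J w u)"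
    using complex_Re_le_cmod[of "cnj \<kappa> * ip J w u"] by (simp add: norm_mult)
  ultimately have main: "s\<^sup>2 + 11 / 16 * (cmod \<kappa>)\<^sup>2 \<le> 2 * (cmod \<kappa> * cmod (ip J w u))"
    using assms(4) by simp
  have "s \<noteq> 0"
  proof
    assume "s = 0"
    then have "\<forall>y\<in>J. w y = 0" using s2 assms(1) by (simp add: sum_nonneg_eq_0_iff)
    then have "ip J w u = 0" by (simp add: ip_def)
    then show False using main \<kappa> \<open>s = 0\<close> by (simp add: zero_less_power not_le)
  qed
  then show "0 < (\<Sum>y\<in>J. (cmod (w y))\<^sup>2)" using s2 by simp
  \<comment> \<open>The arithmetic-geometric mean inequality with factor 4/5, admissible since 16/25
    is at most 11/16 = 3/4 - 1/16.\<close>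
  have "2 * (s * (4 / 5 * cmod \<kappa>)) \<le> s\<^sup>2 + (4 / 5 * cmod \<kappa>)\<^sup>2"
    using sum_squares_bound[of s "4 / 5 * cmod \<kappa>"] by simp
  also have "\<dots> \<le> s\<^sup>2 + 11 / 16 * (cmod \<kappa>)\<^sup>2" by (simp add: power_mult_distrib power_divide)
  also note main
  finally have "cmod \<kappa> * (4 / 5 * s) \<le> cmod \<kappa> * cmod (ip J w u)" by (simp add: mult_ac)
  then have "4 / 5 * s \<le> cmod (ip J w u)" using \<kappa> by simp
  then show "2 / 5 * sqrt (\<Sum>y\<in>J. (cmod (w y))\<^sup>2) \<le> cmod (ip J w u)" using s0 by (simp flip: s_def)
qed

context finite_dist
begin

text \<open>Every sample that is not covered yet adds an element to the covered set, and this happens at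
  most \<open>card S\<close> times.\<close>

lemma missing_mass:
  fixes supp :: "'o \<Rightarrow> 'i set"
  assumes S: "finite S" "\<And>x. x \<in> X \<Longrightarrow> p x \<noteq> 0 \<Longrightarrow> supp x \<subseteq> S" and "T \<subseteq> S"
  shows "real q * iid_expect p X q (\<lambda>l. \<Sum>x | x \<in> X \<and> \<not> supp x \<subseteq> T \<union> \<Union> (supp ` set l). p x)
    \<le> real (card S) - real (card T)"
  using \<open>T \<subseteq> S\<close>
proof (induction q arbitrary: T)
  case 0
  then show ?case using card_mono[OF S(1)] by simp
next
  case (Suc q)
  define mis where "mis T = (\<Sum>x | x \<in> X \<and> \<not> supp x \<subseteq> T. p x)" for T
  have mis_antimono: "mis T' \<le> mis T" if "T \<subseteq> T'" for T T'
    unfolding mis_def using that fin nonneg by (intro sum_mono2) auto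
  define e where "e x = iid_expect p X q (\<lambda>l. mis ((T \<union> supp x) \<union> \<Union> (supp ` set l)))" for x
  have "e x \<le> iid_expect p X q (\<lambda>l. mis T)" for x
    unfolding e_def by (intro iid_expect_mono mis_antimono) auto
  then have e_le: "e x \<le> mis T" for x by (simp add: iid_expect_const)
  have step: "p x * (real q * e x) \<le> p x * (real (card S) - real (card T)) - p x * of_bool (\<not> supp x \<subseteq> T)"
    if x: "x \<in> X" for x
  proof (cases "p x = 0")
    case False
    then have sub: "T \<union> supp x \<subseteq> S" using S x Suc.prems by auto
    have finT: "finite (T \<union> supp x)" using sub S finite_subset by blast
    have "real (card T) + of_bool (\<not> supp x \<subseteq> T) \<le> real (card (T \<union> supp x))"
    proof (cases "supp x \<subseteq> T")
      case False
      then have "card T < card (T \<union> supp x)" using finT by (intro psubset_card_mono) auto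
      then show ?thesis using False by simp
    qed (simp add: Un_absorb2)
    moreover have "real q * e x \<le> real (card S) - real (card (T \<union> supp x))"
      using Suc.IH[OF sub] by (simp add: e_def mis_def)
    ultimately have "real q * e x \<le> real (card S) - real (card T) - of_bool (\<not> supp x \<subseteq> T)" by simp
    from mult_left_mono[OF this nonneg[OF x]] show ?thesis by (simp add: right_diff_distrib)
  qed simp
  \<comment> \<open>Of the \<open>q + 1\<close> copies, \<open>q\<close> are handled by the
    induction hypothesis after the first sample. The remaining one is at most the current missing
    mass, which is exactly the probability, subtracted in \<open>step\<close>, that the first sample
    enlarges \<open>T\<close>.\<close>
  have "real (Suc q) * iid_expect p X (Suc q) (\<lambda>l. mis (T \<union> \<Union> (supp ` set l)))
      = (\<Sum>x\<in>X. p x * (real q * e x)) + (\<Sum>x\<in>X. p x * e x)"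
    by (simp add: e_def Un_assoc algebra_simps sum_distrib_left sum.distrib)
  also have "\<dots> \<le> (\<Sum>x\<in>X. p x * (real (card S) - real (card T)) - p x * of_bool (\<not> supp x \<subseteq> T)) + (\<Sum>x\<in>X. p x * mis T)"
    by (intro add_mono sum_mono step mult_left_mono e_le nonneg)
  also have "\<dots> = real (card S) - real (card T) - (\<Sum>x\<in>X. p x * of_bool (\<not> supp x \<subseteq> T)) + mis T"
    by (simp only: sum_subtractf sum_distrib_right[symmetric] total) simp
  also have "(\<Sum>x\<in>X. p x * of_bool (\<not> supp x \<subseteq> T)) = mis T"
    unfolding mis_def by (subst sum.inter_filter) (simp add: fin, intro sum.cong refl, simp add: of_bool_def)
  finally show ?case by (simp add: mis_def)
qed

end

section \<open>Inputs, measurements and post-processing\<close>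

text \<open>A triple \<open>(y, x, f)\<close> is a basis state of query register, ancilla register and flag; as an index of a
  Bell measurement, \<open>(a, c, f)\<close> stands for the Pauli \<open>X^a Z^c\<close> and flag \<open>f\<close>. The intersections with
  \<open>{..<n}\<close> below make the post-processing total on arbitrary histories.\<close>

type_synonym basis = "nat set \<times> nat set \<times> bool"

definition reg :: "nat \<Rightarrow> basis set" where
  "reg n = Pow {..<n} \<times> Pow {..<n} \<times> UNIV"

lemma finite_reg [simp]: "finite (reg n)"
  by (simp add: reg_def)

lemma sum_reg: "(\<Sum>z\<in>reg n. F z) = (\<Sum>y\<in>Pow {..<n}. \<Sum>x\<in>Pow {..<n}. F (y, x, False) + F (y, x, True))"
  by (simp add: reg_def sum_Times UNIV_bool add.commute)

section \<open>Queries applied to the input states\<close>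

definition apply_query :: "nat \<Rightarrow> complex mat \<Rightarrow> (nat set \<times> 'w \<Rightarrow> complex) \<Rightarrow> nat set \<times> 'w \<Rightarrow> complex" where
  "apply_query n U s = (\<lambda>(y, w). \<Sum>b\<in>Pow {..<n}. ent U y b * s (b, w))"

lemma apply_query_norm:
  assumes "is_unitary (2 ^ n) U"
  shows "ip (Pow {..<n} \<times> W) (apply_query n U s) (apply_query n U s) = ip (Pow {..<n} \<times> W) s s"
proof -
  let ?Q = "Pow {..<n}"
  have t: "tight_frame ?Q ?Q (\<lambda>y b. cnj (ent U y b))"
    using assms is_unitary_iff[of U n] by (auto simp: tight_frame_def ip_def is_unitary_def)
  have "ip (?Q \<times> W) (apply_query n U s) (apply_query n U s)
      = (\<Sum>w\<in>W. \<Sum>y\<in>?Q. cnj (apply_query n U s (y, w)) * apply_query n U s (y, w))"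
    unfolding ip_def sum_Times by (rule sum.swap)
  also have "\<dots> = (\<Sum>w\<in>W. ip ?Q (\<lambda>b. s (b, w)) (\<lambda>b. s (b, w)))"
    using tight_frame_Parseval[OF t] by (intro sum.cong refl) (simp add: apply_query_def ip_def)
  also have "\<dots> = ip (?Q \<times> W) s s"
    unfolding ip_def sum_Times by (rule sum.swap)
  finally show ?thesis .
qed

definition flagbell :: "nat \<Rightarrow> basis \<Rightarrow> basis \<Rightarrow> complex" where
  "flagbell n = (\<lambda>(a, c, f) (y, x, g). of_bool (f = g) * bell n (a, c) (y, x))"

lemma tight_flagbell: "tight_frame (reg n) (reg n) (flagbell n)"
  unfolding tight_frame_def
proof (intro ballI)
  fix u v assume uv: "u \<in> reg n" "v \<in> reg n"
  obtain y x g y' x' g' where u: "u = (y, x, g)" and v: "v = (y', x', g')" by (metis prod.exhaust)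
  have "(\<Sum>k\<in>reg n. flagbell n k u * cnj (flagbell n k v))
      = of_bool (g = g') * (\<Sum>k\<in>Pow {..<n} \<times> Pow {..<n}. bell n k (y, x) * cnj (bell n k (y', x')))"
    unfolding sum_reg sum_Times by (cases g; cases g') (simp_all add: flagbell_def u v)
  also have "\<dots> = of_bool (u = v)"
    using tight_bell[of n] uv by (auto simp: tight_frame_def u v reg_def)
  finally show "(\<Sum>k\<in>reg n. flagbell n k u * cnj (flagbell n k v)) = of_bool (u = v)" .
qed

lemma ip_flagbell:
  "ip (reg n) (flagbell n (a, c, f)) \<psi> = ip (Pow {..<n} \<times> Pow {..<n}) (bell n (a, c)) (\<lambda>(y, x). \<psi> (y, x, f))"
  unfolding ip_def sum_reg sum_Times by (cases f) (simp_all add: flagbell_def)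

definition bell_input :: "nat \<Rightarrow> basis \<Rightarrow> complex" where
  "bell_input n = (\<lambda>(y, x, f). of_bool (y = x \<and> \<not> f) / of_real (sqrt (2 ^ n)))"

definition column_input :: "nat set \<Rightarrow> basis \<Rightarrow> complex" where
  "column_input x0 = (\<lambda>(y, x, f). of_bool (y = x0 \<and> x = x0 \<and> \<not> f))"

text \<open>The flag keeps the two branches apart: a query yields the Choi state with flag
  \<open>False\<close> and column \<open>x0\<close> with flag \<open>True\<close>, so Pauli vectors
  and the reference each see only their own branch, in one coherent state.\<close>

definition joint_input :: "nat \<Rightarrow> nat set \<Rightarrow> basis \<Rightarrow> complex" where
  "joint_input n x0 = (\<lambda>(y, x, f). (if f then of_bool (y = x0 \<and> x = x0)
     else of_bool (y = x) / of_real (sqrt (2 ^ n))) / of_real (sqrt 2))"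

lemma sum_of_bool_eq:
  fixes g :: "'a \<Rightarrow> complex"
  assumes "finite A" "a \<in> A"
  shows "(\<Sum>x\<in>A. g x * of_bool (x = a)) = g a"
  using assms by (simp add: of_bool_def if_distrib[of "\<lambda>v. _ * v"] cong: if_cong)

lemma apply_bell_input:
  assumes "x \<subseteq> {..<n}"
  shows "apply_query n U (bell_input n) (y, x, f) = of_bool (\<not> f) * choi n U (y, x)"
  using sum_of_bool_eq[of "Pow {..<n}" x "ent U y"] assms
  by (cases f) (simp_all add: apply_query_def bell_input_def choi_def flip: sum_divide_distrib)

lemma apply_column_input:
  assumes "x0 \<subseteq> {..<n}"
  shows "apply_query n U (column_input x0) (y, x, f) = of_bool (x = x0 \<and> \<not> f) * ent U y x0"
  using sum_of_bool_eq[of "Pow {..<n}" x0 "ent U y"] assms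
  by (cases f; cases "x = x0") (simp_all add: apply_query_def column_input_def)

lemma apply_joint_input:
  assumes "x0 \<subseteq> {..<n}" "x \<subseteq> {..<n}"
  shows "apply_query n U (joint_input n x0) (y, x, f)
    = (if f then of_bool (x = x0) * ent U y x0 else choi n U (y, x)) / of_real (sqrt 2)"
  using sum_of_bool_eq[of "Pow {..<n}" x0 "ent U y"] sum_of_bool_eq[of "Pow {..<n}" x "ent U y"] assms
  by (cases f; cases "x = x0")
     (simp_all add: apply_query_def joint_input_def choi_def flip: sum_divide_distrib)

lemma bell_input_norm: "ip (reg n) (bell_input n) (bell_input n) = 1"
proof -
  have "ip (reg n) (bell_input n) (bell_input n) = (\<Sum>y\<in>Pow {..<n}. \<Sum>x\<in>Pow {..<n}. 1 / 2 ^ n * of_bool (x = y))"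
    unfolding ip_def sum_reg by (intro sum.cong refl) (auto simp: bell_input_def simp flip: of_real_mult)
  also have "\<dots> = (\<Sum>y\<in>Pow {..<n}. 1 / 2 ^ n)"
    by (intro sum.cong refl sum_of_bool_eq) auto
  also have "\<dots> = 1" by (simp add: card_Pow)
  finally show ?thesis .
qed

lemma column_input_norm:
  assumes "x0 \<subseteq> {..<n}"
  shows "ip (reg n) (column_input x0) (column_input x0) = 1"
proof -
  have "column_input x0 = (\<lambda>z. of_bool (z = (x0, x0, False)))" by (auto simp: column_input_def)
  then show ?thesis using ip_basis_left[of "reg n" "(x0, x0, False)" "column_input x0"] assms
    by (auto simp: reg_def)
qed

lemma joint_input_norm:
  assumes "x0 \<subseteq> {..<n}"
  shows "ip (reg n) (joint_input n x0) (joint_input n x0) = 1"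
proof -
  have "(cmod (complex_of_real (sqrt 2) * complex_of_real (sqrt (2 ^ n))))\<^sup>2 = 2 * 2 ^ n"
    by (simp add: norm_mult power_mult_distrib)
  then have c: "(complex_of_real (cmod (complex_of_real (sqrt 2) * complex_of_real (sqrt (2 ^ n)))))\<^sup>2 = 2 * 2 ^ n"
    by (metis of_real_mult of_real_numeral of_real_power)
  have "ip (reg n) (joint_input n x0) (joint_input n x0)
      = (\<Sum>y\<in>Pow {..<n}. \<Sum>x\<in>Pow {..<n}. 1 / (2 * 2 ^ n) * of_bool (x = y) + of_bool (y = x0) / 2 * of_bool (x = x0))"
    unfolding ip_def sum_reg cnj_mult_self
    by (intro sum.cong refl, rename_tac y x, case_tac "x = y"; case_tac "y = x0"; case_tac "x = x0")
       (simp_all add: joint_input_def norm_divide power_divide mult.commute c)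
  also have "\<dots> = (\<Sum>y\<in>Pow {..<n}. 1 / (2 * 2 ^ n) + 1 / 2 * of_bool (y = x0))"
  proof (intro sum.cong refl)
    fix y assume y: "y \<in> Pow {..<n}"
    have e1: "(\<Sum>x\<in>Pow {..<n}. 1 / (2 * 2 ^ n) * of_bool (x = y)) = (1 / (2 * 2 ^ n) :: complex)"
      by (rule sum_of_bool_eq) (use y in auto)
    have e2: "(\<Sum>x\<in>Pow {..<n}. of_bool (y = x0) / 2 * of_bool (x = x0)) = (of_bool (y = x0) / 2 :: complex)"
      by (rule sum_of_bool_eq) (use assms in auto)
    show "(\<Sum>x\<in>Pow {..<n}. 1 / (2 * 2 ^ n) * of_bool (x = y) + of_bool (y = x0) / 2 * of_bool (x = x0))
        = 1 / (2 * 2 ^ n) + 1 / 2 * (of_bool (y = x0) :: complex)"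
      unfolding sum.distrib e1 e2 by simp
  qed
  also have "\<dots> = (\<Sum>y\<in>Pow {..<n}. 1 / (2 * 2 ^ n)) + 1 / 2"
    unfolding sum.distrib by (subst sum_of_bool_eq[of "Pow {..<n}" x0 "\<lambda>_. 1 / 2"]) (use assms in auto)
  also have "\<dots> = 1" by (simp add: card_Pow)
  finally show ?thesis .
qed

text \<open>Cauchy-Schwarz, from the nonnegative squared distance between \<open>u\<close> and a
  phase-aligned \<open>v\<close>.\<close>

lemma ip_unit_le_1:
  assumes "ip X u u = 1" "ip X v v = 1"
  shows "cmod (ip X u v) \<le> 1"
proof -
  define t where "t = ip X u v"
  define w where "w = (if t = 0 then 1 else cnj (sgn t))"
  have "w * t = of_real (cmod t)" using cnj_mult_self[of t] by (simp add: w_def sgn_eq power2_eq_square)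
  moreover have "cmod w = 1" by (simp add: w_def norm_sgn)
  moreover have "0 \<le> (\<Sum>x\<in>X. (cmod (1 * u x - w * v x))\<^sup>2)" by (simp add: sum_nonneg)
  ultimately show ?thesis unfolding norm_sq_diff_phase[OF assms] by (simp add: t_def)
qed

section \<open>Outcomes and classical post-processing\<close>

definition outcomes :: "nat \<Rightarrow> (basis \<times> nat) set" where
  "outcomes n = reg n \<times> {..<6}"

lemma finite_outcomes [simp]: "finite (outcomes n)"
  by (simp add: outcomes_def)

lemma sum_outcomes: "(\<Sum>k\<in>outcomes n. F k) = (\<Sum>j\<in>reg n. \<Sum>z<6. F (j, z))"
  unfolding outcomes_def by (rule sum_Times)

definition meas_dist :: "nat \<Rightarrow> complex mat \<Rightarrow> (basis \<Rightarrow> complex) \<Rightarrow> (basis \<times> nat \<Rightarrow> basis \<Rightarrow> complex) \<Rightarrow> basis \<times> nat \<Rightarrow> real" where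
  "meas_dist n U s m k = (cmod (ip (reg n) (m k) (apply_query n U s)))\<^sup>2"

lemma finite_dist_meas:
  assumes "is_unitary (2 ^ n) U" "ip (reg n) s s = 1" "tight_frame (reg n) (outcomes n) m"
  shows "finite_dist (meas_dist n U s m) (outcomes n)"
  unfolding meas_dist_def
  using assms apply_query_norm[OF assms(1), of "Pow {..<n} \<times> UNIV" s]
  by (intro tight_frame_dist) (auto simp: reg_def[symmetric])

definition psupp :: "basis \<times> nat \<Rightarrow> nat set" where
  "psupp = (\<lambda>((a, c, f), z). a \<union> c)"

definition found :: "nat \<Rightarrow> (basis \<times> nat) list \<Rightarrow> nat set" where
  "found n l = {..<n} \<inter> \<Union> (psupp ` set l)"

definition xpart :: "nat \<Rightarrow> basis \<times> nat \<Rightarrow> nat set" where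
  "xpart n = (\<lambda>((y, x, f), z). {..<n} \<inter> x)"

definition ypart :: "nat \<Rightarrow> basis \<times> nat \<Rightarrow> nat set" where
  "ypart n = (\<lambda>((y, x, f), z). {..<n} \<inter> y)"

text \<open>The positions where column \<open>x0\<close> may be nonzero if only qubits in
  \<open>T\<close> are touched; the ancilla still holds \<open>x0\<close> after the query.\<close>

definition columns :: "nat \<Rightarrow> nat set \<Rightarrow> nat set \<Rightarrow> basis set" where
  "columns n T x0 = (\<lambda>y. (y, x0, False)) ` {y. y \<subseteq> {..<n} \<and> sdiff y x0 \<subseteq> T}"

definition paulis :: "nat set \<Rightarrow> basis set" where
  "paulis T = (\<lambda>(a, c). (a, c, False)) ` (Pow T \<times> Pow T)"

definition estimate :: "basis set \<Rightarrow> (basis \<times> nat) list \<Rightarrow> basis \<Rightarrow> complex" where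
  "estimate I l i = (\<Sum>k\<leftarrow>l. interference_estimate I k i) / of_nat (length l)"

lemma estimate_outside: "i \<notin> I \<Longrightarrow> estimate I l i = 0"
proof -
  assume "i \<notin> I"
  then have "interference_estimate I k i = 0" for k
    by (auto simp: interference_estimate_def split: prod.splits)
  then show ?thesis by (simp add: estimate_def)
qed

text \<open>The fallback for a vanishing estimate keeps the reference a unit vector on every
  history, as a legal measurement requires.\<close>

definition unit_of :: "nat \<Rightarrow> nat set \<Rightarrow> (nat set \<Rightarrow> complex) \<Rightarrow> nat set \<Rightarrow> complex" where
  "unit_of n x0 w = (let s = (\<Sum>y\<in>Pow {..<n}. (cmod (w y))\<^sup>2) in
     if s = 0 then (\<lambda>y. of_bool (y = x0)) else (\<lambda>y. w y / of_real (sqrt s)))"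

lemma unit_of_norm:
  assumes "x0 \<subseteq> {..<n}"
  shows "ip (Pow {..<n}) (unit_of n x0 w) (unit_of n x0 w) = 1"
proof -
  define s where "s = (\<Sum>y\<in>Pow {..<n}. (cmod (w y))\<^sup>2)"
  show ?thesis
  proof (cases "s = 0")
    case True
    then show ?thesis using assms by (simp add: unit_of_def s_def[symmetric] ip_basis_left)
  next
    case False
    have "0 \<le> s" by (simp add: s_def sum_nonneg)
    then have "(\<Sum>y\<in>Pow {..<n}. (cmod (w y / of_real (sqrt s)))\<^sup>2) = s / s"
      by (simp add: norm_divide power_divide s_def flip: sum_divide_distrib)
    then show ?thesis using False by (simp add: unit_of_def s_def[symmetric] ip_self del: of_real_sum of_real_power)
  qed
qed

definition reference :: "nat \<Rightarrow> nat set \<Rightarrow> nat set \<Rightarrow> (basis \<times> nat) list \<Rightarrow> nat set \<Rightarrow> complex" where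
  "reference n T x0 l = unit_of n x0 (\<lambda>y. estimate (columns n T x0) l (y, x0, False))"

definition flagged :: "nat set \<Rightarrow> (nat set \<Rightarrow> complex) \<Rightarrow> basis \<Rightarrow> complex" where
  "flagged x0 \<phi> = (\<lambda>(y, x, f). of_bool (f \<and> x = x0) * \<phi> y)"

lemma ip_flagged:
  assumes "x0 \<subseteq> {..<n}"
  shows "ip (reg n) (flagged x0 \<phi>) \<psi> = ip (Pow {..<n}) \<phi> (\<lambda>y. \<psi> (y, x0, True))"
proof -
  have "ip (reg n) (flagged x0 \<phi>) \<psi> = (\<Sum>y\<in>Pow {..<n}. \<Sum>x\<in>Pow {..<n}. cnj (\<phi> y) * \<psi> (y, x, True) * of_bool (x = x0))"
    unfolding ip_def sum_reg by (intro sum.cong refl) (auto simp: flagged_def)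
  also have "\<dots> = ip (Pow {..<n}) \<phi> (\<lambda>y. \<psi> (y, x0, True))"
    unfolding ip_def using assms by (intro sum.cong refl sum_of_bool_eq) auto
  finally show ?thesis .
qed

text \<open>The scalar \<open>z\<close> is quantified because it depends on the unknown overlap of
  the reference with a column of \<open>U\<close>. The threshold
  \<open>\<epsilon>\<^sup>2 / 50\<close> is what \<open>qdist_le_common_estimate\<close> converts
  into distance \<open>\<epsilon>\<close>.\<close>

definition fits :: "nat \<Rightarrow> real \<Rightarrow> nat set \<Rightarrow> (basis \<times> nat) list \<Rightarrow> complex mat \<Rightarrow> bool" where
  "fits n \<epsilon> T l V \<longleftrightarrow> is_unitary (2 ^ n) V \<and> (\<exists>z. 1 / 5 \<le> cmod z \<and>
     (\<Sum>(a, c)\<in>Pow {..<n} \<times> Pow {..<n}. (cmod (estimate (paulis T) l (a, c, False) - z * pauli n V (a, c)))\<^sup>2) \<le> \<epsilon>\<^sup>2 / 50)"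

text \<open>Every outcome must yield a unitary, hence the default identity when nothing
  fits.\<close>

definition learned :: "nat \<Rightarrow> real \<Rightarrow> nat set \<Rightarrow> (basis \<times> nat) list \<Rightarrow> complex mat" where
  "learned n \<epsilon> T l = (if \<exists>V. fits n \<epsilon> T l V then SOME V. fits n \<epsilon> T l V else 1\<^sub>m (2 ^ n))"

lemma unitary_one: "is_unitary N (1\<^sub>m N)"
proof -
  have "cadjoint (1\<^sub>m N) = 1\<^sub>m N" by (rule eq_matI) (auto simp: cadjoint_def)
  then show ?thesis by (simp add: is_unitary_def)
qed

lemma learned_unitary: "is_unitary (2 ^ n) (learned n \<epsilon> T l)"
  using someI_ex[of "fits n \<epsilon> T l"] by (auto simp: learned_def unitary_one fits_def)

lemma learned_close:
  assumes "fits n \<epsilon> T l U" "0 \<le> \<epsilon>"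
  shows "qdist U (learned n \<epsilon> T l) \<le> \<epsilon>"
proof -
  have "fits n \<epsilon> T l (learned n \<epsilon> T l)"
    using someI[of "fits n \<epsilon> T l", OF assms(1)] assms(1) by (auto simp: learned_def)
  then have "qdist U (learned n \<epsilon> T l) \<le> sqrt (50 * (\<epsilon>\<^sup>2 / 50))"
    using assms(1) qdist_le_common_estimate[of n U "learned n \<epsilon> T l" _ _ "\<lambda>(a, c). estimate (paulis T) l (a, c, False)" "\<epsilon>\<^sup>2 / 50"]
    unfolding fits_def by (auto simp: split_beta)
  then show ?thesis using assms(2) by simp
qed

section \<open>The stages of the learning algorithm\<close>

abbreviation std :: "'x \<Rightarrow> 'x \<Rightarrow> complex" where
  "std \<equiv> \<lambda>j x. of_bool (x = j)"

lemma ip_basis_frame: "ip X (basis_frame B (j, z)) \<psi> = (if z = 0 then ip X (B j) \<psi> else 0)"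
  by (simp add: basis_frame_def ip_def)

lemma card_columns: "finite T \<Longrightarrow> card (columns n T x0) \<le> 2 ^ card T"
proof -
  assume T: "finite T"
  have "card (columns n T x0) \<le> card {y. y \<subseteq> {..<n} \<and> sdiff y x0 \<subseteq> T}"
    unfolding columns_def by (rule card_image_le) simp
  also have "\<dots> \<le> card (Pow T)"
    by (rule card_inj_on_le[where f = "\<lambda>y. sdiff y x0"]) (use T in \<open>auto simp: inj_on_def sdiff_def\<close>)
  finally show ?thesis using T by (simp add: card_Pow)
qed

lemma card_paulis: "finite T \<Longrightarrow> card (paulis T) \<le> 4 ^ card T"
proof -
  assume T: "finite T"
  have "card (paulis T) \<le> card (Pow T \<times> Pow T)"
    unfolding paulis_def by (rule card_image_le) (use T in simp)
  also have "\<dots> = (2 * 2) ^ card T" using T by (simp only: card_cartesian_product card_Pow power_mult_distrib)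
  finally show ?thesis by simp
qed

locale learn_junta =
  fixes n k :: nat and U :: "complex mat" and S :: "nat set"
  assumes S: "S \<subseteq> {..<n}" "card S = k" and unitary: "is_unitary (2 ^ n) U"
    and col_supp: "\<And>y x. y \<subseteq> {..<n} \<Longrightarrow> x \<subseteq> {..<n} \<Longrightarrow> ent U y x \<noteq> 0 \<Longrightarrow> sdiff y x \<subseteq> S"
    and pauli_supp: "\<And>a c. a \<subseteq> {..<n} \<Longrightarrow> c \<subseteq> {..<n} \<Longrightarrow> pauli n U (a, c) \<noteq> 0 \<Longrightarrow> a \<union> c \<subseteq> S"
begin

abbreviation "Q \<equiv> Pow {..<n}"

section \<open>Stage one: finding the relevant qubits by Bell sampling\<close>

definition mass :: "nat set \<Rightarrow> real" where
  "mass T = (\<Sum>P | P \<in> Q \<times> Q \<and> \<not> fst P \<union> snd P \<subseteq> T. (cmod (pauli n U P))\<^sup>2)"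

definition p1 where "p1 = meas_dist n U (bell_input n) (basis_frame (flagbell n))"

lemma p1_eq:
  "p1 ((a, c, f), z) = of_bool (z = 0 \<and> \<not> f) * (cmod (pauli n U (a, c)))\<^sup>2"
proof -
  have "ip (Q \<times> Q) (bell n (a, c)) (\<lambda>(y, x). apply_query n U (bell_input n) (y, x, f))
      = ip (Q \<times> Q) (bell n (a, c)) (\<lambda>z. of_bool (\<not> f) * choi n U z)"
    by (rule ip_cong) (auto simp: apply_bell_input)
  also have "\<dots> = of_bool (\<not> f) * pauli n U (a, c)" unfolding ip_scale_right pauli_def ..
  finally show ?thesis by (simp add: p1_def meas_dist_def ip_basis_frame ip_flagbell)
qed

lemma dist1: "finite_dist p1 (outcomes n)"
  unfolding p1_def outcomes_def
  using finite_dist_meas[OF unitary bell_input_norm, of "basis_frame (flagbell n)"] tight_basis_frame[OF tight_flagbell]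
  by (simp add: outcomes_def)

lemma psupp_subset:
  assumes "v \<in> outcomes n" "p1 v \<noteq> 0"
  shows "psupp v \<subseteq> S"
proof -
  obtain a c f z where v: "v = ((a, c, f), z)" by (metis prod.exhaust)
  then show ?thesis using assms pauli_supp[of a c] by (auto simp: psupp_def outcomes_def reg_def p1_eq)
qed

lemma found_subset:
  assumes "\<And>x. x \<in> set l \<Longrightarrow> x \<in> outcomes n \<and> p1 x \<noteq> 0"
  shows "\<Union> (psupp ` set l) \<subseteq> S" "found n l = \<Union> (psupp ` set l)"
proof -
  have "psupp x \<subseteq> S" if "x \<in> set l" for x
    using assms[OF that] psupp_subset by blast
  then show "\<Union> (psupp ` set l) \<subseteq> S" by blast
  then show "found n l = \<Union> (psupp ` set l)" using S by (auto simp: found_def)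
qed

lemma mass_outcomes: "(\<Sum>x | x \<in> outcomes n \<and> \<not> psupp x \<subseteq> T. p1 x) = mass T"
proof -
  have "(\<Sum>x | x \<in> outcomes n \<and> \<not> psupp x \<subseteq> T. p1 x) = (\<Sum>x\<in>outcomes n. if \<not> psupp x \<subseteq> T then p1 x else 0)"
    by (simp add: sum.inter_filter)
  also have "\<dots> = (\<Sum>a\<in>Q. \<Sum>c\<in>Q. if \<not> a \<union> c \<subseteq> T then (cmod (pauli n U (a, c)))\<^sup>2 else 0)"
    unfolding sum_outcomes sum_reg sum_lessThan_6 by (simp add: p1_eq psupp_def cong: if_cong)
  also have "\<dots> = mass T"
    unfolding mass_def by (subst sum.inter_filter) (auto simp: sum_Times)
  finally show ?thesis .
qed

lemma mass_nonneg: "0 \<le> mass T"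
  by (simp add: mass_def sum_nonneg)

text \<open>By \<open>missing_mass\<close> the expected uncovered mass is at most
  \<open>k / m\<close>, hence at most \<open>\<eta> / 50\<close>; Markov's inequality does the
  rest.\<close>

lemma relevant_qubits_found:
  assumes "0 < \<eta>" "50 * real k \<le> \<eta> * real m"  "0 < m"
  shows "1 - 1 / 50 \<le> iid_expect p1 (outcomes n) m (\<lambda>l. of_bool (mass (found n l) \<le> \<eta>))"
proof -
  interpret finite_dist p1 "outcomes n" by (rule dist1)
  have finS: "finite S" using S finite_subset by blast
  have "iid_expect p1 (outcomes n) m (\<lambda>l. mass (found n l)) \<le> iid_expect p1 (outcomes n) m (\<lambda>l. mass ({} \<union> \<Union> (psupp ` set l)))"
    by (rule iid_expect_mono) (simp add: found_subset)
  moreover have "real m * iid_expect p1 (outcomes n) m (\<lambda>l. mass ({} \<union> \<Union> (psupp ` set l))) \<le> real k"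
    using missing_mass[where S = S and supp = psupp and T = "{}" and q = m] finS psupp_subset S
    unfolding mass_outcomes by simp
  ultimately have "real m * iid_expect p1 (outcomes n) m (\<lambda>l. mass (found n l)) \<le> real k"
    by (smt (verit, best) assms(3) mult_left_mono of_nat_0_le_iff)
  then have "50 * (real m * iid_expect p1 (outcomes n) m (\<lambda>l. mass (found n l))) \<le> \<eta> * real m"
    using assms(2) by linarith
  then have "iid_expect p1 (outcomes n) m (\<lambda>l. mass (found n l)) \<le> 1 / 50 * \<eta>"
    using assms(3) by (simp add: field_simps)
  then show ?thesis by (intro iid_expect_Markov assms(1) mass_nonneg)
qed

section \<open>Stage two: sampling a column and a reference entry\<close>

definition p2 where "p2 = meas_dist n U (bell_input n) (basis_frame std)"

lemma p2_eq:
  assumes "(y, x, f) \<in> reg n"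
  shows "p2 ((y, x, f), z) = of_bool (z = 0 \<and> \<not> f) * (cmod (ent U y x))\<^sup>2 / 2 ^ n"
proof -
  have "x \<subseteq> {..<n}" using assms by (simp add: reg_def)
  then show ?thesis using assms
    by (simp add: p2_def meas_dist_def ip_basis_frame ip_basis_left apply_bell_input choi_def norm_divide power_divide)
qed

lemma dist2: "finite_dist p2 (outcomes n)"
  unfolding p2_def outcomes_def
  using finite_dist_meas[OF unitary bell_input_norm, of "basis_frame std"] tight_basis_frame[OF tight_frame_standard[OF finite_reg]]
  by (simp add: outcomes_def)

lemma column_norm: "x \<subseteq> {..<n} \<Longrightarrow> (\<Sum>y\<in>Q. (cmod (ent U y x))\<^sup>2) = 1"
  using is_unitary_iff[of U n] unitary ip_self[of Q "\<lambda>y. ent U y x"]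
  by (auto simp: is_unitary_def simp del: of_real_sum)

text \<open>Two demands on the sampled pair: its column lies mostly on the positions allowed by
  \<open>T\<close>, and its entry is large enough to serve as the reference amplitude of stage
  three.\<close>

definition good_column :: "nat set \<Rightarrow> basis \<times> nat \<Rightarrow> bool" where
  "good_column T v \<longleftrightarrow> 3 / 4 \<le> (\<Sum>y | y \<in> Q \<and> sdiff y (xpart n v) \<subseteq> T. (cmod (ent U y (xpart n v)))\<^sup>2)
     \<and> 1 / (50 * 2 ^ k) \<le> (cmod (ent U (ypart n v) (xpart n v)))\<^sup>2"

text \<open>Each demand fails with probability at most 1/50. The column mass off \<open>T\<close>
  averages at most 1/200, so it exceeds 1/4 with probability at most 4/200. A column has at most
  \<open>2 ^ k\<close> nonzero entries, so its entries of squared modulus below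
  \<open>1 / (50 * 2 ^ k)\<close> have total weight at most 1/50.\<close>

lemma good_column_sampled:
  assumes "mass T \<le> 1 / 200"
  shows "1 - 2 / 50 \<le> iid_expect p2 (outcomes n) 1 (\<lambda>l. of_bool (good_column T (hd l)))"
proof -
  interpret finite_dist p2 "outcomes n" by (rule dist2)
  have finS: "finite S" using S finite_subset by blast
  define off where "off x = (\<Sum>y | y \<in> Q \<and> \<not> sdiff y x \<subseteq> T. (cmod (ent U y x))\<^sup>2)" for x
  have off_nonneg: "0 \<le> off x" for x by (simp add: off_def sum_nonneg)
  have on_off: "(\<Sum>y | y \<in> Q \<and> sdiff y x \<subseteq> T. (cmod (ent U y x))\<^sup>2) = 1 - off x" if "x \<in> Q" for x
  proof -
    have "{y. y \<in> Q \<and> sdiff y x \<subseteq> T} \<union> {y. y \<in> Q \<and> \<not> sdiff y x \<subseteq> T} = Q" by auto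
    moreover have "{y. y \<in> Q \<and> sdiff y x \<subseteq> T} \<inter> {y. y \<in> Q \<and> \<not> sdiff y x \<subseteq> T} = {}" by auto
    ultimately show ?thesis
      using sum.union_disjoint[of "{y. y \<in> Q \<and> sdiff y x \<subseteq> T}" "{y. y \<in> Q \<and> \<not> sdiff y x \<subseteq> T}" "\<lambda>y. (cmod (ent U y x))\<^sup>2"]
        column_norm[of x] that by (auto simp: off_def)
  qed
  have off_sum: "(\<Sum>x\<in>Q. off x) / 2 ^ n \<le> 1 / 200"
  proof -
    have "(\<Sum>x\<in>Q. off x) / 2 ^ n \<le> mass T"
      unfolding off_def column_mass_off mass_def by (rule sum_mono2) auto
    then show ?thesis using assms by linarith
  qed
  define small where "small y x = ((cmod (ent U y x))\<^sup>2 < 1 / (50 * 2 ^ k))" for y x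
  have small_sum: "(\<Sum>y\<in>Q. of_bool (small y x) * (cmod (ent U y x))\<^sup>2) \<le> 1 / 50" if x: "x \<in> Q" for x
  proof -
    have "(\<Sum>y\<in>Q. of_bool (small y x) * (cmod (ent U y x))\<^sup>2) \<le> (\<Sum>y\<in>Q. if sdiff y x \<subseteq> S then 1 / (50 * 2 ^ k) else 0)"
    proof (rule sum_mono)
      fix y assume "y \<in> Q"
      then show "of_bool (small y x) * (cmod (ent U y x))\<^sup>2 \<le> (if sdiff y x \<subseteq> S then 1 / (50 * 2 ^ k) else 0)"
        using col_supp[of y x] x by (cases "ent U y x = 0") (auto simp: small_def)
    qed
    also have "\<dots> = real (card {y. y \<in> Q \<and> sdiff y x \<subseteq> S}) * (1 / (50 * 2 ^ k))"
      by (simp flip: sum.inter_filter)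
    also have "\<dots> \<le> 2 ^ k * (1 / (50 * 2 ^ k))"
    proof (rule mult_right_mono)
      have "card {y. y \<in> Q \<and> sdiff y x \<subseteq> S} \<le> card (Pow S)"
        by (rule card_inj_on_le[where f = "\<lambda>y. sdiff y x"]) (use finS in \<open>auto simp: inj_on_def sdiff_def\<close>)
      then show "real (card {y. y \<in> Q \<and> sdiff y x \<subseteq> S}) \<le> 2 ^ k"
        using S finS by (simp add: card_Pow)
    qed simp
    finally show ?thesis by simp
  qed
  have "iid_expect p2 (outcomes n) 1 (\<lambda>l. of_bool (\<not> good_column T (hd l)))
      = (\<Sum>v\<in>outcomes n. p2 v * of_bool (\<not> good_column T v))" by simp
  also have "\<dots> = (\<Sum>y\<in>Q. \<Sum>x\<in>Q. (cmod (ent U y x))\<^sup>2 / 2 ^ n * of_bool (1 / 4 < off x \<or> small y x))"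
    unfolding sum_outcomes sum_reg sum_lessThan_6
  proof (intro sum.cong refl)
    fix y x assume yx: "y \<in> Q" "x \<in> Q"
    then have r: "(y, x, f) \<in> reg n" for f by (simp add: reg_def)
    have xy: "xpart n ((y, x, False), 0) = x" "ypart n ((y, x, False), 0) = y"
      using yx by (auto simp: xpart_def ypart_def)
    have "\<not> good_column T ((y, x, False), 0) \<longleftrightarrow> 1 / 4 < off x \<or> small y x"
      unfolding good_column_def xy on_off[OF yx(2)] small_def by linarith
    \<comment> \<open>Of the twelve outcomes at \<open>(y, x)\<close> only flag \<open>False\<close>
      with \<open>z = 0\<close> can have nonzero weight.\<close>
    then show "p2 ((y, x, False), 0) * of_bool (\<not> good_column T ((y, x, False), 0)) +
        p2 ((y, x, False), 1) * of_bool (\<not> good_column T ((y, x, False), 1)) +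
        p2 ((y, x, False), 2) * of_bool (\<not> good_column T ((y, x, False), 2)) +
        p2 ((y, x, False), 3) * of_bool (\<not> good_column T ((y, x, False), 3)) +
        p2 ((y, x, False), 4) * of_bool (\<not> good_column T ((y, x, False), 4)) +
        p2 ((y, x, False), 5) * of_bool (\<not> good_column T ((y, x, False), 5)) +
        (p2 ((y, x, True), 0) * of_bool (\<not> good_column T ((y, x, True), 0)) +
        p2 ((y, x, True), 1) * of_bool (\<not> good_column T ((y, x, True), 1)) +
        p2 ((y, x, True), 2) * of_bool (\<not> good_column T ((y, x, True), 2)) +
        p2 ((y, x, True), 3) * of_bool (\<not> good_column T ((y, x, True), 3)) +
        p2 ((y, x, True), 4) * of_bool (\<not> good_column T ((y, x, True), 4)) +
        p2 ((y, x, True), 5) * of_bool (\<not> good_column T ((y, x, True), 5)))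
        = (cmod (ent U y x))\<^sup>2 / 2 ^ n * of_bool (1 / 4 < off x \<or> small y x)"
      by (simp add: p2_eq[OF r])
  qed
  also have "\<dots> \<le> (\<Sum>y\<in>Q. \<Sum>x\<in>Q. ((cmod (ent U y x))\<^sup>2 * (4 * off x) + of_bool (small y x) * (cmod (ent U y x))\<^sup>2) / 2 ^ n)"
  proof (intro sum_mono)
    fix y x
    \<comment> \<open>Pointwise form of Markov's inequality at threshold 1/4, joined with a union
      bound.\<close>
    have "of_bool (1 / 4 < off x \<or> small y x) \<le> 4 * off x + of_bool (small y x)"
      using off_nonneg[of x] by (auto simp: of_bool_def)
    from mult_left_mono[OF this, of "(cmod (ent U y x))\<^sup>2 / 2 ^ n"]
    show "(cmod (ent U y x))\<^sup>2 / 2 ^ n * of_bool (1 / 4 < off x \<or> small y x)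
       \<le> ((cmod (ent U y x))\<^sup>2 * (4 * off x) + of_bool (small y x) * (cmod (ent U y x))\<^sup>2) / 2 ^ n"
      by (simp add: field_simps)
  qed
  also have "\<dots> = (\<Sum>x\<in>Q. \<Sum>y\<in>Q. ((cmod (ent U y x))\<^sup>2 * (4 * off x) + of_bool (small y x) * (cmod (ent U y x))\<^sup>2) / 2 ^ n)"
    by (rule sum.swap)
  also have "\<dots> \<le> (\<Sum>x\<in>Q. (4 * off x + 1 / 50) / 2 ^ n)"
  proof (rule sum_mono)
    fix x assume x: "x \<in> Q"
    have "(\<Sum>y\<in>Q. (cmod (ent U y x))\<^sup>2 * (4 * off x)) = 4 * off x"
      using column_norm[of x] x by (simp flip: sum_distrib_right)
    then show "(\<Sum>y\<in>Q. ((cmod (ent U y x))\<^sup>2 * (4 * off x) + of_bool (small y x) * (cmod (ent U y x))\<^sup>2) / 2 ^ n)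
       \<le> (4 * off x + 1 / 50) / 2 ^ n"
      using small_sum[OF x] unfolding sum_divide_distrib[symmetric] sum.distrib
      by (intro divide_right_mono) auto
  qed
  also have "\<dots> = 4 * ((\<Sum>x\<in>Q. off x) / 2 ^ n) + 1 / 50"
    by (simp add: sum.distrib add_divide_distrib card_Pow flip: sum_divide_distrib sum_distrib_left)
  also have "\<dots> \<le> 2 / 50" using off_sum by linarith
  finally have bad: "iid_expect p2 (outcomes n) 1 (\<lambda>l. of_bool (\<not> good_column T (hd l))) \<le> 2 / 50" .
  have "iid_expect p2 (outcomes n) 1 (\<lambda>l. of_bool (good_column T (hd l)))
     = iid_expect p2 (outcomes n) 1 (\<lambda>l. 1 + (- 1) * of_bool (\<not> good_column T (hd l)))"
    by (intro arg_cong[of _ _ "iid_expect p2 (outcomes n) 1"] ext) auto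
  also have "\<dots> = 1 + (- 1) * iid_expect p2 (outcomes n) 1 (\<lambda>l. of_bool (\<not> good_column T (hd l)))"
    by (simp only: iid_expect_add iid_expect_scale iid_expect_const)
  finally show ?thesis using bad by linarith
qed

end

lemma xpart_subset: "xpart n v \<subseteq> {..<n}"
  by (auto simp: xpart_def split: prod.splits)

lemma ypart_subset: "ypart n v \<subseteq> {..<n}"
  by (auto simp: ypart_def split: prod.splits)

lemma columns_reg: "columns n T x0 \<subseteq> reg n" if "x0 \<subseteq> {..<n}"
  using that by (auto simp: columns_def reg_def)

lemma columns_nonempty: "columns n T x0 \<noteq> {}" if "x0 \<subseteq> {..<n}"
  using that by (auto simp: columns_def sdiff_def)

lemma std_norm: "j \<in> reg n \<Longrightarrow> ip (reg n) (std j) (std j) = 1"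
  by (simp add: ip_basis_left)

lemma paulis_reg: "T \<subseteq> {..<n} \<Longrightarrow> paulis T \<subseteq> reg n"
  by (auto simp: paulis_def reg_def)

lemma paulis_nonempty: "paulis T \<noteq> {}"
  by (auto simp: paulis_def)

lemma flagged_norm:
  assumes "x0 \<subseteq> {..<n}" "ip (Pow {..<n}) \<phi> \<phi> = 1"
  shows "ip (reg n) (flagged x0 \<phi>) (flagged x0 \<phi>) = 1"
  using ip_flagged[OF assms(1), of \<phi> "flagged x0 \<phi>"] assms(2) by (simp add: flagged_def)

context learn_junta
begin

section \<open>Stage three: learning a reference for the column\<close>

definition p3 where
  "p3 T v = meas_dist n U (column_input (xpart n v))
    (interference_frame std (columns n T (xpart n v)) (std (ypart n v, xpart n v, False)))"

lemma state_norm: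
  "ip (reg n) s s = 1 \<Longrightarrow> ip (reg n) (apply_query n U s) (apply_query n U s) = 1"
  using apply_query_norm[OF unitary, of "Pow {..<n} \<times> UNIV" s] by (simp add: reg_def)

text \<open>The measured entry \<open>\<kappa>\<close> of the column is the reference amplitude, and
  the standard basis vectors in \<open>columns\<close> are the coordinates. The error falls below
  the tolerance of \<open>overlap_of_estimate\<close>, which is relative to the squared modulus of
  \<open>\<kappa>\<close>.\<close>

lemma reference_learned:
  assumes T: "finite T" "card T \<le> k" and v: "good_column T v" and m: "160000 * 4 ^ k \<le> real m"
  shows "1 - 1 / 50 \<le> iid_expect (p3 T v) (outcomes n) m
    (\<lambda>l. of_bool (2 / 5 \<le> cmod (ip Q (reference n T (xpart n v) l) (\<lambda>y. ent U y (xpart n v)))))"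
proof -
  define x0 y0 where "x0 = xpart n v" and "y0 = ypart n v"
  have x0: "x0 \<subseteq> {..<n}" and y0: "y0 \<subseteq> {..<n}" by (simp_all add: x0_def y0_def xpart_subset ypart_subset)
  define I where "I = columns n T x0"
  define r where "r = std (y0, x0, False)"
  define \<psi> where "\<psi> = apply_query n U (column_input x0)"
  define \<kappa> where "\<kappa> = ent U y0 x0"
  define J where "J = {y. y \<subseteq> {..<n} \<and> sdiff y x0 \<subseteq> T}"
  have finJ: "finite J" by (simp add: J_def)
  have JQ: "J \<subseteq> Q" by (auto simp: J_def)
  have m0: "0 < m"
  proof -
    have "(0::real) < 160000 * 4 ^ k" by simp
    then show ?thesis using m by linarith
  qed
  have rr: "(y0, x0, False) \<in> reg n" using x0 y0 by (simp add: reg_def)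
  have \<psi>r: "ip (reg n) r \<psi> = \<kappa>"
    using rr x0 by (simp add: r_def ip_basis_left \<psi>_def apply_column_input \<kappa>_def)
  have \<psi>I: "ip (reg n) (std (y, x0, False)) \<psi> = ent U y x0" if "y \<in> J" for y
  proof -
    have "(y, x0, False) \<in> reg n" using that x0 by (simp add: reg_def J_def)
    then show ?thesis using x0 by (simp add: ip_basis_left \<psi>_def apply_column_input)
  qed
  have p: "p3 T v = (\<lambda>k. (cmod (ip (reg n) (interference_frame std I r k) \<psi>))\<^sup>2)"
    by (simp add: fun_eq_iff p3_def meas_dist_def x0_def y0_def I_def r_def \<psi>_def)
  interpret finite_dist "p3 T v" "outcomes n"
    unfolding p outcomes_def
    by (rule tight_frame_dist[OF tight_interference_frame])
       (use x0 rr in \<open>auto simp: I_def columns_reg columns_nonempty r_def std_norm \<psi>_def state_norm column_input_norm tight_frame_standard\<close>)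
  have "1 - 1 / 50 \<le> iid_expect (p3 T v) (outcomes n) m (\<lambda>l. of_bool
    ((\<Sum>i\<in>I. (cmod ((\<Sum>k\<leftarrow>l. interference_estimate I k i) / of_nat m - ip (reg n) (std i) \<psi> * cnj (ip (reg n) r \<psi>)))\<^sup>2)
      \<le> 200 * real (card I) / real m))"
    unfolding p outcomes_def
    by (rule interference_concentration)
       (use x0 rr m0 in \<open>auto simp: I_def columns_reg columns_nonempty r_def std_norm \<psi>_def state_norm column_input_norm tight_frame_standard\<close>)
  also have "\<dots> \<le> iid_expect (p3 T v) (outcomes n) m
    (\<lambda>l. of_bool (2 / 5 \<le> cmod (ip Q (reference n T x0 l) (\<lambda>y. ent U y x0))))"
  proof (rule iid_expect_mono)
    fix l :: "(basis \<times> nat) list" assume l: "length l = m"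
    define w where "w y = estimate I l (y, x0, False)" for y
    have "2 / 5 \<le> cmod (ip Q (reference n T x0 l) (\<lambda>y. ent U y x0))"
      if "(\<Sum>i\<in>I. (cmod ((\<Sum>k\<leftarrow>l. interference_estimate I k i) / of_nat m - ip (reg n) (std i) \<psi> * cnj (ip (reg n) r \<psi>)))\<^sup>2)
      \<le> 200 * real (card I) / real m"
    proof -
      have Ieq: "I = (\<lambda>y. (y, x0, False)) ` J" by (simp add: I_def columns_def J_def)
      have "(\<Sum>y\<in>J. (cmod (w y - ent U y x0 * cnj \<kappa>))\<^sup>2) \<le> 200 * real (card I) / real m"
        using that unfolding \<psi>r
        by (simp add: Ieq sum.reindex inj_on_def \<psi>I w_def estimate_def l)
      also have "\<dots> \<le> 200 * 2 ^ k / real m"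
      proof -
        have "real (card I) \<le> 2 ^ card T" using card_columns[OF T(1), of n x0] unfolding I_def
          by (metis of_nat_le_iff of_nat_numeral of_nat_power)
        also have "\<dots> \<le> 2 ^ k" using T(2) by (simp add: power_increasing)
        finally show ?thesis by (simp add: divide_right_mono)
      qed
      \<comment> \<open>The constant 160000 is 200 * 50 * 16: concentration, lower bound on the
        entry, and tolerance 1/16.\<close>
      also have "\<dots> \<le> 1 / (50 * 2 ^ k) / 16"
      proof -
        have "(200 * 2 ^ k) * (50 * 2 ^ k * 16) = 160000 * (2 * 2 :: real) ^ k"
          by (simp only: power_mult_distrib)
        also have "\<dots> \<le> real m" using m by simp
        finally show ?thesis using m0 by (simp add: field_simps)
      qed
      also have "\<dots> \<le> (cmod \<kappa>)\<^sup>2 / 16"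
        using v by (simp add: good_column_def \<kappa>_def x0_def y0_def)
      finally have close: "(\<Sum>y\<in>J. (cmod (w y - ent U y x0 * cnj \<kappa>))\<^sup>2) \<le> (cmod \<kappa>)\<^sup>2 / 16" .
      have "0 < 1 / (50 * (2::real) ^ k)" by simp
      also have "\<dots> \<le> (cmod \<kappa>)\<^sup>2" using v by (simp add: good_column_def \<kappa>_def x0_def y0_def)
      finally have k0: "\<kappa> \<noteq> 0" by auto
      have "3 / 4 \<le> (\<Sum>y\<in>J. (cmod (ent U y x0))\<^sup>2)" using v by (simp add: good_column_def J_def x0_def)
      note ov = overlap_of_estimate[OF finJ k0 this close]
      have w0: "w y = 0" if "y \<in> Q - J" for y
      proof -
        have "(y, x0, False) \<notin> I" using that unfolding Ieq by auto
        then show ?thesis by (simp add: w_def estimate_outside)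
      qed
      define s where "s = (\<Sum>y\<in>Q. (cmod (w y))\<^sup>2)"
      have sJ: "s = (\<Sum>y\<in>J. (cmod (w y))\<^sup>2)"
        unfolding s_def by (rule sum.mono_neutral_right) (use JQ w0 in auto)
      have ipJ: "ip Q w (\<lambda>y. ent U y x0) = ip J w (\<lambda>y. ent U y x0)"
        unfolding ip_def by (rule sum.mono_neutral_right) (use JQ w0 in auto)
      have s0: "0 < s" using ov(1) sJ by simp
      have "reference n T x0 l = (\<lambda>y. (1 / of_real (sqrt s)) * w y)"
        using s0 by (simp add: reference_def unit_of_def I_def[symmetric] w_def[symmetric] s_def[symmetric])
      then have "cmod (ip Q (reference n T x0 l) (\<lambda>y. ent U y x0)) = cmod (ip J w (\<lambda>y. ent U y x0)) / sqrt s"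
        using s0 by (simp add: ip_scale_left ipJ norm_mult norm_divide del: times_divide_eq_left) simp
      moreover have "2 / 5 \<le> cmod (ip J w (\<lambda>y. ent U y x0)) / sqrt s"
        using ov(2) s0 unfolding sJ[symmetric] by (simp add: pos_le_divide_eq)
      ultimately show ?thesis by simp
    qed
    then show "of_bool ((\<Sum>i\<in>I. (cmod ((\<Sum>k\<leftarrow>l. interference_estimate I k i) / of_nat m - ip (reg n) (std i) \<psi> * cnj (ip (reg n) r \<psi>)))\<^sup>2)
      \<le> 200 * real (card I) / real m) \<le> (of_bool (2 / 5 \<le> cmod (ip Q (reference n T x0 l) (\<lambda>y. ent U y x0))) :: real)"
      by (simp add: of_bool_def)
  qed
  finally show ?thesis unfolding x0_def .
qed

section \<open>Stage four: estimating the Pauli coefficients\<close>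

definition p4 where
  "p4 T x0 \<phi> = meas_dist n U (joint_input n x0) (interference_frame (flagbell n) (paulis T) (flagged x0 \<phi>))"

text \<open>The squared error splits into the sampling error on \<open>paulis T\<close>, at most
  \<open>\<epsilon>\<^sup>2 / 100\<close>, and the Pauli mass outside \<open>T\<close>, estimated as
  zero, at most \<open>\<epsilon>\<^sup>2 / 200\<close>.\<close>

lemma pauli_coefficients_learned:
  assumes T: "T \<subseteq> {..<n}" "card T \<le> k" and mass: "mass T \<le> \<epsilon>\<^sup>2 / 200" and \<epsilon>: "0 < \<epsilon>"
    and x0: "x0 \<subseteq> {..<n}" and \<phi>: "ip Q \<phi> \<phi> = 1" "2 / 5 \<le> cmod (ip Q \<phi> (\<lambda>y. ent U y x0))"
    and m: "20000 * 4 ^ k / \<epsilon>\<^sup>2 \<le> real m"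
  shows "1 - 1 / 50 \<le> iid_expect (p4 T x0 \<phi>) (outcomes n) m (\<lambda>l. of_bool (fits n \<epsilon> T l U))"
proof -
  define I where "I = paulis T"
  define r where "r = flagged x0 \<phi>"
  define \<psi> where "\<psi> = apply_query n U (joint_input n x0)"
  define c where "c = ip Q \<phi> (\<lambda>y. ent U y x0)"
  \<comment> \<open>Coefficient and reference amplitude each carry a factor
    \<open>1 / sqrt 2\<close> from \<open>joint_input\<close>; the overlap bound 2/5 therefore
    becomes 1/5 for \<open>z\<close>.\<close>
  define z where "z = cnj c / 2"
  have finT: "finite T" using T finite_subset by blast
  have m0: "0 < m"
  proof -
    have "(0::real) < 20000 * 4 ^ k / \<epsilon>\<^sup>2" using \<epsilon> by simp
    then show ?thesis using m by linarith
  qed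
  have s2: "complex_of_real (sqrt 2) * complex_of_real (sqrt 2) = 2" by (simp flip: of_real_mult)
  have \<psi>r: "ip (reg n) r \<psi> = (1 / of_real (sqrt 2)) * c"
  proof -
    have "ip (reg n) r \<psi> = ip Q \<phi> (\<lambda>y. (1 / of_real (sqrt 2)) * ent U y x0)"
      unfolding r_def ip_flagged[OF x0] by (rule ip_cong) (use x0 in \<open>auto simp: \<psi>_def apply_joint_input\<close>)
    then show ?thesis by (simp only: ip_scale_right c_def)
  qed
  have \<psi>I: "ip (reg n) (flagbell n (a, b, False)) \<psi> = (1 / of_real (sqrt 2)) * pauli n U (a, b)" for a b
  proof -
    have "ip (reg n) (flagbell n (a, b, False)) \<psi> = ip (Q \<times> Q) (bell n (a, b)) (\<lambda>z. (1 / of_real (sqrt 2)) * choi n U z)"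
      unfolding ip_flagbell by (rule ip_cong) (use x0 in \<open>auto simp: \<psi>_def apply_joint_input\<close>)
    then show ?thesis by (simp only: ip_scale_right pauli_def)
  qed
  have prod: "ip (reg n) (flagbell n (a, b, False)) \<psi> * cnj (ip (reg n) r \<psi>) = z * pauli n U (a, b)" for a b
    unfolding \<psi>I \<psi>r z_def using s2 by (simp add: field_simps)
  have p: "p4 T x0 \<phi> = (\<lambda>k. (cmod (ip (reg n) (interference_frame (flagbell n) I r k) \<psi>))\<^sup>2)"
    by (simp add: fun_eq_iff p4_def meas_dist_def I_def r_def \<psi>_def)
  note facts = T x0 \<phi> tight_flagbell paulis_reg[OF T(1)] paulis_nonempty flagged_norm[OF x0 \<phi>(1)]
    state_norm[OF joint_input_norm[OF x0]]
  interpret finite_dist "p4 T x0 \<phi>" "outcomes n"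
    unfolding p outcomes_def
    by (rule tight_frame_dist[OF tight_interference_frame]) (use facts in \<open>auto simp: I_def r_def \<psi>_def\<close>)
  have u1: "ip Q (\<lambda>y. ent U y x0) (\<lambda>y. ent U y x0) = 1"
    using is_unitary_iff[of U n] unitary x0 by (auto simp: is_unitary_def)
  have c1: "cmod c \<le> 1" unfolding c_def by (rule ip_unit_le_1[OF \<phi>(1) u1])
  have "1 - 1 / 50 \<le> iid_expect (p4 T x0 \<phi>) (outcomes n) m (\<lambda>l. of_bool
    ((\<Sum>i\<in>I. (cmod ((\<Sum>k\<leftarrow>l. interference_estimate I k i) / of_nat m - ip (reg n) (flagbell n i) \<psi> * cnj (ip (reg n) r \<psi>)))\<^sup>2)
      \<le> 200 * real (card I) / real m))"
    unfolding p outcomes_def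
    by (rule interference_concentration) (use facts m0 in \<open>auto simp: I_def r_def \<psi>_def\<close>)
  also have "\<dots> \<le> iid_expect (p4 T x0 \<phi>) (outcomes n) m (\<lambda>l. of_bool (fits n \<epsilon> T l U))"
  proof (rule iid_expect_mono)
    fix l :: "(basis \<times> nat) list" assume l: "length l = m"
    define w where "w = (\<lambda>(a, b). estimate I l (a, b, False))"
    have "fits n \<epsilon> T l U"
      if "(\<Sum>i\<in>I. (cmod ((\<Sum>k\<leftarrow>l. interference_estimate I k i) / of_nat m - ip (reg n) (flagbell n i) \<psi> * cnj (ip (reg n) r \<psi>)))\<^sup>2)
      \<le> 200 * real (card I) / real m"
    proof -
      have "(\<Sum>P\<in>Pow T \<times> Pow T. (cmod (w P - z * pauli n U P))\<^sup>2) \<le> 200 * real (card I) / real m"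
        using that unfolding I_def[THEN trans, OF paulis_def]
        by (subst (asm) sum.reindex) (auto simp: inj_on_def prod w_def estimate_def l split_beta I_def paulis_def)
      also have "\<dots> \<le> 200 * 4 ^ k / real m"
      proof -
        have "real (card I) \<le> 4 ^ card T" using card_paulis[OF finT] unfolding I_def
          by (metis of_nat_le_iff of_nat_numeral of_nat_power)
        also have "\<dots> \<le> 4 ^ k" using T(2) by (simp add: power_increasing)
        finally show ?thesis by (simp add: divide_right_mono)
      qed
      \<comment> \<open>Here 20000 = 200 * 100.\<close>
      also have "\<dots> \<le> \<epsilon>\<^sup>2 / 100" using m m0 \<epsilon> by (simp add: field_simps)
      finally have on: "(\<Sum>P\<in>Pow T \<times> Pow T. (cmod (w P - z * pauli n U P))\<^sup>2) \<le> \<epsilon>\<^sup>2 / 100" .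
      let ?B = "{P. P \<in> Q \<times> Q \<and> \<not> fst P \<union> snd P \<subseteq> T}"
      have w0: "w P = 0" if "P \<in> ?B" for P
      proof -
        have "(fst P, snd P, False) \<notin> I" using that by (auto simp: I_def paulis_def)
        then show ?thesis by (simp add: w_def estimate_outside split_beta)
      qed
      have "(cmod z)\<^sup>2 \<le> 1"
        using c1 by (intro power_le_one) (auto simp: z_def norm_divide)
      then have "(cmod z)\<^sup>2 * mass T \<le> 1 * mass T" by (intro mult_right_mono mass_nonneg)
      then have off: "(\<Sum>P\<in>?B. (cmod (w P - z * pauli n U P))\<^sup>2) \<le> \<epsilon>\<^sup>2 / 200"
        using mass by (simp add: w0 norm_mult power_mult_distrib mass_def flip: sum_distrib_left)
      have QQ: "Q \<times> Q = Pow T \<times> Pow T \<union> ?B" "(Pow T \<times> Pow T) \<inter> ?B = {}" using T by auto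
      have "(\<Sum>P\<in>Q \<times> Q. (cmod (w P - z * pauli n U P))\<^sup>2) =
          (\<Sum>P\<in>Pow T \<times> Pow T. (cmod (w P - z * pauli n U P))\<^sup>2) + (\<Sum>P\<in>?B. (cmod (w P - z * pauli n U P))\<^sup>2)"
        by (subst QQ(1), rule sum.union_disjoint) (use finT QQ(2) in auto)
      also have "\<dots> \<le> \<epsilon>\<^sup>2 / 50" using on off zero_le_power2[of \<epsilon>] by linarith
      finally have "(\<Sum>P\<in>Q \<times> Q. (cmod (w P - z * pauli n U P))\<^sup>2) \<le> \<epsilon>\<^sup>2 / 50" .
      moreover have "1 / 5 \<le> cmod z" using \<phi>(2) by (simp add: z_def c_def norm_divide)
      ultimately show ?thesis
        unfolding fits_def using unitary by (auto simp: w_def I_def split_beta intro!: exI[of _ z])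
    qed
    then show "of_bool ((\<Sum>i\<in>I. (cmod ((\<Sum>k\<leftarrow>l. interference_estimate I k i) / of_nat m - ip (reg n) (flagbell n i) \<psi> * cnj (ip (reg n) r \<psi>)))\<^sup>2)
      \<le> 200 * real (card I) / real m) \<le> (of_bool (fits n \<epsilon> T l U) :: real)"
      by (simp add: of_bool_def)
  qed
  finally show ?thesis .
qed

end

section \<open>The learning theorem\<close>

definition stage_input :: "nat \<Rightarrow> nat \<Rightarrow> nat \<Rightarrow> (basis \<times> nat) list \<Rightarrow> basis \<Rightarrow> complex" where
  "stage_input n m1 m2 h = (if length h \<le> m1 then bell_input n
     else if length h < m1 + 1 + m2 then column_input (xpart n (h ! m1))
     else joint_input n (xpart n (h ! m1)))"

text \<open>Position \<open>m1\<close> of the history holds the single column sample. Its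
  experiment, run when \<open>length h = m1\<close>, shares the entangled input of stage one and
  differs only in the measurement. Stage three fills the \<open>m2\<close> positions after
  it.\<close>

definition stage_frame :: "nat \<Rightarrow> nat \<Rightarrow> nat \<Rightarrow> (basis \<times> nat) list \<Rightarrow> basis \<times> nat \<Rightarrow> basis \<Rightarrow> complex" where
  "stage_frame n m1 m2 h = (let T = found n (take m1 h); x0 = xpart n (h ! m1) in
     if length h < m1 then basis_frame (flagbell n)
     else if length h = m1 then basis_frame std
     else if length h < m1 + 1 + m2 then
       interference_frame std (columns n T x0) (std (ypart n (h ! m1), x0, False))
     else interference_frame (flagbell n) (paulis T)
       (flagged x0 (reference n T x0 (take m2 (drop (m1 + 1) h)))))"

lemma stage_input_norm: "ip (reg n) (stage_input n m1 m2 h) (stage_input n m1 m2 h) = 1"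
  by (simp add: stage_input_def bell_input_norm column_input_norm joint_input_norm xpart_subset)

lemma found_bound: "found n l \<subseteq> {..<n}"
  by (auto simp: found_def)

lemma reference_norm:
  "x0 \<subseteq> {..<n} \<Longrightarrow> ip (Pow {..<n}) (reference n T x0 l) (reference n T x0 l) = 1"
  unfolding reference_def by (rule unit_of_norm)

lemma tight_stage_frame: "tight_frame (reg n) (outcomes n) (stage_frame n m1 m2 h)"
proof -
  define T x0 y0 where "T = found n (take m1 h)" "x0 = xpart n (h ! m1)" "y0 = ypart n (h ! m1)"
  note d = T_x0_y0_def
  have x0: "x0 \<subseteq> {..<n}" and T: "T \<subseteq> {..<n}" and y0: "y0 \<subseteq> {..<n}"
    by (simp_all add: d xpart_subset ypart_subset found_bound)
  have yx: "(y0, x0, False) \<in> reg n" using x0 y0 by (simp add: reg_def)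
  have "tight_frame (reg n) (outcomes n) (interference_frame std (columns n T x0) (std (y0, x0, False)))"
    unfolding outcomes_def
    by (rule tight_interference_frame)
       (use x0 yx in \<open>simp_all add: tight_frame_standard columns_reg columns_nonempty std_norm\<close>)
  moreover have "tight_frame (reg n) (outcomes n) (interference_frame (flagbell n) (paulis T) (flagged x0 (reference n T x0 l)))" for l
    unfolding outcomes_def
    by (rule tight_interference_frame)
       (use x0 T in \<open>auto simp: tight_flagbell paulis_reg paulis_nonempty flagged_norm reference_norm\<close>)
  moreover have "tight_frame (reg n) (outcomes n) (basis_frame (flagbell n))"
    "tight_frame (reg n) (outcomes n) (basis_frame std)"
    unfolding outcomes_def by (auto intro!: tight_basis_frame tight_flagbell tight_frame_standard)
  ultimately show ?thesis by (simp add: stage_frame_def Let_def flip: d)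
qed

lemma adaptive_expect_nonneg:
  assumes "\<And>h x. 0 \<le> P h x" "\<And>h. 0 \<le> f h"
  shows "0 \<le> adaptive_expect P X q h f"
  using assms by (induction q arbitrary: h) (auto intro: sum_nonneg)

text \<open>The four stages fail with probability at most 1/50, 2/50, 1/50 and 1/50, together
  1/10.\<close>

lemma (in learn_junta) learning_success:
  assumes \<epsilon>: "0 < \<epsilon>" "\<epsilon> \<le> 1"
    and m1: "10000 * real k \<le> \<epsilon>\<^sup>2 * real m1" "0 < m1"
    and m2: "160000 * 4 ^ k \<le> real m2" and m3: "20000 * 4 ^ k / \<epsilon>\<^sup>2 \<le> real m3"
  defines "P \<equiv> \<lambda>h. meas_dist n U (stage_input n m1 m2 h) (stage_frame n m1 m2 h)"
  defines "f \<equiv> \<lambda>h. if qdist U (learned n \<epsilon> (found n (take m1 h)) (drop (m1 + 1 + m2) h)) \<le> \<epsilon> then 1 else 0 :: real"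
  shows "9 / 10 \<le> adaptive_expect P (outcomes n) (m1 + (1 + (m2 + m3))) [] f"
proof -
  let ?X = "outcomes n"
  have dist: "finite_dist (P h) ?X" for h
    unfolding P_def by (rule finite_dist_meas[OF unitary stage_input_norm tight_stage_frame])
  have P0: "0 \<le> P h x" for h x by (simp add: P_def meas_dist_def)
  have f0: "0 \<le> f h" for h by (simp add: f_def)
  have E0: "0 \<le> adaptive_expect P ?X q h g" if "\<And>h. 0 \<le> g h" for q h g
    by (rule adaptive_expect_nonneg) (use P0 that in auto)
  have \<epsilon>2: "\<epsilon>\<^sup>2 \<le> 1" using \<epsilon> by (simp add: power_le_one)

  \<comment> \<open>The claims run backwards from the last stage; each bounds the success
    probability from a history on which the earlier stages went well.\<close>
  have claim4: "49 / 50 \<le> adaptive_expect P ?X m3 (l1 @ [v] @ l2) f"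
    if len: "length l1 = m1" "length l2 = m2" and T: "found n l1 \<subseteq> S" "mass (found n l1) \<le> \<epsilon>\<^sup>2 / 200"
      and good: "2 / 5 \<le> cmod (ip Q (reference n (found n l1) (xpart n v) l2) (\<lambda>y. ent U y (xpart n v)))"
    for l1 v l2
  proof -
    let ?T = "found n l1" and ?x0 = "xpart n v"
    let ?\<phi> = "reference n ?T ?x0 l2"
    have eq: "P ((l1 @ [v] @ l2) @ l) = p4 ?T ?x0 ?\<phi>" for l
      using len by (simp add: P_def p4_def stage_input_def stage_frame_def Let_def nth_append)
    interpret finite_dist "p4 ?T ?x0 ?\<phi>" ?X using dist[of "l1 @ [v] @ l2"] eq[of "[]"] by simp
    have cT: "card ?T \<le> k" using card_mono[of S ?T] T(1) S finite_subset by blast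
    have "adaptive_expect P ?X m3 (l1 @ [v] @ l2) f = iid_expect (p4 ?T ?x0 ?\<phi>) ?X m3 (\<lambda>l. f ((l1 @ [v] @ l2) @ l))"
      by (rule adaptive_expect_iid) (rule eq)
    moreover have "1 - 1 / 50 \<le> iid_expect (p4 ?T ?x0 ?\<phi>) ?X m3 (\<lambda>l. f ((l1 @ [v] @ l2) @ l))"
    proof (rule iid_expect_good)
      show "1 - 1 / 50 \<le> iid_expect (p4 ?T ?x0 ?\<phi>) ?X m3 (\<lambda>l. of_bool (fits n \<epsilon> ?T l U))"
        by (rule pauli_coefficients_learned[OF found_bound cT T(2) \<epsilon>(1) xpart_subset reference_norm[OF xpart_subset] good m3])
      show "1 \<le> f ((l1 @ [v] @ l2) @ l)" if "fits n \<epsilon> ?T l U" for l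
        using learned_close[OF that] \<epsilon> len by (simp add: f_def)
    qed (use f0 in auto)
    ultimately show ?thesis by simp
  qed

  have claim3: "48 / 50 \<le> adaptive_expect P ?X m2 (l1 @ [v]) (\<lambda>h. adaptive_expect P ?X m3 h f)"
    if len: "length l1 = m1" and T: "found n l1 \<subseteq> S" "mass (found n l1) \<le> \<epsilon>\<^sup>2 / 200"
      and good: "good_column (found n l1) v"
    for l1 v
  proof -
    let ?T = "found n l1" and ?x0 = "xpart n v"
    have eq: "P ((l1 @ [v]) @ l) = p3 ?T v" if "length l < m2" for l
      using len that by (simp add: P_def p3_def stage_input_def stage_frame_def Let_def nth_append)
    have "0 < m2"
    proof -
      have "(0::real) < 160000 * 4 ^ k" by simp
      then show ?thesis using m2 by linarith
    qed
    then interpret finite_dist "p3 ?T v" ?X using dist[of "l1 @ [v]"] eq[of "[]"] by simp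
    have finT: "finite ?T" using found_bound finite_subset by blast
    have cT: "card ?T \<le> k" using card_mono[of S ?T] T(1) S finite_subset by blast
    have "adaptive_expect P ?X m2 (l1 @ [v]) (\<lambda>h. adaptive_expect P ?X m3 h f)
        = iid_expect (p3 ?T v) ?X m2 (\<lambda>l. adaptive_expect P ?X m3 ((l1 @ [v]) @ l) f)"
      by (rule adaptive_expect_iid) (rule eq)
    moreover have "49 / 50 - 1 / 50 \<le> iid_expect (p3 ?T v) ?X m2 (\<lambda>l. adaptive_expect P ?X m3 ((l1 @ [v]) @ l) f)"
      by (rule iid_expect_good[OF reference_learned[OF finT cT good m2]])
         (use claim4[OF len _ T] E0[OF f0] in auto)
    ultimately show ?thesis by simp
  qed

  have claim2: "46 / 50 \<le> adaptive_expect P ?X 1 l1 (\<lambda>h. adaptive_expect P ?X m2 h (\<lambda>h. adaptive_expect P ?X m3 h f))"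
    if len: "length l1 = m1" and T: "found n l1 \<subseteq> S" "mass (found n l1) \<le> \<epsilon>\<^sup>2 / 200"
    for l1
  proof -
    let ?T = "found n l1"
    let ?g = "\<lambda>h. adaptive_expect P ?X m2 h (\<lambda>h. adaptive_expect P ?X m3 h f)"
    have eq: "P (l1 @ l) = p2" if "length l < 1" for l
      using len that by (simp add: P_def p2_def stage_input_def stage_frame_def Let_def)
    interpret finite_dist p2 ?X by (rule dist2)
    have "adaptive_expect P ?X 1 l1 ?g = iid_expect p2 ?X 1 (\<lambda>l. ?g (l1 @ l))"
      by (rule adaptive_expect_iid) (rule eq)
    moreover have "48 / 50 - 2 / 50 \<le> iid_expect p2 ?X 1 (\<lambda>l. ?g (l1 @ l))"
    proof (rule iid_expect_good)
      show "1 - 2 / 50 \<le> iid_expect p2 ?X 1 (\<lambda>l. of_bool (good_column ?T (hd l)))"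
        by (rule good_column_sampled) (use T(2) \<epsilon>2 in auto)
      show "48 / 50 \<le> ?g (l1 @ l)" if l: "length l = 1" "good_column ?T (hd l)" for l
      proof -
        obtain v where "l = [v]" using l(1) by (cases l) auto
        then show ?thesis using claim3[OF len T, of v] l(2) by simp
      qed
      show "0 \<le> ?g (l1 @ l)" for l by (rule E0[OF E0[OF f0]])
    qed simp_all
    ultimately show ?thesis by simp
  qed

  let ?g = "\<lambda>h. adaptive_expect P ?X 1 h (\<lambda>h. adaptive_expect P ?X m2 h (\<lambda>h. adaptive_expect P ?X m3 h f))"
  interpret finite_dist p1 ?X by (rule dist1)
  have "adaptive_expect P ?X (m1 + (1 + (m2 + m3))) [] f = adaptive_expect P ?X m1 [] ?g"
    by (simp only: adaptive_expect_add)
  also have "\<dots> = iid_expect p1 ?X m1 (\<lambda>l. ?g ([] @ l))"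
    by (rule adaptive_expect_iid) (simp add: P_def p1_def stage_input_def stage_frame_def Let_def)
  also have "46 / 50 - 1 / 50 \<le> \<dots>"
  proof (rule iid_expect_good)
    show "1 - 1 / 50 \<le> iid_expect p1 ?X m1 (\<lambda>l. of_bool (mass (found n l) \<le> \<epsilon>\<^sup>2 / 200))"
      by (rule relevant_qubits_found) (use \<epsilon> m1 in auto)
    show "46 / 50 \<le> ?g ([] @ l)"
      if "length l = m1" "\<And>x. x \<in> set l \<Longrightarrow> x \<in> ?X \<and> p1 x \<noteq> 0" "mass (found n l) \<le> \<epsilon>\<^sup>2 / 200" for l
      using claim2[OF that(1) _ that(3)] found_subset[OF that(2)] by simp
    show "0 \<le> ?g ([] @ l)" for l by (rule E0[OF E0[OF E0[OF f0]]])
  qed auto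
  finally show ?thesis by simp
qed

theorem mainTheorem5:
  shows "\<exists>C>0. \<forall>(n::nat) (k::nat) (\<epsilon>::real). \<epsilon> > 0 \<longrightarrow>
     (\<exists>M Ws out. valid_algorithm n M Ws out
        \<and> real (num_queries Ws) \<le> C * (real k / \<epsilon> + 4 ^ k / \<epsilon>\<^sup>2)
        \<and> (\<forall>U. quantum_junta n k U \<longrightarrow> success_prob U M Ws out \<epsilon> \<ge> 9/10))"
proof (rule exI[of _ 200000], intro conjI allI impI)
  fix n k :: nat and \<epsilon> :: real assume \<epsilon>: "\<epsilon> > 0"
  \<comment> \<open>The summand 1 keeps \<open>m1\<close> positive when
    \<open>k = 0\<close>.\<close>
  define m1 where "m1 = nat \<lceil>10000 * (real k + 1) / \<epsilon>\<^sup>2\<rceil>"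
  define m2 :: nat where "m2 = 160000 * 4 ^ k"
  define m3 where "m3 = nat \<lceil>20000 * 4 ^ k / \<epsilon>\<^sup>2\<rceil>"
  \<comment> \<open>For \<open>\<epsilon> > 1\<close> no query is made: every unitary is within
    distance 1.\<close>
  define q where "q = (if \<epsilon> \<le> 1 then m1 + (1 + (m2 + m3)) else 0)"
  define outf where "outf h = learned n \<epsilon> (found n (take m1 h)) (drop (m1 + 1 + m2) h)" for h
  interpret adaptive_queries n "Pow {..<n}" set_encode "Pow {..<n} \<times> UNIV" "outcomes n"
    "stage_input n m1 m2" "stage_frame n m1 m2"
    using bij_set_encode stage_input_norm[unfolded reg_def] tight_stage_frame
    by unfold_locales (auto simp: tight_frame_def reg_def)
  have prob: "out_prob U = (\<lambda>h. meas_dist n U (stage_input n m1 m2 h) (stage_frame n m1 m2 h))" for U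
    by (simp add: fun_eq_iff out_prob_def amp_def meas_dist_def queried_def apply_query_def reg_def)
  obtain M Ws out where alg: "valid_algorithm n M Ws out" "num_queries Ws = q"
    and succ: "\<And>U. U \<in> carrier_mat (2 ^ n) (2 ^ n) \<Longrightarrow> success_prob U M Ws out \<epsilon> =
      adaptive_expect (out_prob U) (outcomes n) q [] (\<lambda>h. if qdist U (outf h) \<le> \<epsilon> then 1 else 0)"
    using simulation[of outf q \<epsilon>] learned_unitary unfolding outf_def by blast
  have qb: "real q \<le> 200000 * (real k / \<epsilon> + 4 ^ k / \<epsilon>\<^sup>2)"
  proof (cases "\<epsilon> \<le> 1")
    case True
    define D where "D = 4 ^ k / \<epsilon>\<^sup>2"
    have e2: "0 < \<epsilon>\<^sup>2" "\<epsilon>\<^sup>2 \<le> 1" using \<epsilon> True by (auto simp: power_le_one)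
    have D4: "4 ^ k \<le> D" using e2 by (simp add: D_def field_simps)
    have D1: "1 \<le> D" using D4 one_le_power[of "4::real" k] by linarith
    have k4: "real k + 1 \<le> 4 ^ k"
    proof (induction k)
      case (Suc k)
      then show ?case by simp
    qed simp
    have "10000 * (real k + 1) / \<epsilon>\<^sup>2 \<le> 10000 * D"
      using k4 e2 by (simp add: D_def divide_right_mono)
    moreover have "real m1 \<le> 10000 * (real k + 1) / \<epsilon>\<^sup>2 + 1"
      unfolding m1_def using e2 by (simp add: of_nat_nat ceiling_le_iff)
    moreover have "real m3 \<le> 20000 * D + 1"
      unfolding m3_def D_def using e2 by simp
    moreover have "real m2 \<le> 160000 * D" using D4 by (simp add: m2_def)
    moreover have "0 \<le> real k / \<epsilon>" using \<epsilon> by simp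
    \<comment> \<open>The stages cost 10000, 160000 and 20000 multiples of \<open>D\<close>; two
      ceilings and the column sample add 3, which is at most \<open>3 * D\<close>.\<close>
    ultimately show ?thesis using True D1 by (simp add: q_def D_def[symmetric])
  qed (use \<epsilon> in \<open>simp add: q_def\<close>)
  have "9 / 10 \<le> success_prob U M Ws out \<epsilon>" if J: "quantum_junta n k U" for U
  proof -
    obtain S where props: "S \<subseteq> {..<n}" "card S = k" "is_unitary (2 ^ n) U"
      "\<And>y x. y \<subseteq> {..<n} \<Longrightarrow> x \<subseteq> {..<n} \<Longrightarrow> ent U y x \<noteq> 0 \<Longrightarrow> sdiff y x \<subseteq> S"
      "\<And>a c. a \<subseteq> {..<n} \<Longrightarrow> c \<subseteq> {..<n} \<Longrightarrow> pauli n U (a, c) \<noteq> 0 \<Longrightarrow> a \<union> c \<subseteq> S"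
      using junta_properties[OF J] by metis
    interpret learn_junta n k U S by unfold_locales (use props in auto)
    have U: "U \<in> carrier_mat (2 ^ n) (2 ^ n)" using props(3) by (simp add: is_unitary_def)
    show ?thesis
    proof (cases "\<epsilon> \<le> 1")
      case True
      have e2: "0 < \<epsilon>\<^sup>2" using \<epsilon> by simp
      have "10000 * (real k + 1) / \<epsilon>\<^sup>2 \<le> real m1" unfolding m1_def by (rule real_nat_ceiling_ge)
      then have *: "10000 * (real k + 1) \<le> \<epsilon>\<^sup>2 * real m1" using e2 by (simp add: field_simps)
      then have "0 < \<epsilon>\<^sup>2 * real m1" by (smt (verit) of_nat_0_le_iff)
      then have "0 < m1" using e2 by (simp add: zero_less_mult_iff)
      with * show ?thesis
        unfolding succ[OF U] prob outf_def using True
        by (simp only: q_def if_True)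
           (rule learning_success, use \<epsilon> in \<open>auto simp: m2_def m3_def real_nat_ceiling_ge\<close>)
    next
      case False
      have "qdist U (outf []) \<le> 1" by (rule qdist_le_1[OF props(3)]) (simp add: outf_def learned_unitary)
      then show ?thesis unfolding succ[OF U] using False by (simp add: q_def)
    qed
  qed
  then show "\<exists>M Ws out. valid_algorithm n M Ws out
        \<and> real (num_queries Ws) \<le> 200000 * (real k / \<epsilon> + 4 ^ k / \<epsilon>\<^sup>2)
        \<and> (\<forall>U. quantum_junta n k U \<longrightarrow> success_prob U M Ws out \<epsilon> \<ge> 9/10)"
    using alg qb by (intro exI[of _ M] exI[of _ Ws] exI[of _ out]) simp
qed simp

end
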